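(* Let $n\ge1$, $p,q>1$, and let $\Theta\subset\mathbb{R}^{n+1}$ be open and bounded. Suppose that $u$ is a viscosity supersolution and $v$ is a viscosity subsolution of $\partial_t u=\Delta_p^q u$ in $\Theta$. If $$\infty\neq\limsup_{\Theta\ni(y,s)\to(x,t)}v(y,s)\ \le\ \liminf_{\Theta\ni(y,s)\to(x,t)}u(y,s)\neq-\infty$$ for all $(x,t)\in\partial\Theta$ (the full Euclidean boundary), then $v\le u$ in $\Theta$.
   Context: Equation. Points of $\mathbb{R}^{n+1}$ are written $(x,t)$, and $\nabla$, $\Delta$, $D^2$ act in $x$ only. The equation is (E): $\partial_t u=\Delta_p^q u$, where for $\nabla u\neq 0$, $\Delta_p^q u=|\nabla u|^{q-p}\operatorname{div}(|\nabla u|^{p-2}\nabla u)=F(\nabla u,D^2u)$ with $F(\eta,X)=|\eta|^{q-2}\operatorname{Tr}\big(X+(p-2)\tfrac{\eta\otimes\eta}{|\eta|^2}X\big)$ for $\eta\in\mathbb{R}^n\setminus\{0\}$ and $X$ a symmetric $n\times n$ matrix. Admissible functions. $\mathcal{F}(F)$ is the set of $f\in C^2([0,\infty))$ with $f(0)=f'(0)=f''(0)=0$, $f''(r)>0$ for all $r>0$, and $\lim_{x\to 0,\,x\ne 0}F(\nabla g(x),D^2g(x))=0$ for $g(x)=f(|x|)$. $\Sigma$ is the set of even $\sigma\in C^1(\mathbb{R})$ with $\sigma(0)=\sigma'(0)=0$ and $\sigma(r)>0$ for $r>0$. A function $\varphi\in C^2(\Theta)$ is admissible at $(x_0,t_0)\in\Theta$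 if either $\nabla\varphi(x_0,t_0)\ne0$, or there are $\delta>0$, $f\in\mathcal{F}(F)$, $\sigma\in\Sigma$ such that $|\varphi(x,t)-\varphi(x_0,t_0)-\partial_t\varphi(x_0,t_0)(t-t_0)|\le f(|x-x_0|)+\sigma(t-t_0)$ for all $(x,t)\in B_\delta(x_0)\times(t_0-\delta,t_0+\delta)$. Viscosity super/subsolutions. $u:\Theta\to\mathbb{R}\cup\{\infty\}$ is a viscosity supersolution of (E) in $\Theta$ if (1) $u$ is lower semicontinuous; (2) $u$ is finite in a dense subset of $\Theta$; (3) whenever $\varphi\in C^2(\Theta)$ is admissible at $\xi\in\Theta$ and touches $u$ at $\xi$ from below (i.e. $\varphi(\xi)=u(\xi)$ and $\varphi<u$ in a punctured neighborhood of $\xi$), then $\partial_t\varphi(\xi)-\Delta_p^q\varphi(\xi)\ge0$ if $\nabla\varphi(\xi)\ne0$, and $\partial_t\varphi(\xi)\ge0$ if $\nabla\varphi(\xi)=0$. $v:\Theta\to\mathbb{R}\cup\{-\infty\}$ is a viscosity subsolution if $-v$ is a viscosity supersolution. *)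

theory Defs
  imports "HOL-Analysis.Analysis"
begin

text \<open>
  Points \<open>(x,t)\<close> of the \<open>(n+1)\<close>-dimensional space have type \<open>(real ^ 'n) \<times> real\<close>, where
  \<open>n = CARD('n)\<close> is an arbitrary positive integer.  The product norm is the Euclidean one.
\<close>

definition partial_deriv :: "'n \<Rightarrow> (real ^ 'n \<Rightarrow> real) \<Rightarrow> real ^ 'n \<Rightarrow> real" where
  "partial_deriv i w x = deriv (\<lambda>s. w (x + s *\<^sub>R axis i 1)) 0"

definition grad :: "(real ^ 'n \<Rightarrow> real) \<Rightarrow> real ^ 'n \<Rightarrow> real ^ 'n" where
  "grad w x = (\<chi> i. partial_deriv i w x)"

definition hessian :: "(real ^ 'n \<Rightarrow> real) \<Rightarrow> real ^ 'n \<Rightarrow> real ^ 'n ^ 'n" where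
  "hessian w x = (\<chi> i j. partial_deriv j (partial_deriv i w) x)"

definition divergence :: "(real ^ 'n \<Rightarrow> real ^ 'n) \<Rightarrow> real ^ 'n \<Rightarrow> real" where
  "divergence V x = (\<Sum>i\<in>UNIV. partial_deriv i (\<lambda>y. V y $ i) x)"

text \<open>Only used where \<open>grad w x \<noteq> 0\<close>.\<close>

definition pq_laplacian :: "real \<Rightarrow> real \<Rightarrow> (real ^ 'n \<Rightarrow> real) \<Rightarrow> real ^ 'n \<Rightarrow> real" where
  "pq_laplacian p q w x =
     norm (grad w x) powr (q - p) * divergence (\<lambda>y. norm (grad w y) powr (p - 2) *\<^sub>R grad w y) x"

definition outer :: "real ^ 'n \<Rightarrow> real ^ 'n \<Rightarrow> real ^ 'n ^ 'n" where
  "outer a b = (\<chi> i j. a $ i * b $ j)"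

definition pq_operator :: "real \<Rightarrow> real \<Rightarrow> real ^ 'n \<Rightarrow> real ^ 'n ^ 'n \<Rightarrow> real" where
  "pq_operator p q \<eta> X =
     norm \<eta> powr (q - 2) * trace (X + (p - 2) *\<^sub>R (((1 / (norm \<eta>)\<^sup>2) *\<^sub>R outer \<eta> \<eta>) ** X))"

definition C2_on :: "('a::real_normed_vector \<Rightarrow> real) \<Rightarrow> 'a set \<Rightarrow> bool" where
  "C2_on w S \<longleftrightarrow>
     (\<exists>(w' :: 'a \<Rightarrow> 'a \<Rightarrow>\<^sub>L real) (w'' :: 'a \<Rightarrow> 'a \<Rightarrow>\<^sub>L ('a \<Rightarrow>\<^sub>L real)).
        (\<forall>x\<in>S. (w has_derivative blinfun_apply (w' x)) (at x)) \<and>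
        (\<forall>x\<in>S. (w' has_derivative blinfun_apply (w'' x)) (at x)) \<and>
        continuous_on S w'')"

lemma partial_deriv_eqI:
  assumes "(w has_derivative w') (at x)"
  shows "partial_deriv i w x = w' (axis i 1)"
proof -
  have lin: "((\<lambda>s::real. x + s *\<^sub>R axis i 1) has_derivative (\<lambda>s. s *\<^sub>R axis i 1)) (at 0)"
    by (auto intro!: derivative_eq_intros)
  have "((\<lambda>s. w (x + s *\<^sub>R axis i 1)) has_derivative (\<lambda>s. w' (s *\<^sub>R axis i 1))) (at 0)"
    using has_derivative_compose[OF lin, of w w'] assms by simp
  moreover have "w' (s *\<^sub>R axis i 1) = w' (axis i 1) * s" for s
    using linear_scale[OF has_derivative_linear[OF assms], of s "axis i 1"] by simp
  ultimately have "((\<lambda>s. w (x + s *\<^sub>R axis i 1)) has_field_derivative w' (axis i 1)) (at 0)"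
    by (simp add: has_field_derivative_def)
  then show ?thesis
    unfolding partial_deriv_def by (rule DERIV_imp_deriv)
qed

text \<open>The divergence form and the trace form of the operator agree.\<close>

lemma pq_laplacian_eq_pq_operator:
  fixes w :: "real ^ 'n \<Rightarrow> real"
  assumes "open S" "x \<in> S" and C2: "C2_on w S" and nz: "grad w x \<noteq> 0"
  shows "pq_laplacian p q w x = pq_operator p q (grad w x) (hessian w x)"
proof -
  obtain w' :: "real ^ 'n \<Rightarrow> ((real ^ 'n) \<Rightarrow>\<^sub>L real)"
    and w'' :: "real ^ 'n \<Rightarrow> ((real ^ 'n) \<Rightarrow>\<^sub>L ((real ^ 'n) \<Rightarrow>\<^sub>L real))"
    where w': "\<And>y. y \<in> S \<Longrightarrow> (w has_derivative blinfun_apply (w' y)) (at y)"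
      and w'': "\<And>y. y \<in> S \<Longrightarrow> (w' has_derivative blinfun_apply (w'' y)) (at y)"
    using C2 unfolding C2_on_def by blast
  have pd: "w' y (axis i 1) = partial_deriv i w y" if "y \<in> S" for y i
    using partial_deriv_eqI[OF w'[OF that]] by simp
  have dpd: "(partial_deriv i w has_derivative (\<lambda>h. w'' x h (axis i 1))) (at x)" for i
  proof (rule has_derivative_transform_within_open[OF _ \<open>open S\<close> \<open>x \<in> S\<close>])
    show "((\<lambda>y. w' y (axis i 1)) has_derivative (\<lambda>h. w'' x h (axis i 1))) (at x)"
      by (rule bounded_linear.has_derivative[OF blinfun.bounded_linear_left w''[OF \<open>x \<in> S\<close>]])
  qed (rule pd)
  define N where "N = norm (grad w x)"
  have N: "N > 0" using nz by (simp add: N_def)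
  define g where "g i = partial_deriv i w x" for i
  define H where "H i j = hessian w x $ i $ j" for i j
  have H: "w'' x (axis j 1) (axis i 1) = H i j" for i j
    using partial_deriv_eqI[OF dpd[of i], of j] by (simp add: H_def hessian_def)
  have dgrad: "(grad w has_derivative (\<lambda>h. \<chi> i. w'' x h (axis i 1))) (at x)"
    unfolding grad_def
    by (rule has_derivative_componentwise_within[THEN iffD2])
       (auto simp: Basis_vec_def inner_axis intro!: dpd)
  have dnorm: "((\<lambda>y. norm (grad w y)) has_derivative
      (\<lambda>h. (\<chi> i. w'' x h (axis i 1)) \<bullet> sgn (grad w x))) (at x)"
    using has_derivative_compose[OF dgrad has_derivative_norm[OF nz]]
    by simp
  have dpow: "((\<lambda>y. norm (grad w y) powr (p - 2)) has_derivative
      (\<lambda>h. ((\<chi> i. w'' x h (axis i 1)) \<bullet> sgn (grad w x)) * ((p - 2) * N powr (p - 3)))) (at x)"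
  proof -
    have "((\<lambda>r. r powr (p - 2)) has_derivative (*) ((p - 2) * N powr (p - 3)))
        (at (norm (grad w x)))"
      using has_real_derivative_powr[OF N, of "p - 2"]
      by (simp add: has_field_derivative_def N_def)
    from has_derivative_compose[OF dnorm this] show ?thesis
      by (simp add: mult.commute)
  qed
  have dV: "partial_deriv i (\<lambda>y. norm (grad w y) powr (p - 2) * partial_deriv i w y) x
      = N powr (p - 2) * H i i + (p - 2) * N powr (p - 4) * (\<Sum>j\<in>UNIV. g i * g j * H j i)" for i
  proof -
    have sc: "(\<chi> k. H k i) \<bullet> sgn (grad w x) = (\<Sum>j\<in>UNIV. g j * H j i) / N"
      by (simp add: sgn_div_norm inner_vec_def grad_def g_def N_def divide_inverse
          sum_distrib_left sum_distrib_right mult_ac)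
    have "N powr (p - 3) = N powr (p - 4) * N"
      using powr_mult_base[of N "p - 4"] N by (simp add: mult.commute)
    then show ?thesis
      using partial_deriv_eqI[OF has_derivative_mult[OF dpow dpd[of i]], of i] N
      by (simp add: H sc N_def[symmetric] g_def[symmetric] sum_distrib_left sum_divide_distrib mult_ac)
  qed
  have dgl: "divergence (\<lambda>y. norm (grad w y) powr (p - 2) *\<^sub>R grad w y) x
      = N powr (p - 2) * (\<Sum>i\<in>UNIV. H i i)
        + (p - 2) * N powr (p - 4) * (\<Sum>i\<in>UNIV. \<Sum>j\<in>UNIV. g i * g j * H j i)"
  proof -
    have "divergence (\<lambda>y. norm (grad w y) powr (p - 2) *\<^sub>R grad w y) x
      = (\<Sum>i\<in>UNIV. partial_deriv i (\<lambda>y. norm (grad w y) powr (p - 2) * partial_deriv i w y) x)"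
      by (simp add: divergence_def) (simp add: grad_def)
    then show ?thesis
      by (simp add: dV sum.distrib sum_distrib_left)
  qed
  have tr: "trace (hessian w x + (p - 2) *\<^sub>R
        (((1 / (norm (grad w x))\<^sup>2) *\<^sub>R outer (grad w x) (grad w x)) ** hessian w x))
      = (\<Sum>i\<in>UNIV. H i i) + (p - 2) / N\<^sup>2 * (\<Sum>i\<in>UNIV. \<Sum>j\<in>UNIV. g i * g j * H j i)"
    by (simp add: trace_def matrix_matrix_mult_def outer_def H_def g_def N_def grad_def
        sum.distrib sum_distrib_left mult_ac)
  have e1: "N powr (q - p) * N powr (p - 2) = N powr (q - 2)"
    by (simp add: powr_add[symmetric])
  have e2: "N powr (q - p) * N powr (p - 4) = N powr (q - 2) / N\<^sup>2"
    using N by (simp add: powr_add[symmetric] powr_diff[of N "q - 2" 2, simplified])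
  have "pq_laplacian p q w x = N powr (q - p) * N powr (p - 2) * (\<Sum>i\<in>UNIV. H i i)
     + (p - 2) * (N powr (q - p) * N powr (p - 4)) * (\<Sum>i\<in>UNIV. \<Sum>j\<in>UNIV. g i * g j * H j i)"
    by (simp add: pq_laplacian_def dgl N_def[symmetric] algebra_simps)
  then show ?thesis
    unfolding e1 e2 pq_operator_def tr by (simp add: N_def[symmetric] algebra_simps)
qed

definition admissible_profiles :: "(real ^ 'n \<Rightarrow> real ^ 'n ^ 'n \<Rightarrow> real) \<Rightarrow> (real \<Rightarrow> real) set" where
  "admissible_profiles F = {f. \<exists>f' f''.
     (\<forall>r\<ge>0. (f has_real_derivative f' r) (at r within {0..})) \<and>
     (\<forall>r\<ge>0. (f' has_real_derivative f'' r) (at r within {0..})) \<and>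
     continuous_on {0..} f'' \<and>
     f 0 = 0 \<and> f' 0 = 0 \<and> f'' 0 = 0 \<and> (\<forall>r>0. f'' r > 0) \<and>
     (let g = (\<lambda>x. f (norm x)) in ((\<lambda>x. F (grad g x) (hessian g x)) \<longlongrightarrow> 0) (at 0))}"

definition time_moduli :: "(real \<Rightarrow> real) set" where
  "time_moduli = {\<sigma>. (\<forall>r. \<sigma> (- r) = \<sigma> r) \<and>
     (\<exists>\<sigma>'. (\<forall>r. (\<sigma> has_real_derivative \<sigma>' r) (at r)) \<and> continuous_on UNIV \<sigma>' \<and>
           \<sigma> 0 = 0 \<and> \<sigma>' 0 = 0) \<and>
     (\<forall>r>0. \<sigma> r > 0)}"

definition space_grad :: "((real ^ 'n) \<times> real \<Rightarrow> real) \<Rightarrow> (real ^ 'n) \<times> real \<Rightarrow> real ^ 'n" where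
  "space_grad \<phi> = (\<lambda>(x, t). grad (\<lambda>y. \<phi> (y, t)) x)"

definition space_pq_laplacian ::
    "real \<Rightarrow> real \<Rightarrow> ((real ^ 'n) \<times> real \<Rightarrow> real) \<Rightarrow> (real ^ 'n) \<times> real \<Rightarrow> real" where
  "space_pq_laplacian p q \<phi> = (\<lambda>(x, t). pq_laplacian p q (\<lambda>y. \<phi> (y, t)) x)"

definition time_deriv :: "((real ^ 'n) \<times> real \<Rightarrow> real) \<Rightarrow> (real ^ 'n) \<times> real \<Rightarrow> real" where
  "time_deriv \<phi> = (\<lambda>(x, t). deriv (\<lambda>s. \<phi> (x, s)) t)"

text \<open>
  Test functions are total, but only their values near \<open>(x0,t0)\<close> matter: the condition for
  some \<open>\<delta>\<close> implies the one for every smaller \<open>\<delta>\<close>.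
\<close>

definition admissible_at ::
    "real \<Rightarrow> real \<Rightarrow> ((real ^ 'n) \<times> real \<Rightarrow> real) \<Rightarrow> (real ^ 'n) \<times> real \<Rightarrow> bool" where
  "admissible_at p q \<phi> = (\<lambda>(x0, t0).
     space_grad \<phi> (x0, t0) \<noteq> 0 \<or>
     (\<exists>\<delta>>0. \<exists>f \<in> admissible_profiles (pq_operator p q :: real ^ 'n \<Rightarrow> real ^ 'n ^ 'n \<Rightarrow> real).
        \<exists>\<sigma> \<in> time_moduli. \<forall>x \<in> ball x0 \<delta>. \<forall>t \<in> {t0 - \<delta><..<t0 + \<delta>}.
          \<bar>\<phi> (x, t) - \<phi> (x0, t0) - time_deriv \<phi> (x0, t0) * (t - t0)\<bar>
            \<le> f (norm (x - x0)) + \<sigma> (t - t0)))"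

definition lower_semicontinuous_on :: "'a::topological_space set \<Rightarrow> ('a \<Rightarrow> ereal) \<Rightarrow> bool" where
  "lower_semicontinuous_on S u \<longleftrightarrow> (\<forall>\<xi>\<in>S. u \<xi> \<le> Liminf (at \<xi> within S) u)"

definition touches_from_below :: "('a::topological_space \<Rightarrow> real) \<Rightarrow> ('a \<Rightarrow> ereal) \<Rightarrow> 'a \<Rightarrow> bool" where
  "touches_from_below \<phi> u \<xi> \<longleftrightarrow>
     ereal (\<phi> \<xi>) = u \<xi> \<and> (\<forall>\<^sub>F \<zeta> in at \<xi>. ereal (\<phi> \<zeta>) < u \<zeta>)"

text \<open>
  The first conjunct expresses that \<open>u\<close> maps \<open>\<Theta>\<close> to the reals extended by \<open>\<infinity>\<close>.
\<close>

definition viscosity_supersolution ::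
    "real \<Rightarrow> real \<Rightarrow> ((real ^ 'n) \<times> real) set \<Rightarrow> ((real ^ 'n) \<times> real \<Rightarrow> ereal) \<Rightarrow> bool" where
  "viscosity_supersolution p q \<Theta> u \<longleftrightarrow>
     (\<forall>\<xi>\<in>\<Theta>. u \<xi> \<noteq> -\<infinity>) \<and>
     lower_semicontinuous_on \<Theta> u \<and>
     \<Theta> \<subseteq> closure {\<xi>\<in>\<Theta>. \<bar>u \<xi>\<bar> \<noteq> \<infinity>} \<and>
     (\<forall>\<phi>. \<forall>\<xi>\<in>\<Theta>. C2_on \<phi> \<Theta> \<and> admissible_at p q \<phi> \<xi> \<and> touches_from_below \<phi> u \<xi> \<longrightarrow>
        (space_grad \<phi> \<xi> \<noteq> 0 \<longrightarrow> time_deriv \<phi> \<xi> - space_pq_laplacian p q \<phi> \<xi> \<ge> 0) \<and>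
        (space_grad \<phi> \<xi> = 0 \<longrightarrow> time_deriv \<phi> \<xi> \<ge> 0))"

definition viscosity_subsolution ::
    "real \<Rightarrow> real \<Rightarrow> ((real ^ 'n) \<times> real) set \<Rightarrow> ((real ^ 'n) \<times> real \<Rightarrow> ereal) \<Rightarrow> bool" where
  "viscosity_subsolution p q \<Theta> v \<longleftrightarrow> viscosity_supersolution p q \<Theta> (\<lambda>\<xi>. - v \<xi>)"

end

theory Submission
  imports Defs "HOL-Complex_Analysis.Great_Picard"
begin

text \<open>
  The operator is linear in the Hessian, so the comparison principle does not need the theorem on
  sums of Crandall and Ishii.  Doubling the variables with the penalty \<open>j (|x - y|\<^sup>2\<^sup>M + (t - s)\<^sup>2)\<close>,
  with \<open>M\<close> large, gives points of contact.  If they have the same space coordinate, the penalty is an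
  admissible test function for both sides, and the time derivatives contradict each other.  Otherwise
  the gradient \<open>\<eta>\<close> at the contact is nonzero.  The two functions, rescaled around their points of
  contact after subtracting the common affine part, are separated by a sup-convolution that is
  equi-Lipschitz in the scale; by the theorem of Arzela and Ascoli its restriction to an ellipsoid
  converges along a sequence of scales.  Its boundary values are approximated by a polynomial, which
  extends into the ellipsoid as a polynomial solution of the equation linearised at \<open>\<eta>\<close>.  Since the
  supersolution was made strict, two small modifications of this solution are classical strict barriers
  for the two functions at all small scales, but they are in the wrong order at the point of contact.
\<close>

subsection \<open>Calculus of polynomial functions\<close>

text \<open>Time and space are rescaled by the same factor \<open>r\<close>, not parabolically. A
  barrier with increment \<open>r * (\<eta> \<bullet> x) + r * \<theta> * \<tau> + r\<^sup>2 * (H x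
  - K * \<tau>\<^sup>2)\<close> then has gradient \<eta> + O(r), the Hessian of \<open>H\<close>,
  and time derivative \<theta> + O(r). In the limit time is a mere parameter, and what remains is an
  elliptic equation with constant coefficients, the same for both functions since both have gradient
  \<eta>. The ends of the time interval are absorbed by a large \<open>K\<close>, at no cost in the
  limit. The strictness \<epsilon> becomes a gap between the two right-hand sides, \<theta> for
  \<open>v\<close> and \<theta> - \<epsilon> for \<open>u\<close>. The obstacle is the order of the
  choices: how small \<open>r\<close> must be depends on the barriers, the barriers depend on the
  separating function, and that depends on \<open>r\<close>. Compactness breaks this circle. The
  ellipsoid is a sublevel set of the quadratic form inverse to the coefficient matrix. In that
  geometry the Dirichlet problem with polynomial data is solved by linear algebra on homogeneous
  polynomials, so no existence or regularity theory for elliptic equations enters.\<close>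

lemma polynomial_derivative:
  fixes f :: "'a::euclidean_space \<Rightarrow> real"
  assumes "real_polynomial_function f"
  shows "\<exists>d. (\<forall>b\<in>Basis. real_polynomial_function (d b)) \<and>
    (\<forall>x. (f has_derivative (\<lambda>h. \<Sum>b\<in>Basis. (h \<bullet> b) * d b x)) (at x))"
  using assms
proof induction
  case (linear f)
  have "(f has_derivative (\<lambda>h. \<Sum>b\<in>Basis. (h \<bullet> b) * f b)) (at x)" for x
  proof -
    have "f h = (\<Sum>b\<in>Basis. (h \<bullet> b) * f b)" for h
      using linear_sum[OF bounded_linear.linear[OF linear], of "\<lambda>b. (h \<bullet> b) *\<^sub>R b" Basis]
      by (simp add: euclidean_representation linear_scale[OF bounded_linear.linear[OF linear]])
    then have "f = (\<lambda>h. \<Sum>b\<in>Basis. (h \<bullet> b) * f b)" by blast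
    then show ?thesis
      using bounded_linear.has_derivative[OF linear has_derivative_ident, of "at x"] by simp
  qed
  then show ?case
    by (intro exI[of _ "\<lambda>b x. f b"]) auto
next
  case (const c)
  show ?case by (intro exI[of _ "\<lambda>b x. 0"]) auto
next
  case (add f g)
  then obtain d e where
    d: "\<And>b. b \<in> Basis \<Longrightarrow> real_polynomial_function (d b)"
      "\<And>x. (f has_derivative (\<lambda>h. \<Sum>b\<in>Basis. (h \<bullet> b) * d b x)) (at x)" and
    e: "\<And>b. b \<in> Basis \<Longrightarrow> real_polynomial_function (e b)"
      "\<And>x. (g has_derivative (\<lambda>h. \<Sum>b\<in>Basis. (h \<bullet> b) * e b x)) (at x)"
    by blast
  have "((\<lambda>x. f x + g x) has_derivative (\<lambda>h. \<Sum>b\<in>Basis. (h \<bullet> b) * (d b x + e b x))) (at x)" for x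
    by (rule has_derivative_eq_rhs[OF has_derivative_add[OF d(2) e(2)]])
       (simp add: sum.distrib algebra_simps)
  then show ?case
    by (intro exI[of _ "\<lambda>b x. d b x + e b x"]) (auto simp: d e)
next
  case (mult f g)
  then obtain d e where
    d: "\<And>b. b \<in> Basis \<Longrightarrow> real_polynomial_function (d b)"
      "\<And>x. (f has_derivative (\<lambda>h. \<Sum>b\<in>Basis. (h \<bullet> b) * d b x)) (at x)" and
    e: "\<And>b. b \<in> Basis \<Longrightarrow> real_polynomial_function (e b)"
      "\<And>x. (g has_derivative (\<lambda>h. \<Sum>b\<in>Basis. (h \<bullet> b) * e b x)) (at x)"
    by blast
  have "((\<lambda>x. f x * g x) has_derivative
      (\<lambda>h. \<Sum>b\<in>Basis. (h \<bullet> b) * (f x * e b x + d b x * g x))) (at x)" for x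
    by (rule has_derivative_eq_rhs[OF has_derivative_mult[OF d(2) e(2)]])
       (simp add: sum.distrib sum_distrib_left sum_distrib_right algebra_simps)
  then show ?case
    using mult.hyps d(1) e(1)
    by (intro exI[of _ "\<lambda>b x. f x * e b x + d b x * g x"])
       (simp add: real_polynomial_function.intros(3,4))
qed

lemma polynomial_continuous_on:
  fixes f :: "'a::euclidean_space \<Rightarrow> real"
  shows "real_polynomial_function f \<Longrightarrow> continuous_on S f"
  by (simp add: continuous_on_polymonial_function real_polynomial_function_eq)

text \<open>Every test function below is a polynomial in space and time, so this settles the
  smoothness requirement on test functions once and for all.\<close>

lemma polynomial_C2_on:
  fixes f :: "'a::euclidean_space \<Rightarrow> real"
  assumes "real_polynomial_function f"
  shows "C2_on f S"
proof -
  obtain d where d: "\<And>b. b \<in> Basis \<Longrightarrow> real_polynomial_function (d b)"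
      "\<And>x. (f has_derivative (\<lambda>h. \<Sum>b\<in>Basis. (h \<bullet> b) * d b x)) (at x)"
    using polynomial_derivative[OF assms] by blast
  have "\<forall>b\<in>Basis. \<exists>e. (\<forall>c\<in>Basis. real_polynomial_function (e c)) \<and>
    (\<forall>x. (d b has_derivative (\<lambda>h. \<Sum>c\<in>Basis. (h \<bullet> c) * e c x)) (at x))"
    using polynomial_derivative d(1) by blast
  from bchoice[OF this] obtain e where
    e: "\<And>b c. b \<in> Basis \<Longrightarrow> c \<in> Basis \<Longrightarrow> real_polynomial_function (e b c)"
      "\<And>b x. b \<in> Basis \<Longrightarrow> (d b has_derivative (\<lambda>h. \<Sum>c\<in>Basis. (h \<bullet> c) * e b c x)) (at x)"
    by blast
  define w' :: "'a \<Rightarrow> 'a \<Rightarrow>\<^sub>L real" where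
    "w' x = (\<Sum>b\<in>Basis. d b x *\<^sub>R blinfun_inner_left b)" for x
  define w'' :: "'a \<Rightarrow> 'a \<Rightarrow>\<^sub>L ('a \<Rightarrow>\<^sub>L real)" where
    "w'' x = (\<Sum>b\<in>Basis. \<Sum>c\<in>Basis. e b c x *\<^sub>R
       (blinfun_scaleR_left (blinfun_inner_left b) o\<^sub>L blinfun_inner_left c))" for x
  have "(f has_derivative blinfun_apply (w' x)) (at x)" for x
    by (rule has_derivative_eq_rhs[OF d(2)])
       (auto simp: w'_def blinfun.sum_left blinfun.scaleR_left inner_commute mult.commute)
  moreover have "(w' has_derivative blinfun_apply (w'' x)) (at x)" for x
  proof -
    have "((\<lambda>x. \<Sum>b\<in>Basis. d b x *\<^sub>R blinfun_inner_left b) has_derivative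
        (\<lambda>h. \<Sum>b\<in>Basis. (\<Sum>c\<in>Basis. (h \<bullet> c) * e b c x) *\<^sub>R blinfun_inner_left b)) (at x)"
      by (intro has_derivative_sum has_derivative_scaleR_left e(2))
    then show ?thesis
      unfolding w'_def[abs_def]
      by (rule has_derivative_eq_rhs)
         (auto simp: w''_def blinfun.sum_left blinfun.scaleR_left scaleR_sum_left
             inner_commute mult.commute intro!: sum.cong)
  qed
  moreover have "continuous_on S w''"
    unfolding w''_def[abs_def]
    by (intro continuous_intros polynomial_continuous_on e(1))
  ultimately show ?thesis
    unfolding C2_on_def by blast
qed

lemma polynomial_component [intro]: "real_polynomial_function (\<lambda>x::real^'n. x $ i)"
  by (rule real_polynomial_function.intros(1)) (rule bounded_linear_vec_nth)

lemma axis_expansion: "(h::real^'n) = (\<Sum>i\<in>UNIV. (h $ i) *\<^sub>R axis i 1)"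
  using basis_expansion[of h] by (simp add: scalar_mult_eq_scaleR)

text \<open>As \<open>partial_deriv\<close> rests on \<open>deriv\<close>, its sum and product rules
  need differentiability. For polynomials this is automatic, and since their partial derivatives are
  polynomials again, the rules iterate up to the Hessian.\<close>

lemma polynomial_has_derivative_grad:
  fixes f :: "real ^ 'n \<Rightarrow> real"
  assumes "real_polynomial_function f"
  shows "(f has_derivative (\<lambda>h. h \<bullet> grad f x)) (at x)"
    and polynomial_partial_deriv: "real_polynomial_function (partial_deriv i f)"
proof -
  obtain d where d: "\<And>b. b \<in> Basis \<Longrightarrow> real_polynomial_function (d b)"
      "\<And>x. (f has_derivative (\<lambda>h. \<Sum>b\<in>Basis. (h \<bullet> b) * d b x)) (at x)"
    using polynomial_derivative[OF assms] by blast
  have pd: "partial_deriv i f x = d (axis i 1) x" for i x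
  proof -
    have "(\<Sum>b\<in>Basis. (axis i 1 \<bullet> b) * d b x) = (\<Sum>b\<in>Basis. if b = axis i 1 then d b x else 0)"
      by (intro sum.cong refl) (auto simp: inner_Basis)
    also have "\<dots> = d (axis i 1) x" by simp
    finally show ?thesis using partial_deriv_eqI[OF d(2)[of x], of i] by simp
  qed
  then have "partial_deriv i f = d (axis i 1)" by auto
  then show "real_polynomial_function (partial_deriv i f)" using d(1) by simp
  show "(f has_derivative (\<lambda>h. h \<bullet> grad f x)) (at x)"
  proof (rule has_derivative_eq_rhs[OF d(2)], rule ext)
    fix h :: "real^'n"
    have "linear (\<lambda>h. \<Sum>b\<in>Basis. (h \<bullet> b) * d b x)"
      by (rule has_derivative_linear[OF d(2)])
    from linear_sum[OF this, of "\<lambda>i. (h $ i) *\<^sub>R axis i 1" UNIV] linear_scale[OF this]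
    have "(\<Sum>b\<in>Basis. (h \<bullet> b) * d b x) = (\<Sum>i\<in>UNIV. h $ i * (\<Sum>b\<in>Basis. (axis i 1 \<bullet> b) * d b x))"
      by (simp flip: axis_expansion)
    also have "\<dots> = h \<bullet> grad f x"
      using partial_deriv_eqI[OF d(2)[of x]] by (simp add: inner_vec_def grad_def)
    finally show "(\<Sum>b\<in>Basis. (h \<bullet> b) * d b x) = h \<bullet> grad f x" .
  qed
qed

lemma partial_deriv_add:
  fixes f g :: "real ^ 'n \<Rightarrow> real"
  assumes "real_polynomial_function f" "real_polynomial_function g"
  shows "partial_deriv i (\<lambda>x. f x + g x) = (\<lambda>x. partial_deriv i f x + partial_deriv i g x)"
proof
  fix x
  show "partial_deriv i (\<lambda>x. f x + g x) x = partial_deriv i f x + partial_deriv i g x"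
    using partial_deriv_eqI[OF has_derivative_add[OF polynomial_has_derivative_grad(1)[OF assms(1)]
      polynomial_has_derivative_grad(1)[OF assms(2)]]] by (simp add: grad_def inner_axis')
qed

lemma partial_deriv_mult:
  fixes f g :: "real ^ 'n \<Rightarrow> real"
  assumes "real_polynomial_function f" "real_polynomial_function g"
  shows "partial_deriv i (\<lambda>x. f x * g x) = (\<lambda>x. f x * partial_deriv i g x + partial_deriv i f x * g x)"
proof
  fix x
  show "partial_deriv i (\<lambda>x. f x * g x) x = f x * partial_deriv i g x + partial_deriv i f x * g x"
    using partial_deriv_eqI[OF has_derivative_mult[OF polynomial_has_derivative_grad(1)[OF assms(1)]
      polynomial_has_derivative_grad(1)[OF assms(2)]]] by (simp add: grad_def inner_axis')
qed

lemma partial_deriv_const: "partial_deriv i (\<lambda>x::real^'n. c) = (\<lambda>x. 0)"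
  using partial_deriv_eqI[OF has_derivative_const] by fastforce

lemma partial_deriv_component: "partial_deriv i (\<lambda>x::real^'n. x $ j) = (\<lambda>x. if i = j then 1 else 0)"
proof
  fix x :: "real^'n"
  show "partial_deriv i (\<lambda>x::real^'n. x $ j) x = (if i = j then 1 else 0)"
    by (subst partial_deriv_eqI[OF bounded_linear.has_derivative[OF bounded_linear_vec_nth has_derivative_ident]])
       (auto simp: axis_def)
qed

lemma partial_deriv_cmult:
  fixes f :: "real ^ 'n \<Rightarrow> real"
  assumes "real_polynomial_function f"
  shows "partial_deriv i (\<lambda>x. c * f x) = (\<lambda>x. c * partial_deriv i f x)"
  using partial_deriv_mult[OF real_polynomial_function.intros(2) assms] by (simp add: partial_deriv_const)

lemma partial_deriv_sum:
  fixes f :: "'b \<Rightarrow> real ^ 'n \<Rightarrow> real"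
  assumes "finite I" "\<And>k. k \<in> I \<Longrightarrow> real_polynomial_function (f k)"
  shows "partial_deriv i (\<lambda>x. \<Sum>k\<in>I. f k x) = (\<lambda>x. \<Sum>k\<in>I. partial_deriv i (f k) x)"
  using assms
proof (induction I)
  case (insert k I)
  then show ?case
    using partial_deriv_add[of "f k" "\<lambda>x. \<Sum>k\<in>I. f k x"]
    by (simp add: real_polynomial_function_sum)
qed (simp add: partial_deriv_const)

text \<open>The equation with frozen coefficients: \<open>a\<close> will be
  \<open>pq_coeff p q\<close> at one fixed vector, either the contact gradient \<eta> or the
  gradient of a test function at its point of contact.\<close>

definition lin_op :: "('n \<Rightarrow> 'n \<Rightarrow> real) \<Rightarrow> (real ^ 'n \<Rightarrow> real) \<Rightarrow> real ^ 'n \<Rightarrow> real" where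
  "lin_op a f x = (\<Sum>i\<in>UNIV. \<Sum>j\<in>UNIV. a i j * hessian f x $ i $ j)"

lemma lin_op_add:
  fixes f g :: "real ^ 'n \<Rightarrow> real"
  assumes "real_polynomial_function f" "real_polynomial_function g"
  shows "lin_op a (\<lambda>x. f x + g x) = (\<lambda>x. lin_op a f x + lin_op a g x)"
  using assms
  by (auto simp: lin_op_def hessian_def partial_deriv_add polynomial_partial_deriv sum.distrib
      algebra_simps)

lemma lin_op_cmult:
  fixes f :: "real ^ 'n \<Rightarrow> real"
  assumes "real_polynomial_function f"
  shows "lin_op a (\<lambda>x. c * f x) = (\<lambda>x. c * lin_op a f x)"
  using assms
  by (auto simp: lin_op_def hessian_def partial_deriv_cmult polynomial_partial_deriv
      sum_distrib_left algebra_simps)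

lemma lin_op_const: "lin_op a (\<lambda>x::real^'n. c) = (\<lambda>x. 0)"
  by (auto simp: lin_op_def hessian_def partial_deriv_const)

lemma lin_op_mult:
  fixes f g :: "real ^ 'n \<Rightarrow> real"
  assumes "real_polynomial_function f" "real_polynomial_function g"
    and sym: "\<And>i j. a i j = a j i"
  shows "lin_op a (\<lambda>x. f x * g x) = (\<lambda>x. f x * lin_op a g x + g x * lin_op a f x
    + 2 * (\<Sum>i\<in>UNIV. \<Sum>j\<in>UNIV. a i j * partial_deriv i f x * partial_deriv j g x))"
proof
  fix x
  have "(\<Sum>i\<in>UNIV. \<Sum>j\<in>UNIV. a i j * partial_deriv j f x * partial_deriv i g x)
     = (\<Sum>i\<in>UNIV. \<Sum>j\<in>UNIV. a i j * partial_deriv i f x * partial_deriv j g x)"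
    by (subst sum.swap) (simp add: sym)
  then show "lin_op a (\<lambda>x. f x * g x) x = f x * lin_op a g x + g x * lin_op a f x
    + 2 * (\<Sum>i\<in>UNIV. \<Sum>j\<in>UNIV. a i j * partial_deriv i f x * partial_deriv j g x)"
    using assms
    by (simp add: lin_op_def hessian_def partial_deriv_add partial_deriv_mult polynomial_partial_deriv
      real_polynomial_function.intros(4) sum_distrib_left sum.distrib algebra_simps)
qed

subsection \<open>Extension from the boundary of an ellipsoid\<close>

text \<open>Generating these functions by rules, rather than by the scaling law, yields
  polynomiality, Euler's identity and the drop of the degree under differentiation by plain
  induction. The zero function has every degree.\<close>

inductive homogeneous :: "nat \<Rightarrow> (real ^ 'n \<Rightarrow> real) \<Rightarrow> bool" where
  const: "homogeneous 0 (\<lambda>x. c)"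
| component: "homogeneous d f \<Longrightarrow> homogeneous (Suc d) (\<lambda>x. x $ i * f x)"
| add: "homogeneous d f \<Longrightarrow> homogeneous d g \<Longrightarrow> homogeneous d (\<lambda>x. f x + g x)"

lemma homogeneous_polynomial:
  "homogeneous d f \<Longrightarrow> real_polynomial_function f"
  by (induction rule: homogeneous.induct) auto

lemma homogeneous_zero: "homogeneous d (\<lambda>x::real^'n. 0)"
proof (induction d)
  case (Suc d)
  then show ?case
    using homogeneous.component[OF Suc] by simp
qed (rule homogeneous.const)

lemma homogeneous_cmult:
  "homogeneous d f \<Longrightarrow> homogeneous d (\<lambda>x. c * f x)"
proof (induction rule: homogeneous.induct)
  case (component d f i)
  then show ?case
    using homogeneous.component[of d "\<lambda>x. c * f x" i] by (simp add: mult.left_commute)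
next
  case (add d f g)
  then show ?case
    using homogeneous.add by (force simp: distrib_left)
qed (rule homogeneous.const)

lemma homogeneous_mult:
  "homogeneous d f \<Longrightarrow> homogeneous e g \<Longrightarrow> homogeneous (d + e) (\<lambda>x. f x * g x)"
proof (induction rule: homogeneous.induct)
  case (component d f i)
  then show ?case
    using homogeneous.component[of "d + e" "\<lambda>x. f x * g x" i] by (simp add: mult.assoc)
next
  case (add d f h)
  then show ?case
    using homogeneous.add[of "d + e" "\<lambda>x. f x * g x" "\<lambda>x. h x * g x"]
    by (simp add: distrib_right)
qed (simp add: homogeneous_cmult)

lemma homogeneous_diff:
  assumes "homogeneous d f" "homogeneous d g"
  shows "homogeneous d (\<lambda>x. f x - g x)"
  using homogeneous.add[OF assms(1) homogeneous_cmult[OF assms(2), of "-1"]] by simp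

lemma homogeneous_power:
  assumes "homogeneous d f"
  shows "homogeneous (s * d) (\<lambda>x. f x ^ s)"
proof (induction s)
  case (Suc s)
  then show ?case using homogeneous_mult[OF assms Suc] by simp
qed (simp add: homogeneous.const)

lemma homogeneous_sum:
  assumes "finite I" "\<And>k. k \<in> I \<Longrightarrow> homogeneous d (f k)"
  shows "homogeneous d (\<lambda>x. \<Sum>k\<in>I. f k x)"
  using assms by (induction I) (auto simp: homogeneous_zero homogeneous.add)

text \<open>The split on \<open>d\<close> is needed because the degree is a natural number: in
  degree 0 the derivative vanishes instead of having degree -1. Both cases are carried through one
  induction, since \<open>component\<close> in degree 1 relies on degree 0.\<close>

lemma homogeneous_partial_deriv:
  "homogeneous d f \<Longrightarrow>
    (case d of 0 \<Rightarrow> partial_deriv i f = (\<lambda>x. 0) | Suc e \<Rightarrow> homogeneous e (partial_deriv i f))"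
proof (induction rule: homogeneous.induct)
  case (const c)
  show ?case by (simp add: partial_deriv_const)
next
  case (component d f j)
  have "partial_deriv i (\<lambda>x. x $ j * f x) = (\<lambda>x. x $ j * partial_deriv i f x + (if i = j then 1 else 0) * f x)"
    by (subst partial_deriv_mult)
       (use component.hyps homogeneous_polynomial in \<open>auto simp: partial_deriv_component\<close>)
  moreover have "homogeneous d (\<lambda>x. x $ j * partial_deriv i f x)"
    using component.IH
    by (cases d) (auto simp: homogeneous_zero homogeneous.component)
  ultimately show ?case
    using component.hyps by (simp add: homogeneous.add homogeneous_cmult)
next
  case (add d f g)
  then show ?case
    by (simp add: partial_deriv_add homogeneous_polynomial homogeneous.add split: nat.splits)
qed

lemma homogeneous_0_partial_deriv:
  "homogeneous 0 f \<Longrightarrow> partial_deriv i f = (\<lambda>x. 0)"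
  using homogeneous_partial_deriv[of 0] by simp

lemma homogeneous_Suc_partial_deriv:
  "homogeneous (Suc d) f \<Longrightarrow> homogeneous d (partial_deriv i f)"
  using homogeneous_partial_deriv[of "Suc d"] by simp

lemma homogeneous_euler:
  "homogeneous d f \<Longrightarrow> (\<Sum>i\<in>UNIV. x $ i * partial_deriv i f x) = real d * f x"
proof (induction rule: homogeneous.induct)
  case (const c)
  show ?case by (simp add: partial_deriv_const)
next
  case (component d f j)
  have *: "partial_deriv i (\<lambda>x. x $ j * f x) = (\<lambda>x. x $ j * partial_deriv i f x + (if i = j then 1 else 0) * f x)" for i
    by (subst partial_deriv_mult)
       (use component.hyps homogeneous_polynomial in \<open>auto simp: partial_deriv_component\<close>)
  have "(\<Sum>i\<in>UNIV. x $ i * partial_deriv i (\<lambda>x. x $ j * f x) x)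
     = x $ j * (\<Sum>i\<in>UNIV. x $ i * partial_deriv i f x) + (\<Sum>i\<in>UNIV. if i = j then x $ i * f x else 0)"
    unfolding * sum_distrib_left sum.distrib[symmetric]
    by (intro sum.cong refl) (simp add: algebra_simps)
  then show ?case
    using component.IH by (simp add: algebra_simps)
next
  case (add d f g)
  then show ?case
    by (simp add: partial_deriv_add homogeneous_polynomial distrib_left sum.distrib)
qed

lemma homogeneous_lin_op_low:
  assumes "homogeneous d f" "d < 2"
  shows "lin_op a f = (\<lambda>x. 0)"
proof -
  have "partial_deriv j (partial_deriv i f) = (\<lambda>x. 0)" for i j
  proof (cases d)
    case 0
    then show ?thesis
      using assms by (simp add: homogeneous_0_partial_deriv partial_deriv_const)
  next
    case (Suc e)
    with assms have "homogeneous (Suc 0) f" by (simp add: less_2_cases_iff)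
    then show ?thesis
      by (simp add: homogeneous_Suc_partial_deriv homogeneous_0_partial_deriv)
  qed
  then show ?thesis by (auto simp: lin_op_def hessian_def)
qed

lemma homogeneous_lin_op:
  assumes "homogeneous (Suc (Suc d)) f"
  shows "homogeneous d (lin_op a f)"
  unfolding lin_op_def[abs_def] hessian_def
  using assms
  by (auto intro!: homogeneous_sum homogeneous_cmult homogeneous_Suc_partial_deriv)

text \<open>
  The last assumption says that \<open>Q\<close> is the quadratic form of the inverse of \<open>a\<close>.  It makes \<open>lin_op a\<close>
  act on \<open>Q\<close> as the Laplacian acts on the squared norm.
\<close>

context
  fixes a :: "'n::finite \<Rightarrow> 'n \<Rightarrow> real" and Q :: "real ^ 'n \<Rightarrow> real"
  assumes sym: "\<And>i j. a i j = a j i"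
    and Q: "homogeneous 2 Q"
    and aQ: "\<And>i x. (\<Sum>j\<in>UNIV. a i j * partial_deriv j Q x) = 2 * x $ i"
begin

text \<open>Differentiating the identity \<open>aQ\<close> in the direction \<open>i\<close> gives 2
  for each \<open>i\<close>; no explicit form of \<open>Q\<close> is used.\<close>

lemma lin_op_quadratic: "lin_op a Q x = 2 * CARD('n)"
proof -
  have pQ: "real_polynomial_function (partial_deriv j Q)" for j
    using homogeneous_polynomial[OF Q] polynomial_partial_deriv by blast
  have "(\<Sum>j\<in>UNIV. a i j * partial_deriv i (partial_deriv j Q) x) = 2" for i
  proof -
    have "(\<Sum>j\<in>UNIV. a i j * partial_deriv i (partial_deriv j Q) x)
        = partial_deriv i (\<lambda>x. \<Sum>j\<in>UNIV. a i j * partial_deriv j Q x) x"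
      by (subst partial_deriv_sum) (auto simp: pQ partial_deriv_cmult)
    also have "\<dots> = 2"
      by (simp only: aQ) (simp add: partial_deriv_cmult polynomial_component partial_deriv_component)
    finally show ?thesis .
  qed
  then have "(\<Sum>i\<in>UNIV. \<Sum>j\<in>UNIV. a i j * partial_deriv i (partial_deriv j Q) x) = 2 * CARD('n)"
    by simp
  \<comment> \<open>Interchanging the sums and using the symmetry of \<open>a\<close> replaces an
    appeal to the symmetry of second derivatives.\<close>
  then show ?thesis
    unfolding lin_op_def hessian_def
    by (subst sum.swap) (simp add: sym)
qed

text \<open>By \<open>aQ\<close> the cross term of the product rule collapses to the radial
  derivative of \<open>f\<close>, which Euler's identity evaluates; hence the summand
  \<open>4 * d\<close> next to the \<open>2 * n\<close> coming from \<open>Q\<close> itself.\<close>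

lemma lin_op_quadratic_mult:
  assumes "homogeneous d f"
  shows "lin_op a (\<lambda>x. Q x * f x) = (\<lambda>x. Q x * lin_op a f x + (2 * real CARD('n) + 4 * real d) * f x)"
proof
  fix x
  have "(\<Sum>i\<in>UNIV. \<Sum>j\<in>UNIV. a i j * partial_deriv i f x * partial_deriv j Q x)
     = (\<Sum>i\<in>UNIV. partial_deriv i f x * (\<Sum>j\<in>UNIV. a i j * partial_deriv j Q x))"
    by (simp add: sum_distrib_left mult_ac)
  also have "\<dots> = 2 * (\<Sum>i\<in>UNIV. x $ i * partial_deriv i f x)"
    by (simp add: aQ sum_distrib_left mult_ac)
  also have "\<dots> = 2 * real d * f x"
    by (simp add: homogeneous_euler[OF assms])
  finally have *: "(\<Sum>i\<in>UNIV. \<Sum>j\<in>UNIV. a i j * partial_deriv i f x * partial_deriv j Q x) = 2 * real d * f x" .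
  have "lin_op a (\<lambda>x. f x * Q x) x = Q x * lin_op a f x + (2 * real CARD('n) + 4 * real d) * f x"
    using homogeneous_polynomial[OF Q] homogeneous_polynomial[OF assms]
    by (subst lin_op_mult) (simp_all only: sym * lin_op_quadratic, simp_all add: sym algebra_simps)
  then show "lin_op a (\<lambda>x. Q x * f x) x = Q x * lin_op a f x + (2 * real CARD('n) + 4 * real d) * f x"
    by (simp add: mult.commute)
qed

text \<open>Of the constant only the sign is kept: later it has to be divided by.\<close>

lemma lin_op_quadratic_power_mult:
  assumes "homogeneous d f"
  shows "\<exists>c>0. lin_op a (\<lambda>x. Q x ^ Suc s * f x) = (\<lambda>x. Q x ^ Suc s * lin_op a f x + c * (Q x ^ s * f x))"
proof (induction s)
  case 0
  have "2 * real CARD('n) + 4 * real d > 0" by (simp add: add_pos_nonneg)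
  then show ?case
    using lin_op_quadratic_mult[OF assms] by auto
next
  case (Suc s)
  then obtain c where c: "c > 0"
    "lin_op a (\<lambda>x. Q x ^ Suc s * f x) = (\<lambda>x. Q x ^ Suc s * lin_op a f x + c * (Q x ^ s * f x))"
    by blast
  define e where "e = Suc s * 2 + d"
  have "homogeneous e (\<lambda>x. Q x ^ Suc s * f x)"
    unfolding e_def by (rule homogeneous_mult[OF homogeneous_power[OF Q] assms])
  from lin_op_quadratic_mult[OF this]
  have "lin_op a (\<lambda>x. Q x ^ Suc (Suc s) * f x) =
    (\<lambda>x. Q x ^ Suc (Suc s) * lin_op a f x + (c + (2 * real CARD('n) + 4 * real e)) * (Q x ^ Suc s * f x))"
    unfolding c(2) by (simp add: algebra_simps)
  moreover have "c + (2 * real CARD('n) + 4 * real e) > 0" using c(1) by (simp add: add_pos_nonneg)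
  ultimately show ?case by blast
qed

text \<open>The first guess \<open>g / c\<close> leaves the error
  \<open>Q ^ Suc s * lin_op a g / c\<close>. Its second factor has degree lower by two while the
  power of \<open>Q\<close> has gone up by one, so the induction on the degree must leave
  \<open>s\<close> arbitrary. The correction \<open>r\<close> from the induction gives the solution
  \<open>(g - Q * r) / c\<close>.\<close>

lemma lin_op_quadratic_power_solvable:
  assumes "homogeneous d g"
  shows "\<exists>r. homogeneous d r \<and> lin_op a (\<lambda>x. Q x ^ Suc s * r x) = (\<lambda>x. Q x ^ s * g x)"
  using assms
proof (induction d arbitrary: g s rule: less_induct)
  case (less d)
  obtain c where c: "c > 0"
    "lin_op a (\<lambda>x. Q x ^ Suc s * g x) = (\<lambda>x. Q x ^ Suc s * lin_op a g x + c * (Q x ^ s * g x))"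
    using lin_op_quadratic_power_mult[OF less.prems] by blast
  have pg: "real_polynomial_function (\<lambda>x. Q x ^ Suc s * g x)"
    using homogeneous_polynomial[OF homogeneous_mult[OF homogeneous_power[OF Q] less.prems]] .
  show ?case
  proof (cases "d < 2")
    case True
    have "lin_op a (\<lambda>x. Q x ^ Suc s * (1 / c * g x)) = (\<lambda>x. 1 / c * lin_op a (\<lambda>x. Q x ^ Suc s * g x) x)"
      using lin_op_cmult[OF pg, of a "1/c"] by (simp add: mult_ac)
    also have "\<dots> = (\<lambda>x. Q x ^ s * g x)"
      unfolding c(2) homogeneous_lin_op_low[OF less.prems True] using c(1) by auto
    finally show ?thesis
      using homogeneous_cmult[OF less.prems] by blast
  next
    case False
    then obtain e where e: "d = Suc (Suc e)"
      by (metis less_2_cases_iff not0_implies_Suc One_nat_def)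
    obtain r where r: "homogeneous e r"
      "lin_op a (\<lambda>x. Q x ^ Suc (Suc s) * r x) = (\<lambda>x. Q x ^ Suc s * lin_op a g x)"
      using less.IH[of e "lin_op a g" "Suc s"] homogeneous_lin_op[of e g a] less.prems
      unfolding e by auto
    have pr: "real_polynomial_function (\<lambda>x. Q x ^ Suc (Suc s) * r x)"
      using homogeneous_polynomial[OF homogeneous_mult[OF homogeneous_power[OF Q] r(1)]] .
    define R where "R x = 1 / c * (g x + (-1) * (Q x * r x))" for x
    have "homogeneous d (\<lambda>x. Q x * r x)"
      using homogeneous_mult[OF Q r(1)] by (simp add: e)
    then have "homogeneous d R"
      unfolding R_def[abs_def]
      by (intro homogeneous_cmult homogeneous.add less.prems)
    moreover have "lin_op a (\<lambda>x. Q x ^ Suc s * R x) = (\<lambda>x. Q x ^ s * g x)"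
    proof -
      have e1: "(\<lambda>x. Q x ^ Suc s * R x) = (\<lambda>x. 1/c * (Q x ^ Suc s * g x + (-1) * (Q x ^ Suc (Suc s) * r x)))"
        by (auto simp: R_def algebra_simps)
      have s: "real_polynomial_function (\<lambda>x. - 1 * (Q x ^ Suc (Suc s) * r x))"
        using real_polynomial_function.intros(4)[OF real_polynomial_function.intros(2) pr] .
      show ?thesis
        unfolding e1 lin_op_cmult[OF real_polynomial_function.intros(3)[OF pg s]]
          lin_op_add[OF pg s] lin_op_cmult[OF pr] c(2) r(2) using c(1) by auto
    qed
    ultimately show ?thesis by blast
  qed
qed

text \<open>Choose \<open>r\<close> with \<open>lin_op a (Q * r) = lin_op a g\<close>. Then
  \<open>g - Q * r\<close> solves the equation and equals \<open>g - r\<close> where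
  \<open>Q = 1\<close>. The missing \<open>r\<close> has degree lower by two, so it is extended by
  induction and added.\<close>

lemma homogeneous_harmonic_extension:
  assumes "homogeneous d g"
  shows "\<exists>h. real_polynomial_function h \<and> lin_op a h = (\<lambda>x. 0) \<and> (\<forall>x. Q x = 1 \<longrightarrow> h x = g x)"
  using assms
proof (induction d arbitrary: g rule: less_induct)
  case (less d)
  show ?case
  proof (cases "d < 2")
    case True
    then show ?thesis
      by (intro exI[of _ g]) (simp add: homogeneous_polynomial[OF less.prems] homogeneous_lin_op_low[OF less.prems])
  next
    case False
    then obtain e where e: "d = Suc (Suc e)"
      by (metis less_2_cases_iff not0_implies_Suc One_nat_def)
    obtain r where r: "homogeneous e r" "lin_op a (\<lambda>x. Q x * r x) = lin_op a g"
      using lin_op_quadratic_power_solvable[of e "lin_op a g" 0] homogeneous_lin_op less.prems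
      unfolding e by auto
    obtain k where k: "real_polynomial_function k" "lin_op a k = (\<lambda>x. 0)" "\<And>x. Q x = 1 \<Longrightarrow> k x = r x"
      using less.IH[OF _ r(1)] unfolding e by auto
    have pr: "real_polynomial_function (\<lambda>x. Q x * r x)" "real_polynomial_function g"
      using homogeneous_polynomial[OF homogeneous_mult[OF Q r(1)]] homogeneous_polynomial[OF less.prems] .
    define h where "h x = (g x + (-1) * (Q x * r x)) + k x" for x
    have s: "real_polynomial_function (\<lambda>x. (-1) * (Q x * r x))"
      using real_polynomial_function.intros(4)[OF real_polynomial_function.intros(2) pr(1)] .
    have "real_polynomial_function h"
      unfolding h_def[abs_def]
      using real_polynomial_function.intros(3)[OF real_polynomial_function.intros(3)[OF pr(2) s] k(1)] .
    moreover have "lin_op a h = (\<lambda>x. 0)"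
      unfolding h_def[abs_def] lin_op_add[OF real_polynomial_function.intros(3)[OF pr(2) s] k(1)]
        lin_op_add[OF pr(2) s] lin_op_cmult[OF pr(1)] r(2) k(2) by simp
    moreover have "\<forall>x. Q x = 1 \<longrightarrow> h x = g x"
      using k(3) by (simp add: h_def)
    ultimately show ?thesis by blast
  qed
qed

end

text \<open>The decomposition into degrees is not recorded: the extension problem is linear, so
  closure under addition is all that is needed to pass from homogeneous to arbitrary
  polynomials.\<close>

inductive homogeneous_sums :: "(real ^ 'n \<Rightarrow> real) \<Rightarrow> bool" where
  homogeneous: "homogeneous d f \<Longrightarrow> homogeneous_sums f"
| add: "homogeneous_sums f \<Longrightarrow> homogeneous_sums g \<Longrightarrow> homogeneous_sums (\<lambda>x. f x + g x)"

lemma homogeneous_sums_mult: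
  assumes "homogeneous_sums f" "homogeneous_sums g"
  shows "homogeneous_sums (\<lambda>x. f x * g x)"
  using assms(1)
proof induction
  case (homogeneous d f)
  from assms(2) show ?case
  proof induction
    case (homogeneous e g)
    then show ?case
      by (rule homogeneous_sums.homogeneous[OF homogeneous_mult[OF \<open>homogeneous d f\<close>]])
  next
    case (add g h)
    then show ?case
      using homogeneous_sums.add[of "\<lambda>x. f x * g x" "\<lambda>x. f x * h x"] by (simp add: distrib_left)
  qed
next
  case (add f h)
  then show ?case
    using homogeneous_sums.add[of "\<lambda>x. f x * g x" "\<lambda>x. h x * g x"] by (simp add: distrib_right)
qed

lemma polynomial_homogeneous_sums:
  "real_polynomial_function f \<Longrightarrow> homogeneous_sums f"
proof (induction rule: real_polynomial_function.induct)
  case (linear f)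
  have "f x = (\<Sum>i\<in>UNIV. x $ i * f (axis i 1))" for x
  proof -
    have "f x = f (\<Sum>i\<in>UNIV. (x $ i) *\<^sub>R axis i 1)"
      using axis_expansion[of x] by (rule arg_cong)
    then show ?thesis
      by (simp add: linear_sum[OF bounded_linear.linear[OF linear]]
          linear_scale[OF bounded_linear.linear[OF linear]])
  qed
  then have eq: "f = (\<lambda>x. \<Sum>i\<in>UNIV. x $ i * f (axis i 1))" by (rule ext)
  have "homogeneous (Suc 0) (\<lambda>x. \<Sum>i\<in>UNIV. x $ i * f (axis i 1))"
    by (rule homogeneous_sum[OF finite homogeneous.component[OF homogeneous.const]])
  then have hs: "homogeneous_sums (\<lambda>x. \<Sum>i\<in>UNIV. x $ i * f (axis i 1))"
    by (rule homogeneous_sums.homogeneous)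
  then show ?case
    by (simp flip: eq)
next
  case (const c)
  show ?case
    by (rule homogeneous_sums.homogeneous[OF homogeneous.const])
next
  case (add f g)
  show ?case by (rule homogeneous_sums.add[OF add.IH])
next
  case (mult f g)
  show ?case by (rule homogeneous_sums_mult[OF mult.IH])
qed

lemma polynomial_harmonic_extension:
  fixes Q :: "real ^ 'n \<Rightarrow> real"
  assumes sym: "\<And>i j. a i j = a j i"
    and Q: "homogeneous 2 Q"
    and aQ: "\<And>i x. (\<Sum>j\<in>UNIV. a i j * partial_deriv j Q x) = 2 * x $ i"
    and g: "real_polynomial_function g"
  obtains h where "real_polynomial_function h" "lin_op a h = (\<lambda>x. 0)" "\<And>x. Q x = 1 \<Longrightarrow> h x = g x"
proof -
  from polynomial_homogeneous_sums[OF g]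
  have "\<exists>h. real_polynomial_function h \<and> lin_op a h = (\<lambda>x. 0) \<and> (\<forall>x. Q x = 1 \<longrightarrow> h x = g x)"
  proof induction
    case (homogeneous d f)
    show ?case
      by (rule homogeneous_harmonic_extension[OF sym Q aQ homogeneous])
  next
    case (add f g)
    from add.IH(1) obtain h where h: "real_polynomial_function h" "lin_op a h = (\<lambda>x. 0)"
      "\<forall>x. Q x = 1 \<longrightarrow> h x = f x" by (elim exE conjE)
    from add.IH(2) obtain k where k: "real_polynomial_function k" "lin_op a k = (\<lambda>x. 0)"
      "\<forall>x. Q x = 1 \<longrightarrow> k x = g x" by (elim exE conjE)
    show ?case
      using h k
      by (intro exI[of _ "\<lambda>x. h x + k x"]) (simp add: lin_op_add real_polynomial_function.intros(3))
  qed
  then show thesis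
    by (elim exE conjE) (rule that, assumption, assumption, simp)
qed

subsection \<open>The coefficients of the operator\<close>

definition pq_coeff :: "real \<Rightarrow> real \<Rightarrow> real ^ 'n \<Rightarrow> 'n \<Rightarrow> 'n \<Rightarrow> real" where
  "pq_coeff p q \<eta> i j = norm \<eta> powr (q - 2) *
     ((if i = j then 1 else 0) + (p - 2) * (\<eta> $ i * \<eta> $ j / (norm \<eta>)\<^sup>2))"

lemma pq_coeff_sym: "pq_coeff p q \<eta> i j = pq_coeff p q \<eta> j i"
  by (simp add: pq_coeff_def mult.commute)

text \<open>The subsolution is handled as the supersolution \<open>- v\<close>, whose contact
  gradient is \<open>- \<eta>\<close>; evenness puts the same linear operator on both sides.\<close>

lemma pq_coeff_minus [simp]: "pq_coeff p q (- \<eta>) = pq_coeff p q \<eta>"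
  by (simp add: pq_coeff_def fun_eq_iff)

lemma continuous_on_pq_coeff: "continuous_on (- {0}) (\<lambda>\<eta>. pq_coeff p q \<eta> i j)"
  unfolding pq_coeff_def by (intro continuous_intros) auto

lemma pq_operator_eq_coeff_sum:
  fixes \<eta> :: "real ^ 'n"
  shows "pq_operator p q \<eta> X = (\<Sum>i\<in>UNIV. \<Sum>j\<in>UNIV. pq_coeff p q \<eta> i j * X $ i $ j)"
proof -
  define c where "c = (p - 2) / (norm \<eta>)\<^sup>2"
  have "(\<Sum>i\<in>UNIV. \<Sum>j\<in>UNIV. pq_coeff p q \<eta> i j * X $ i $ j)
      = (\<Sum>i\<in>UNIV. \<Sum>j\<in>UNIV. norm \<eta> powr (q - 2) * (if i = j then X $ i $ j else 0)
          + norm \<eta> powr (q - 2) * (c * (\<eta> $ i * \<eta> $ j * X $ i $ j)))"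
    by (intro sum.cong refl) (simp add: pq_coeff_def c_def algebra_simps)
  also have "\<dots> = norm \<eta> powr (q - 2) * (\<Sum>i\<in>UNIV. X $ i $ i)
      + norm \<eta> powr (q - 2) * (c * (\<Sum>i\<in>UNIV. \<Sum>j\<in>UNIV. \<eta> $ i * \<eta> $ j * X $ i $ j))"
    by (simp add: sum.distrib flip: sum_distrib_left)
  \<comment> \<open>The trace of the matrix product produces \<open>X $ j $ i\<close>. Renaming the
    indices works because the outer product is symmetric, so \<open>X\<close> may be any
    matrix.\<close>
  also have "(\<Sum>i\<in>UNIV. \<Sum>j\<in>UNIV. \<eta> $ i * \<eta> $ j * X $ i $ j)
      = (\<Sum>i\<in>UNIV. \<Sum>j\<in>UNIV. \<eta> $ i * \<eta> $ j * X $ j $ i)"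
    by (subst sum.swap) (simp add: mult_ac)
  also have "norm \<eta> powr (q - 2) * (\<Sum>i\<in>UNIV. X $ i $ i)
      + norm \<eta> powr (q - 2) * (c * (\<Sum>i\<in>UNIV. \<Sum>j\<in>UNIV. \<eta> $ i * \<eta> $ j * X $ j $ i))
     = pq_operator p q \<eta> X"
  proof -
    have "trace (X + (p - 2) *\<^sub>R (((1 / (norm \<eta>)\<^sup>2) *\<^sub>R outer \<eta> \<eta>) ** X))
      = (\<Sum>i\<in>UNIV. X $ i $ i) + c * (\<Sum>i\<in>UNIV. \<Sum>j\<in>UNIV. \<eta> $ i * \<eta> $ j * X $ j $ i)"
      by (simp add: trace_def matrix_matrix_mult_def outer_def c_def sum.distrib sum_distrib_left mult_ac)
    then show ?thesis
      by (simp only: pq_operator_def distrib_left)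
  qed
  finally show ?thesis by simp
qed

text \<open>The quadratic form of the inverse of the matrix \<open>pq_coeff p q \<eta>\<close>. With
  the unit vector e along \<eta>, the inverse of I + (p - 2) e e^T is I - (p - 2)/(p - 1) e
  e^T.\<close>

definition pq_quad :: "real \<Rightarrow> real \<Rightarrow> real ^ 'n \<Rightarrow> real ^ 'n \<Rightarrow> real" where
  "pq_quad p q \<eta> x = norm \<eta> powr (2 - q) * (x \<bullet> x - (p - 2) / (p - 1) * ((\<eta> \<bullet> x) / norm \<eta>)\<^sup>2)"

lemma homogeneous_linear: "homogeneous (Suc 0) (\<lambda>x. b \<bullet> x)"
proof -
  have "(\<lambda>x. b \<bullet> x) = (\<lambda>x. \<Sum>i\<in>UNIV. x $ i * b $ i)"
    by (simp add: inner_vec_def mult.commute)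
  then show ?thesis
    by (simp add: homogeneous_sum homogeneous.component homogeneous.const)
qed

lemma homogeneous_pq_quad: "homogeneous 2 (pq_quad p q \<eta>)"
proof -
  have 1: "homogeneous 2 (\<lambda>x::real^'n. x \<bullet> x)"
    unfolding inner_vec_def inner_real_def numeral_2_eq_2
    using homogeneous.component[OF homogeneous.component[OF homogeneous.const[of 1]]]
    by (intro homogeneous_sum) simp_all
  have "homogeneous 2 (\<lambda>x. (\<eta> \<bullet> x) * (\<eta> \<bullet> x))"
    using homogeneous_mult[OF homogeneous_linear[of \<eta>] homogeneous_linear[of \<eta>]]
    by (simp add: numeral_2_eq_2)
  from homogeneous_cmult[OF homogeneous_diff[OF 1 homogeneous_cmult[OF this]]]
  have "homogeneous 2 (\<lambda>x. norm \<eta> powr (2 - q) *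
    (x \<bullet> x - ((p - 2) / (p - 1) / (norm \<eta>)\<^sup>2) * ((\<eta> \<bullet> x) * (\<eta> \<bullet> x))))" .
  then show ?thesis
    by (simp add: pq_quad_def[abs_def] power_divide power2_eq_square)
qed

lemma pq_coeff_pq_quad:
  fixes \<eta> :: "real ^ 'n"
  assumes "p > 1" "\<eta> \<noteq> 0"
  shows "(\<Sum>j\<in>UNIV. pq_coeff p q \<eta> i j * partial_deriv j (pq_quad p q \<eta>) x) = 2 * x $ i"
proof -
  define N where "N = norm \<eta>"
  define k where "k = (p - 2) / (p - 1)"
  define s where "s = \<eta> \<bullet> x"
  have N: "N > 0" using assms by (simp add: N_def)
  have "(pq_quad p q \<eta> has_derivative (\<lambda>h. N powr (2 - q) * (2 * (x \<bullet> h) - k * (2 * s * (\<eta> \<bullet> h) / N\<^sup>2)))) (at x)"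
    unfolding pq_quad_def[abs_def] using N
    by (auto intro!: derivative_eq_intros simp: N_def[symmetric] k_def[symmetric] s_def
        power2_eq_square field_simps inner_commute fun_eq_iff)
  from partial_deriv_eqI[OF this]
  have pd: "partial_deriv j (pq_quad p q \<eta>) x = N powr (2 - q) * (2 * x $ j - k * (2 * s * \<eta> $ j / N\<^sup>2))" for j
    by (simp add: inner_axis)
  have NN: "N powr (q - 2) * N powr (2 - q) = 1"
    using N by (simp flip: powr_add)
  have "pq_coeff p q \<eta> i j * partial_deriv j (pq_quad p q \<eta>) x =
    (if i = j then 2 * x $ j - k * (2 * s * \<eta> $ j / N\<^sup>2) else 0)
     + (p - 2) * \<eta> $ i / N\<^sup>2 * 2 * (\<eta> $ j * x $ j)
     - (p - 2) * \<eta> $ i / N\<^sup>2 * k * 2 * s / N\<^sup>2 * (\<eta> $ j * \<eta> $ j)" for j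
  proof -
    have "pq_coeff p q \<eta> i j * partial_deriv j (pq_quad p q \<eta>) x
      = (N powr (q - 2) * N powr (2 - q)) * (((if i = j then 1 else 0) + (p - 2) * (\<eta> $ i * \<eta> $ j / N\<^sup>2)) * (2 * x $ j - k * (2 * s * \<eta> $ j / N\<^sup>2)))"
      unfolding pd pq_coeff_def N_def[symmetric] by (simp only: mult_ac)
    \<comment> \<open>\<open>D\<close> stands for the inverse of \<open>N\<^sup>2\<close>; with it
      as a free variable the identity is polynomial.\<close>
    moreover have "(b + (p - 2) * (\<eta> $ i * \<eta> $ j * D)) * (2 * x $ j - k * (2 * s * \<eta> $ j * D))
      = b * (2 * x $ j - k * (2 * s * \<eta> $ j * D)) + (p - 2) * \<eta> $ i * D * 2 * (\<eta> $ j * x $ j)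
       - (p - 2) * \<eta> $ i * D * k * 2 * s * D * (\<eta> $ j * \<eta> $ j)" for b D
      by algebra
    ultimately show ?thesis
      unfolding NN divide_inverse by simp
  qed
  then have "(\<Sum>j\<in>UNIV. pq_coeff p q \<eta> i j * partial_deriv j (pq_quad p q \<eta>) x)
    = (2 * x $ i - k * (2 * s * \<eta> $ i / N\<^sup>2))
     + (p - 2) * \<eta> $ i / N\<^sup>2 * 2 * (\<Sum>j\<in>UNIV. \<eta> $ j * x $ j)
     - (p - 2) * \<eta> $ i / N\<^sup>2 * k * 2 * s / N\<^sup>2 * (\<Sum>j\<in>UNIV. \<eta> $ j * \<eta> $ j)"
    by (simp add: sum.distrib sum_subtractf sum_distrib_left)
  also have "(\<Sum>j\<in>UNIV. \<eta> $ j * x $ j) = s" by (simp add: s_def inner_vec_def)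
  also have "(\<Sum>j\<in>UNIV. \<eta> $ j * \<eta> $ j) = N\<^sup>2"
    by (simp add: N_def power2_norm_eq_inner inner_vec_def)
  also have "(2 * x $ i - k * (2 * s * \<eta> $ i / N\<^sup>2)) + (p - 2) * \<eta> $ i / N\<^sup>2 * 2 * s
     - (p - 2) * \<eta> $ i / N\<^sup>2 * k * 2 * s / N\<^sup>2 * N\<^sup>2 =
     2 * x $ i + 2 * s * \<eta> $ i / N\<^sup>2 * ((p - 2) - k * (p - 1))"
    using N by (simp add: field_simps power2_eq_square)
  \<comment> \<open>This cancellation is what determines the factor \<open>k\<close> in the inverse
    matrix.\<close>
  also have "(p - 2) - k * (p - 1) = 0" using assms(1) by (simp add: k_def)
  finally show ?thesis by simp
qed

lemma pq_quad_coercive: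
  fixes \<eta> :: "real ^ 'n"
  assumes "p > 1" "\<eta> \<noteq> 0"
  obtains c where "c > 0" "\<And>x. c * (norm x)\<^sup>2 \<le> pq_quad p q \<eta> x"
proof -
  define k where "k = (p - 2) / (p - 1)"
  \<comment> \<open>The smaller of the two eigenvalues of I - k e e^T: 1 orthogonally to \<eta>, and
    1 - k = 1/(p - 1) along \<eta>.\<close>
  define m where "m = min 1 (1 / (p - 1))"
  have m: "m > 0" using assms by (simp add: m_def)
  have "m * (norm x)\<^sup>2 \<le> x \<bullet> x - k * ((\<eta> \<bullet> x) / norm \<eta>)\<^sup>2" for x
  proof -
    define s where "s = ((\<eta> \<bullet> x) / norm \<eta>)\<^sup>2"
    have "\<bar>\<eta> \<bullet> x\<bar> \<le> norm \<eta> * norm x" by (rule Cauchy_Schwarz_ineq2)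
    then have "\<bar>(\<eta> \<bullet> x) / norm \<eta>\<bar> \<le> \<bar>norm x\<bar>" using assms(2) by (simp add: field_simps)
    then have s: "0 \<le> s" "s \<le> (norm x)\<^sup>2" by (simp_all only: s_def zero_le_power2 abs_le_square_iff)
    have "m * (norm x)\<^sup>2 \<le> (norm x)\<^sup>2 - k * s"
    proof (cases "p \<ge> 2")
      case True
      have "k \<ge> 0" using True by (simp add: k_def)
      then have "k * s \<le> k * (norm x)\<^sup>2" using s by (simp add: mult_left_mono)
      moreover have "m \<le> 1 - k" using assms(1) by (simp add: m_def k_def field_simps min_def)
      then have "m * (norm x)\<^sup>2 \<le> (1 - k) * (norm x)\<^sup>2" by (rule mult_right_mono) simp
      ultimately show ?thesis by (simp add: algebra_simps)
    next
      case False
      then have "k \<le> 0" using assms(1) by (simp add: k_def divide_nonpos_pos)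
      then have "k * s \<le> 0" using s by (simp add: mult_nonpos_nonneg)
      moreover have "m * (norm x)\<^sup>2 \<le> 1 * (norm x)\<^sup>2" by (rule mult_right_mono) (auto simp: m_def)
      ultimately show ?thesis by simp
    qed
    then show ?thesis by (simp add: s_def power2_norm_eq_inner)
  qed
  then have "norm \<eta> powr (2 - q) * m * (norm x)\<^sup>2 \<le> pq_quad p q \<eta> x" for x
    unfolding pq_quad_def k_def by (simp add: mult.assoc mult_left_mono)
  moreover have "norm \<eta> powr (2 - q) * m > 0" using m assms by simp
  ultimately show thesis using that by blast
qed

lemma compact_pq_quad_ball:
  fixes \<eta> :: "real ^ 'n"
  assumes "p > 1" "\<eta> \<noteq> 0"
  shows "compact {x. pq_quad p q \<eta> x \<le> 1}"
proof -
  obtain c where c: "c > 0" "\<And>x. c * (norm x)\<^sup>2 \<le> pq_quad p q \<eta> x"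
    using pq_quad_coercive[OF assms, where q=q] by blast
  have "norm x \<le> sqrt (1 / c)" if "pq_quad p q \<eta> x \<le> 1" for x
  proof -
    have "(norm x)\<^sup>2 \<le> 1 / c"
      using c(2)[of x] that c(1) by (simp add: field_simps)
    then show ?thesis by (rule real_le_rsqrt)
  qed
  then have "bounded {x. pq_quad p q \<eta> x \<le> 1}"
    unfolding bounded_iff by blast
  moreover have "closed {x. pq_quad p q \<eta> x \<le> 1}"
    by (intro closed_Collect_le continuous_on_const polynomial_continuous_on
        homogeneous_polynomial[OF homogeneous_pq_quad])
  ultimately show ?thesis by (simp add: compact_eq_bounded_closed)
qed

subsection \<open>Test functions\<close>

lemma grad_add_const:
  fixes G :: "real ^ 'n \<Rightarrow> real"
  assumes "real_polynomial_function G"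
  shows "grad (\<lambda>y. G y + c) = grad G"
  using assms by (simp add: grad_def[abs_def] partial_deriv_add partial_deriv_const real_polynomial_function.intros(2))

text \<open>All test functions separate as \<open>G y + T s\<close>, so that the spatial operators
  see only \<open>G\<close> and the time derivative only \<open>T\<close>.\<close>

lemma polynomial_split:
  fixes G :: "real ^ 'n \<Rightarrow> real"
  assumes "real_polynomial_function G" "real_polynomial_function T"
  shows "real_polynomial_function (\<lambda>(y, s::real). G y + T s)"
proof -
  have "real_polynomial_function (G \<circ> fst)" "real_polynomial_function (T \<circ> (snd :: (real^'n) \<times> real \<Rightarrow> real))"
    using assms by (auto intro!: real_polynomial_function_compose polynomial_function_bounded_linear
      bounded_linear_fst bounded_linear_snd)
  from real_polynomial_function.intros(3)[OF this] show ?thesis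
    by (simp add: case_prod_beta' o_def)
qed

lemma space_grad_split:
  fixes G :: "real ^ 'n \<Rightarrow> real"
  assumes "real_polynomial_function G"
  shows "space_grad (\<lambda>(y, s). G y + T s) (x, t) = grad G x"
  using grad_add_const[OF assms, of "T t"] by (simp add: space_grad_def)

lemma space_pq_laplacian_split:
  fixes G :: "real ^ 'n \<Rightarrow> real"
  assumes G: "real_polynomial_function G" and "grad G x \<noteq> 0"
  shows "space_pq_laplacian p q (\<lambda>(y, s). G y + T s) (x, t) = lin_op (pq_coeff p q (grad G x)) G x"
proof -
  have r: "real_polynomial_function (\<lambda>y. G y + T t)"
    by (rule real_polynomial_function.intros(3)[OF G real_polynomial_function.intros(2)])
  have "pq_laplacian p q (\<lambda>y. G y + T t) x = lin_op (pq_coeff p q (grad G x)) (\<lambda>y. G y + T t) x"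
    using pq_laplacian_eq_pq_operator[OF open_UNIV _ polynomial_C2_on[OF r], of x p q] assms(2)
    by (simp add: grad_add_const[OF G] lin_op_def pq_operator_eq_coeff_sum)
  also have "\<dots> = lin_op (pq_coeff p q (grad G x)) G x"
    by (subst lin_op_add[OF G real_polynomial_function.intros(2)]) (simp add: lin_op_const)
  finally show ?thesis by (simp add: space_pq_laplacian_def)
qed

lemma time_deriv_split:
  assumes "(T has_real_derivative T') (at t)"
  shows "time_deriv (\<lambda>(y, s). G y + T s) (x, t) = T'"
proof -
  have "((\<lambda>s. G x + T s) has_real_derivative T') (at t)"
    using DERIV_add[OF DERIV_const assms] by simp
  then show ?thesis
    by (simp add: time_deriv_def DERIV_imp_deriv)
qed

lemma polynomial_dist_square: "real_polynomial_function (\<lambda>y::real^'n. (y - x) \<bullet> (y - x))"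
  unfolding inner_vec_def inner_real_def vector_minus_component
  by (intro real_polynomial_function_sum real_polynomial_function.intros(4) real_polynomial_function_diff
      real_polynomial_function.intros(2) polynomial_component finite)

lemma partial_deriv_dist_square: "partial_deriv i (\<lambda>y::real^'n. (y - x) \<bullet> (y - x)) y = 2 * (y - x) $ i"
proof -
  have "((\<lambda>y::real^'n. (y - x) \<bullet> (y - x)) has_derivative (\<lambda>h. 2 * ((y - x) \<bullet> h))) (at y)"
    by (auto intro!: derivative_eq_intros simp: inner_commute)
  from partial_deriv_eqI[OF this] show ?thesis by (simp add: inner_axis)
qed

text \<open>The definition asks for strict contact. Subtracting the fourth power of the distance in
  space and the square in time makes a weak contact strict and leaves the gradient, the Hessian and
  the time derivative at the point unchanged. Admissibility is automatic since the gradient does not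
  vanish.\<close>

lemma supersolution_test:
  fixes G :: "real ^ 'n \<Rightarrow> real"
  assumes sup: "viscosity_supersolution p q \<Theta> u"
    and \<xi>: "(x, t) \<in> \<Theta>"
    and G: "real_polynomial_function G" and T: "real_polynomial_function T"
    and T': "(T has_real_derivative T') (at t)"
    and eq: "u (x, t) = ereal (G x + T t)"
    and le: "\<forall>\<^sub>F \<zeta> in at (x, t). ereal (G (fst \<zeta>) + T (snd \<zeta>)) \<le> u \<zeta>"
    and nz: "grad G x \<noteq> 0"
  shows "lin_op (pq_coeff p q (grad G x)) G x \<le> T'"
proof -
  define r where "r y = (y - x) \<bullet> (y - x)" for y
  define A where "A = pq_coeff p q (grad G x)"
  define G1 where "G1 y = G y + - 1 * (r y * r y)" for y
  define T1 where "T1 s = T s - (s - t)\<^sup>2" for s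
  have r: "real_polynomial_function r"
    unfolding r_def[abs_def] by (rule polynomial_dist_square)
  have r0: "r x = 0" "partial_deriv i r x = 0" for i
    unfolding r_def[abs_def] partial_deriv_dist_square by simp_all
  have rr: "real_polynomial_function (\<lambda>y. r y * r y)" "real_polynomial_function (\<lambda>y. - 1 * (r y * r y))"
    by (intro real_polynomial_function.intros(2,4) r)+
  have G1: "real_polynomial_function G1"
    unfolding G1_def[abs_def] by (rule real_polynomial_function.intros(3)[OF G rr(2)])
  have "real_polynomial_function (\<lambda>s. s)"
    by (rule real_polynomial_function.intros(1)) (rule bounded_linear_ident)
  then have T1: "real_polynomial_function T1"
    unfolding T1_def[abs_def] using T by (intro real_polynomial_function_diff real_polynomial_function_power) auto
  have T1': "(T1 has_real_derivative T') (at t)"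
    unfolding T1_def[abs_def] by (auto intro!: derivative_eq_intros T')
  have gr: "grad G1 x = grad G x"
    unfolding G1_def[abs_def] grad_def partial_deriv_add[OF G rr(2)] partial_deriv_cmult[OF rr(1)]
      partial_deriv_mult[OF r r] r0 by simp
  have lin: "lin_op A G1 x = lin_op A G x"
    unfolding G1_def[abs_def] lin_op_add[OF G rr(2)] lin_op_cmult[OF rr(1)]
    by (subst lin_op_mult[OF r r]) (simp_all add: A_def pq_coeff_sym[of p q "grad G x"] r0)
  define \<phi> where "\<phi> = (\<lambda>(y, s). G1 y + T1 s)"
  have "C2_on \<phi> \<Theta>"
    unfolding \<phi>_def by (intro polynomial_C2_on polynomial_split G1 T1)
  moreover have sg: "space_grad \<phi> (x, t) \<noteq> 0"
    unfolding \<phi>_def space_grad_split[OF G1] gr by (rule nz)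
  then have "admissible_at p q \<phi> (x, t)"
    by (simp add: admissible_at_def)
  moreover have "touches_from_below \<phi> u (x, t)"
  proof -
    have ne: "\<forall>\<^sub>F \<zeta> in at (x, t). \<zeta> \<noteq> (x, t)"
      by (simp add: eventually_at_filter)
    have "\<forall>\<^sub>F \<zeta> in at (x, t). ereal (\<phi> \<zeta>) < u \<zeta>"
      using le ne
    proof eventually_elim
      case (elim \<zeta>)
      obtain y s where \<zeta>: "\<zeta> = (y, s)" by fastforce
      have "\<phi> \<zeta> < G (fst \<zeta>) + T (snd \<zeta>)"
      proof (cases "y = x")
        case True
        then show ?thesis using elim(2) by (simp add: \<zeta> \<phi>_def G1_def T1_def r_def)
      next
        case False
        then have "r y > 0" by (simp add: r_def)
        then have "r y * r y > 0" by simp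
        then show ?thesis
          using zero_le_power2[of "s - t"] unfolding \<zeta> \<phi>_def G1_def T1_def prod.case fst_conv snd_conv
          by linarith
      qed
      with elim(1) show ?case by (metis ereal_less_eq(3) leD less_le_trans ereal_less(2) less_ereal.simps(1))
    qed
    then show ?thesis
      by (simp add: touches_from_below_def eq \<phi>_def G1_def T1_def r0)
  qed
  ultimately have "time_deriv \<phi> (x, t) - space_pq_laplacian p q \<phi> (x, t) \<ge> 0"
    using sup \<xi> sg unfolding viscosity_supersolution_def by blast
  moreover have "space_pq_laplacian p q \<phi> (x, t) = lin_op (pq_coeff p q (grad G1 x)) G1 x"
    unfolding \<phi>_def by (rule space_pq_laplacian_split[OF G1]) (simp add: gr nz)
  moreover have "time_deriv \<phi> (x, t) = T'"
    unfolding \<phi>_def by (rule time_deriv_split[OF T1'])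
  ultimately show ?thesis
    using lin by (simp add: gr A_def)
qed

subsection \<open>Lower semicontinuous functions\<close>

text \<open>This form combines directly with sequential compactness, products and compositions.
  Unlike in a limit along \<open>at \<xi> within S\<close>, the sequence may visit \<xi>
  itself.\<close>

definition seq_lsc_on :: "'a::metric_space set \<Rightarrow> ('a \<Rightarrow> ereal) \<Rightarrow> bool" where
  "seq_lsc_on K f \<longleftrightarrow>
     (\<forall>X \<xi>. \<xi> \<in> K \<and> (\<forall>n. X n \<in> K) \<and> X \<longlonglongrightarrow> \<xi> \<longrightarrow> f \<xi> \<le> liminf (\<lambda>n. f (X n)))"

lemma seq_lsc_onD:
  "seq_lsc_on K f \<Longrightarrow> \<xi> \<in> K \<Longrightarrow> (\<And>n. X n \<in> K) \<Longrightarrow> X \<longlonglongrightarrow> \<xi> \<Longrightarrow> f \<xi> \<le> liminf (\<lambda>n. f (X n))"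
  by (auto simp: seq_lsc_on_def)

lemma seq_lsc_on_attains_inf:
  assumes K: "compact K" "K \<noteq> {}" and f: "seq_lsc_on K f"
  shows "\<exists>\<xi>\<in>K. \<forall>\<zeta>\<in>K. f \<xi> \<le> f \<zeta>"
proof -
  obtain g where g: "decseq g" "range g \<subseteq> f ` K" "Inf (f ` K) = (INF i. g i)"
    using Inf_countable_INF[of "f ` K"] K(2) by blast
  then have "\<forall>n. \<exists>x\<in>K. g n = f x" by (metis image_iff range_subsetD)
  then obtain X where X: "\<And>n. X n \<in> K" "\<And>n. g n = f (X n)" by metis
  obtain \<xi> r where r: "\<xi> \<in> K" "strict_mono r" "(X \<circ> r) \<longlonglongrightarrow> \<xi>"
    using K(1) X(1) unfolding compact_def by metis
  have "(\<lambda>n. f (X n)) \<longlonglongrightarrow> Inf (f ` K)"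
    using LIMSEQ_INF[OF g(1)] unfolding g(3) X(2)[symmetric] .
  then have "(\<lambda>n. f ((X \<circ> r) n)) \<longlonglongrightarrow> Inf (f ` K)"
    using LIMSEQ_subseq_LIMSEQ[OF _ r(2)] by (fastforce simp: o_def)
  then have "liminf (\<lambda>n. f ((X \<circ> r) n)) = Inf (f ` K)"
    by (rule lim_imp_Liminf[OF sequentially_bot])
  moreover have "f \<xi> \<le> liminf (\<lambda>n. f ((X \<circ> r) n))"
    using seq_lsc_onD[OF f r(1) _ r(3)] X(1) by simp
  ultimately show ?thesis
    using r(1) by (metis INF_lower dual_order.trans)
qed

text \<open>Excluding -\<infinity> keeps the two lower limits from being \<infinity> and
  -\<infinity>, where the superadditivity of \<open>liminf\<close> can fail.\<close>

lemma seq_lsc_on_add: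
  assumes "seq_lsc_on K f" "seq_lsc_on K g"
    and "\<And>\<xi>. \<xi> \<in> K \<Longrightarrow> f \<xi> \<noteq> -\<infinity>" "\<And>\<xi>. \<xi> \<in> K \<Longrightarrow> g \<xi> \<noteq> -\<infinity>"
  shows "seq_lsc_on K (\<lambda>\<xi>. f \<xi> + g \<xi>)"
  unfolding seq_lsc_on_def
proof (intro allI impI, elim conjE)
  fix X \<xi> assume *: "\<xi> \<in> K" "\<forall>n. X n \<in> K" "X \<longlonglongrightarrow> \<xi>"
  have 1: "f \<xi> \<le> liminf (\<lambda>n. f (X n))" "g \<xi> \<le> liminf (\<lambda>n. g (X n))"
    using seq_lsc_onD assms(1,2) * by blast+
  then have "f \<xi> + g \<xi> \<le> liminf (\<lambda>n. f (X n)) + liminf (\<lambda>n. g (X n))"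
    by (rule add_mono)
  also have "\<dots> \<le> liminf (\<lambda>n. f (X n) + g (X n))"
    using 1 assms(3,4)[OF *(1)] by (intro ereal_liminf_add_mono) auto
  finally show "f \<xi> + g \<xi> \<le> liminf (\<lambda>n. f (X n) + g (X n))" .
qed

lemma seq_lsc_on_continuous:
  assumes "continuous_on K P"
  shows "seq_lsc_on K (\<lambda>\<xi>. ereal (P \<xi>))"
  unfolding seq_lsc_on_def
proof (intro allI impI, elim conjE)
  fix X \<xi> assume *: "\<xi> \<in> K" "\<forall>n. X n \<in> K" "X \<longlonglongrightarrow> \<xi>"
  then have "(\<lambda>n. P (X n)) \<longlonglongrightarrow> P \<xi>"
    using assms by (auto simp: continuous_on_sequentially o_def)
  then have "(\<lambda>n. ereal (P (X n))) \<longlonglongrightarrow> ereal (P \<xi>)" by simp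
  from lim_imp_Liminf[OF sequentially_bot this]
  show "ereal (P \<xi>) \<le> liminf (\<lambda>n. ereal (P (X n)))" by simp
qed

lemma seq_lsc_on_compose:
  assumes "seq_lsc_on L f" "continuous_on K h" "h ` K \<subseteq> L"
  shows "seq_lsc_on K (\<lambda>\<xi>. f (h \<xi>))"
  unfolding seq_lsc_on_def
proof (intro allI impI, elim conjE)
  fix X \<xi> assume *: "\<xi> \<in> K" "\<forall>n. X n \<in> K" "X \<longlonglongrightarrow> \<xi>"
  then have "(\<lambda>n. h (X n)) \<longlonglongrightarrow> h \<xi>"
    using assms(2) by (auto simp: continuous_on_sequentially o_def)
  then show "f (h \<xi>) \<le> liminf (\<lambda>n. f (h (X n)))"
    using seq_lsc_onD[OF assms(1), of "h \<xi>" "\<lambda>n. h (X n)"] *(1,2) assms(3) by blast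
qed

lemma seq_lsc_onI:
  assumes "\<And>\<xi> c. \<xi> \<in> K \<Longrightarrow> c < f \<xi> \<Longrightarrow> \<exists>U. open U \<and> \<xi> \<in> U \<and> (\<forall>\<zeta>\<in>U \<inter> K. c < f \<zeta>)"
  shows "seq_lsc_on K f"
  unfolding seq_lsc_on_def le_Liminf_iff
proof (intro allI impI, elim conjE)
  fix X \<xi> c assume *: "\<xi> \<in> K" "\<forall>n. X n \<in> K" "X \<longlonglongrightarrow> \<xi>" "c < f \<xi>"
  obtain U where "open U" "\<xi> \<in> U" "\<forall>\<zeta>\<in>U \<inter> K. c < f \<zeta>" using assms[OF *(1,4)] by blast
  moreover from this have "\<forall>\<^sub>F n in sequentially. X n \<in> U"
    using *(3) topological_tendstoD by blast
  ultimately show "\<forall>\<^sub>F n in sequentially. c < f (X n)"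
    using *(2) by (auto elim!: eventually_mono)
qed

lemma lower_semicontinuous_on_nhd:
  assumes "lower_semicontinuous_on S f" "\<xi> \<in> S" "c < f \<xi>"
  shows "\<exists>U. open U \<and> \<xi> \<in> U \<and> (\<forall>\<zeta>\<in>U \<inter> S. c < f \<zeta>)"
proof -
  have "\<forall>\<^sub>F \<zeta> in at \<xi> within S. c < f \<zeta>"
    using assms unfolding lower_semicontinuous_on_def le_Liminf_iff by blast
  then obtain U where U: "open U" "\<xi> \<in> U" "\<And>\<zeta>. \<zeta> \<in> U \<Longrightarrow> \<zeta> \<noteq> \<xi> \<Longrightarrow> \<zeta> \<in> S \<Longrightarrow> c < f \<zeta>"
    unfolding eventually_at_topological by blast
  have "c < f \<zeta>" if "\<zeta> \<in> U \<inter> S" for \<zeta>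
    using U(3)[of \<zeta>] that assms(3) by (cases "\<zeta> = \<xi>") auto
  with U(1,2) show ?thesis by blast
qed

lemma lower_semicontinuous_on_seq_lsc_on:
  fixes f :: "'a::metric_space \<Rightarrow> ereal"
  shows "lower_semicontinuous_on S f \<Longrightarrow> seq_lsc_on S f"
  by (rule seq_lsc_onI) (rule lower_semicontinuous_on_nhd)

text \<open>On the frontier this takes exactly the limits in the boundary condition: the lower limit
  of \<open>u\<close>, and for \<open>- v\<close> the negative of the upper limit of
  \<open>v\<close>. The boundary condition thus becomes a sign condition on a compact set.\<close>

definition lsc_extension :: "'a::metric_space set \<Rightarrow> ('a \<Rightarrow> ereal) \<Rightarrow> 'a \<Rightarrow> ereal" where
  "lsc_extension S f \<xi> = (if \<xi> \<in> S then f \<xi> else Liminf (at \<xi> within S) f)"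

lemma seq_lsc_on_lsc_extension:
  assumes "lower_semicontinuous_on S f"
  shows "seq_lsc_on (closure S) (lsc_extension S f)"
proof (rule seq_lsc_onI)
  fix \<xi> c assume \<xi>: "\<xi> \<in> closure S" "c < lsc_extension S f \<xi>"
  \<comment> \<open>A lower limit preserves only weak inequalities; the intermediate value
    \<open>d\<close> makes the final one strict again.\<close>
  then obtain d where d: "c < d" "d < lsc_extension S f \<xi>" using dense by blast
  obtain U where U: "open U" "\<xi> \<in> U" "\<forall>\<zeta>\<in>U \<inter> S. d < f \<zeta>"
  proof (cases "\<xi> \<in> S")
    case True
    with d(2) have "d < f \<xi>" by (simp add: lsc_extension_def)
    from lower_semicontinuous_on_nhd[OF assms True this] show ?thesis
      by (elim exE conjE) (rule that)
  next
    case False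
    then have "\<forall>\<^sub>F \<zeta> in at \<xi> within S. d < f \<zeta>"
      using d(2) less_LiminfD by (auto simp: lsc_extension_def)
    then obtain U where U: "open U" "\<xi> \<in> U" "\<And>\<zeta>. \<zeta> \<in> U \<Longrightarrow> \<zeta> \<noteq> \<xi> \<Longrightarrow> \<zeta> \<in> S \<Longrightarrow> d < f \<zeta>"
      unfolding eventually_at_topological by blast
    have "\<forall>\<zeta>\<in>U \<inter> S. d < f \<zeta>" using U(3) False by auto
    with U(1,2) show ?thesis by (rule that)
  qed
  have "c < lsc_extension S f \<zeta>" if \<zeta>: "\<zeta> \<in> U" for \<zeta>
  proof (cases "\<zeta> \<in> S")
    case True
    with U(3) \<zeta> have "d < f \<zeta>" by simp
    with d(1) True show ?thesis by (simp add: lsc_extension_def)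
  next
    case False
    have "\<forall>\<^sub>F \<omega> in at \<zeta> within S. d \<le> f \<omega>"
      unfolding eventually_at_topological using U \<zeta> by (intro exI[of _ U]) (simp add: less_imp_le)
    then have "d \<le> Liminf (at \<zeta> within S) f"
      by (rule Liminf_bounded)
    then show ?thesis using d(1) False by (simp add: lsc_extension_def)
  qed
  with U(1,2) show "\<exists>U. open U \<and> \<xi> \<in> U \<and> (\<forall>\<zeta>\<in>U \<inter> closure S. c < lsc_extension S f \<zeta>)"
    by (intro exI[of _ U]) simp
qed

subsection \<open>Test functions with vanishing gradient\<close>

text \<open>At distance R from the origin the gradient of the profile has size R^(2m - 1) and its
  Hessian R^(2m - 2). Hence the operator is a constant times R^((2m - 1)(q - 1) - 1), and the last
  hypothesis says that this exponent is positive. For \<open>q\<close> near 1 this forces a high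
  power.\<close>

lemma power_profile_admissible:
  fixes p q c :: real and m :: nat
  assumes "q > 1" "c > 0" and m: "m \<ge> 2" "(2 * real m - 1) * (q - 1) > 1"
  shows "(\<lambda>r. c * r ^ (2 * m)) \<in> admissible_profiles (pq_operator p q :: real ^ 'n \<Rightarrow> real ^ 'n ^ 'n \<Rightarrow> real)"
proof -
  define g where "g x = c * norm x ^ (2 * m)" for x :: "real ^ 'n"
  define d where "d = 2 * real m * c"
  define s where "s x = d * (norm x)^(2 * m - 2)" for x :: "real ^ 'n"
  have d: "d > 0" using assms by (simp add: d_def)
  have g_alt: "g = (\<lambda>x. c * (x \<bullet> x) ^ m)"
    by (simp add: g_def fun_eq_iff power_mult power2_norm_eq_inner)
  have s_alt: "s = (\<lambda>x. d * (x \<bullet> x) ^ (m - 1))"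
  proof
    fix x
    have "2 * m - 2 = 2 * (m - 1)" by simp
    then show "s x = d * (x \<bullet> x) ^ (m - 1)"
      by (simp only: s_def power_mult power2_norm_eq_inner)
  qed
  have dg: "partial_deriv i g = (\<lambda>x. s x * x $ i)" for i
  proof
    fix x
    have "(g has_derivative (\<lambda>h. s x * (x \<bullet> h))) (at x)"
      unfolding g_alt s_alt d_def
      by (auto intro!: derivative_eq_intros simp: inner_commute)
    from partial_deriv_eqI[OF this] show "partial_deriv i g x = s x * x $ i"
      by (simp add: inner_axis)
  qed
  have gr: "grad g x = s x *\<^sub>R x" for x
    by (simp add: grad_def dg vec_eq_iff)
  have hs: "hessian g x $ i $ j = s x * (if i = j then 1 else 0) + s x * (2 * m - 2) * (x $ i * x $ j / (norm x)\<^sup>2)"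
    if "x \<noteq> 0" for x i j
  proof -
    obtain e where e: "m = Suc (Suc e)" using m(1) by (metis Suc_le_D numeral_2_eq_2 Suc_le_mono)
    have "((\<lambda>x. s x * x $ i) has_derivative
       (\<lambda>h. s x * h $ i + d * (real (Suc e) * (2 * (x \<bullet> h)) * (x \<bullet> x) ^ e) * x $ i)) (at x)"
      unfolding s_alt e
      by (rule derivative_eq_intros bounded_linear.has_derivative[OF bounded_linear_vec_nth] refl)+
         (cases e; simp add: fun_eq_iff inner_commute algebra_simps)
    note pd = partial_deriv_eqI[OF this, of j]
    have "(axis j 1 :: real ^ 'n) $ i = (if i = j then 1 else 0)" by (simp add: axis_def)
    with pd have "hessian g x $ i $ j = s x * (if i = j then 1 else 0) + d * (real (Suc e) * (2 * x $ j) * (x \<bullet> x) ^ e) * x $ i"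
      by (simp add: hessian_def dg inner_axis)
    also have "d * (real (Suc e) * (2 * x $ j) * (x \<bullet> x) ^ e) * x $ i = s x * (2 * m - 2) * (x $ i * x $ j / (norm x)\<^sup>2)"
      using that by (simp add: s_alt e power2_norm_eq_inner field_simps)
    finally show ?thesis .
  qed
  \<comment> \<open>The trace of (I + (p - 2) b)(I + (2m - 2) b), where b is the orthogonal
    projection onto the line of \<open>x\<close>, so that b has trace 1 and equals its
    square.\<close>
  define C where "C = CARD('n) + (2 * real m - 2) + (p - 2) * (1 + (2 * real m - 2))"
  define e where "e = (2 * real m - 1) * (q - 1) - 1"
  have op: "pq_operator p q (grad g x) (hessian g x) = d powr (q - 1) * C * norm x powr e" if x: "x \<noteq> 0" for x
  proof -
    define R where "R = norm x"
    have R: "R > 0" using x by (simp add: R_def)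
    have sx: "s x > 0" using d x by (simp add: s_def)
    define b where "b i j = x $ i * x $ j / R\<^sup>2" for i j
    have N: "norm (grad g x) = s x * R" using sx by (simp add: gr R_def)
    have cf: "pq_coeff p q (grad g x) i j = (s x * R) powr (q - 2) * ((if i = j then 1 else 0) + (p - 2) * b i j)" for i j
      unfolding pq_coeff_def N using sx R
      by (simp add: gr b_def power2_eq_square)
    have b1: "(\<Sum>i\<in>UNIV. b i i) = 1"
    proof -
      have "(\<Sum>i\<in>UNIV. x $ i * x $ i) = R\<^sup>2" by (simp add: R_def power2_norm_eq_inner inner_vec_def)
      then show ?thesis using R by (simp add: b_def flip: sum_divide_distrib)
    qed
    have bb: "b i j * b i j = b i i * b j j" for i j by (simp add: b_def)
    have "pq_operator p q (grad g x) (hessian g x)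
      = (\<Sum>i\<in>UNIV. \<Sum>j\<in>UNIV. (s x * R) powr (q - 2) * s x * (((if i = j then 1 else 0) + (p - 2) * b i j) * ((if i = j then 1 else 0) + (2 * m - 2) * b i j)))"
      unfolding pq_operator_eq_coeff_sum cf hs[OF x] R_def[symmetric] b_def[symmetric]
      by (simp add: algebra_simps)
    also have "\<dots> = (s x * R) powr (q - 2) * s x * (\<Sum>i\<in>UNIV. \<Sum>j\<in>UNIV. (if i = j then 1 + (p - 2 + (2 * m - 2)) * b i i else 0) + (p - 2) * (2 * m - 2) * (b i i * b j j))"
    proof -
      have "((if i = j then 1 else 0) + (p - 2) * b i j) * ((if i = j then 1 else 0) + (2 * m - 2) * b i j)
        = (if i = j then 1 + (p - 2 + (2 * m - 2)) * b i i else 0) + (p - 2) * (2 * m - 2) * (b i j * b i j)" for i j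
        by (cases "i = j") (simp_all add: algebra_simps)
      then show ?thesis by (simp only: bb sum_distrib_left)
    qed
    also have "(\<Sum>i\<in>UNIV. \<Sum>j\<in>UNIV. (if i = j then 1 + (p - 2 + (2 * m - 2)) * b i i else 0) + (p - 2) * (2 * m - 2) * (b i i * b j j)) = C"
    proof -
      have "(\<Sum>i\<in>UNIV. \<Sum>j\<in>UNIV. b i i * b j j) = (\<Sum>i\<in>UNIV. b i i) * (\<Sum>i\<in>UNIV. b i i)"
        by (simp add: sum_product)
      then have bbs: "(\<Sum>i\<in>UNIV. \<Sum>j\<in>UNIV. b i i * b j j) = 1" by (simp add: b1)
      have "(\<Sum>i\<in>UNIV. \<Sum>j\<in>UNIV. if i = j then 1 + k * b i i else 0) = real CARD('n) + k" for k :: real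
        by (simp add: sum.distrib b1 flip: sum_distrib_left)
      moreover have "(\<Sum>i\<in>UNIV. \<Sum>j\<in>UNIV. (if i = j then 1 + k * b i i else 0) + l * (b i i * b j j))
        = (\<Sum>i\<in>UNIV. \<Sum>j\<in>UNIV. if i = j then 1 + k * b i i else 0) + l * (\<Sum>i\<in>UNIV. \<Sum>j\<in>UNIV. b i i * b j j)" for k l :: real
        by (simp only: sum.distrib sum_distrib_left)
      ultimately show ?thesis
        using m(1) by (simp only: bbs) (simp add: C_def algebra_simps of_nat_diff)
    qed
    also have "(s x * R) powr (q - 2) * s x = d powr (q - 1) * R powr e"
    proof -
      have s1: "s x = d * R powr (2 * real m - 2)"
        using m(1) R powr_realpow[OF R, of "2 * m - 2"] by (simp add: s_def R_def of_nat_diff)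
      have s2: "s x * R = d * R powr (2 * real m - 1)"
        using R powr_add[of R "2 * real m - 2" 1] by (simp add: s1)
      have "(s x * R) powr (q - 2) * s x = (d powr (q - 2) * d) * (R powr ((2 * real m - 1) * (q - 2)) * R powr (2 * real m - 2))"
        unfolding s2 using d R by (simp add: s1 powr_mult powr_powr)
      also have "d powr (q - 2) * d = d powr (q - 1)"
        using d powr_add[of d "q - 2" 1] by simp
      also have "R powr ((2 * real m - 1) * (q - 2)) * R powr (2 * real m - 2) = R powr e"
        by (simp add: e_def algebra_simps flip: powr_add)
      finally show ?thesis .
    qed
    finally show ?thesis by (simp add: R_def)
  qed
  have "((\<lambda>x::real^'n. norm x powr e) \<longlongrightarrow> 0) (at 0)"
    using m(2) by (intro tendsto_zero_powrI tendsto_const tendsto_norm_zero tendsto_ident_at) (auto simp: e_def)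
  then have "((\<lambda>x::real^'n. d powr (q - 1) * C * norm x powr e) \<longlongrightarrow> 0) (at 0)"
    by (rule tendsto_mult_right_zero)
  then have lim: "((\<lambda>x. pq_operator p q (grad g x) (hessian g x)) \<longlongrightarrow> 0) (at 0)"
    by (rule Lim_transform_eventually) (auto simp: eventually_at_filter op)
  show ?thesis
    unfolding admissible_profiles_def mem_Collect_eq Let_def
  proof (rule exI[of _ "\<lambda>r. c * (2 * real m) * r ^ (2 * m - 1)"],
      rule exI[of _ "\<lambda>r. c * (2 * real m) * (2 * real m - 1) * r ^ (2 * m - 2)"], intro conjI allI impI)
    show "((\<lambda>r. c * r ^ (2 * m)) has_real_derivative c * (2 * real m) * r ^ (2 * m - 1)) (at r within {0..})" for r
      by (auto intro!: derivative_eq_intros)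
    have "2 * m - Suc (Suc 0) = 2 * m - 2" by simp
    then show "((\<lambda>r. c * (2 * real m) * r ^ (2 * m - 1)) has_real_derivative c * (2 * real m) * (2 * real m - 1) * r ^ (2 * m - 2)) (at r within {0..})" for r
      using m(1) by (auto intro!: derivative_eq_intros simp: of_nat_diff)
    show "continuous_on {0..} (\<lambda>r. c * (2 * real m) * (2 * real m - 1) * r ^ (2 * m - 2))"
      by (intro continuous_intros)
    show "0 < c * (2 * real m) * (2 * real m - 1) * r ^ (2 * m - 2)" if "0 < r" for r
      using that assms by simp
    show "((\<lambda>x::real^'n. pq_operator p q (grad (\<lambda>x. c * norm x ^ (2 * m)) x) (hessian (\<lambda>x. c * norm x ^ (2 * m)) x)) \<longlongrightarrow> 0) (at 0)"
      using lim unfolding g_def[abs_def] .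
  qed (use m in auto)
qed

text \<open>The test function has \<open>c + 1\<close> in place of \<open>c\<close>. The additional
  unit makes the contact strict, and the same function times -1 serves as the profile and the
  modulus that certify admissibility at a vanishing gradient.\<close>

lemma supersolution_degenerate_test:
  fixes p q c \<theta> :: real and m :: nat and \<Theta> :: "((real ^ 'n) \<times> real) set"
  assumes sup: "viscosity_supersolution p q \<Theta> u"
    and \<Theta>: "open \<Theta>" "(x0, t0) \<in> \<Theta>"
    and "q > 1" "c \<ge> 0" and m: "m \<ge> 2" "(2 * real m - 1) * (q - 1) > 1"
    and eq: "u (x0, t0) = ereal u0"
    and le: "\<And>y s. (y, s) \<in> \<Theta> \<Longrightarrow>
      ereal (u0 + \<theta> * (s - t0) - c * (norm (y - x0) ^ (2 * m) + (s - t0)\<^sup>2)) \<le> u (y, s)"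
  shows "\<theta> \<ge> 0"
proof -
  define G where "G y = - (c + 1) * ((y - x0) \<bullet> (y - x0)) ^ m" for y :: "real ^ 'n"
  define T where "T s = u0 + \<theta> * (s - t0) - (c + 1) * (s - t0)\<^sup>2" for s
  have G_alt: "G y = - (c + 1) * norm (y - x0) ^ (2 * m)" for y
    by (simp add: G_def power_mult power2_norm_eq_inner)
  have G: "real_polynomial_function G"
    unfolding G_def[abs_def]
    by (intro real_polynomial_function.intros(2,4) real_polynomial_function_power polynomial_dist_square)
  have id: "real_polynomial_function (\<lambda>s::real. s)"
    by (rule real_polynomial_function.intros(1)) (rule bounded_linear_ident)
  have T: "real_polynomial_function T"
    unfolding T_def[abs_def]
    by (intro real_polynomial_function_diff real_polynomial_function.intros(2-4) real_polynomial_function_power id)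
  have T': "(T has_real_derivative \<theta>) (at t0)"
    unfolding T_def[abs_def] by (auto intro!: derivative_eq_intros)
  have "(G has_derivative (\<lambda>h. 0)) (at x0)"
    unfolding G_def[abs_def] using m(1) by (auto intro!: derivative_eq_intros)
  from partial_deriv_eqI[OF this] have gr: "grad G x0 = 0"
    by (simp add: grad_def vec_eq_iff)
  define \<phi> where "\<phi> = (\<lambda>(y, s). G y + T s)"
  have C2: "C2_on \<phi> \<Theta>"
    unfolding \<phi>_def by (intro polynomial_C2_on polynomial_split G T)
  have sg: "space_grad \<phi> (x0, t0) = 0"
    unfolding \<phi>_def space_grad_split[OF G] gr ..
  have td: "time_deriv \<phi> (x0, t0) = \<theta>"
    unfolding \<phi>_def by (rule time_deriv_split[OF T'])
  have \<phi>0: "\<phi> (x0, t0) = u0" using m(1) by (simp add: \<phi>_def G_def T_def)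
  have "admissible_at p q \<phi> (x0, t0)"
  proof -
    have f: "(\<lambda>r. (c + 1) * r ^ (2 * m)) \<in> admissible_profiles (pq_operator p q :: real ^ 'n \<Rightarrow> real ^ 'n ^ 'n \<Rightarrow> real)"
      using assms by (intro power_profile_admissible) auto
    have \<sigma>: "(\<lambda>r. (c + 1) * r\<^sup>2) \<in> time_moduli"
      unfolding time_moduli_def mem_Collect_eq
    proof (intro conjI exI[of _ "\<lambda>r. 2 * (c + 1) * r"] allI)
      show "((\<lambda>r. (c + 1) * r\<^sup>2) has_real_derivative 2 * (c + 1) * r) (at r)" for r
        by (auto intro!: derivative_eq_intros)
      show "continuous_on UNIV (\<lambda>r. 2 * (c + 1) * r)" by (intro continuous_intros)
    qed (use \<open>c \<ge> 0\<close> in auto)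
    have "\<bar>\<phi> (x, t) - \<phi> (x0, t0) - time_deriv \<phi> (x0, t0) * (t - t0)\<bar>
            \<le> (c + 1) * norm (x - x0) ^ (2 * m) + (c + 1) * (t - t0)\<^sup>2" for x t
    proof -
      have "\<phi> (x, t) - \<phi> (x0, t0) - time_deriv \<phi> (x0, t0) * (t - t0)
        = - ((c + 1) * norm (x - x0) ^ (2 * m) + (c + 1) * (t - t0)\<^sup>2)"
        unfolding td \<phi>0 by (simp add: \<phi>_def G_alt T_def algebra_simps)
      moreover have "0 \<le> (c + 1) * norm (x - x0) ^ (2 * m) + (c + 1) * (t - t0)\<^sup>2"
        using \<open>c \<ge> 0\<close> by simp
      ultimately show ?thesis by linarith
    qed
    then show ?thesis
      unfolding admissible_at_def prod.case
      by (intro disjI2 exI[of _ 1] conjI bexI[OF _ f] bexI[OF _ \<sigma>]) auto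
  qed
  moreover have "touches_from_below \<phi> u (x0, t0)"
  proof -
    have "\<forall>\<^sub>F \<zeta> in at (x0, t0). \<zeta> \<in> \<Theta>"
      using \<Theta> by (simp add: eventually_at_topological) blast
    moreover have "\<forall>\<^sub>F \<zeta> in at (x0, t0). \<zeta> \<noteq> (x0, t0)"
      by (simp add: eventually_at_filter)
    ultimately have "\<forall>\<^sub>F \<zeta> in at (x0, t0). ereal (\<phi> \<zeta>) < u \<zeta>"
    proof eventually_elim
      case (elim \<zeta>)
      obtain y s where \<zeta>: "\<zeta> = (y, s)" by fastforce
      have "norm (y - x0) ^ (2 * m) + (s - t0)\<^sup>2 > 0"
        using elim(2) by (cases "y = x0") (auto simp: \<zeta> add_pos_nonneg add_nonneg_pos)
      then have "\<phi> \<zeta> < u0 + \<theta> * (s - t0) - c * (norm (y - x0) ^ (2 * m) + (s - t0)\<^sup>2)"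
        by (simp add: \<zeta> \<phi>_def G_alt T_def algebra_simps)
      then show ?case
        using le[of y s] elim(1) unfolding \<zeta> by (meson less_ereal.simps(1) less_le_trans)
    qed
    then show ?thesis by (simp add: touches_from_below_def eq \<phi>0)
  qed
  ultimately have "space_grad \<phi> (x0, t0) = 0 \<longrightarrow> time_deriv \<phi> (x0, t0) \<ge> 0"
    using sup \<Theta>(2) C2 unfolding viscosity_supersolution_def by blast
  then show ?thesis
    by (simp add: sg td)
qed

subsection \<open>Comparison at small scales\<close>

lemma partial_deriv_rescale:
  fixes H :: "real ^ 'n \<Rightarrow> real"
  assumes "real_polynomial_function H"
  shows "partial_deriv i (\<lambda>y. H ((y - x0) /\<^sub>R r)) = (\<lambda>y. partial_deriv i H ((y - x0) /\<^sub>R r) / r)"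
proof
  fix y
  have "((\<lambda>y. (y - x0) /\<^sub>R r) has_derivative (\<lambda>h. h /\<^sub>R r)) (at y)"
    by (auto intro!: derivative_eq_intros)
  from has_derivative_compose[OF this polynomial_has_derivative_grad(1)[OF assms]]
  have "((\<lambda>y. H ((y - x0) /\<^sub>R r)) has_derivative (\<lambda>h. (h /\<^sub>R r) \<bullet> grad H ((y - x0) /\<^sub>R r))) (at y)" .
  from partial_deriv_eqI[OF this]
  show "partial_deriv i (\<lambda>y. H ((y - x0) /\<^sub>R r)) y = partial_deriv i H ((y - x0) /\<^sub>R r) / r"
    by (simp add: grad_def inner_axis' divide_inverse mult.commute)
qed

lemma polynomial_rescale:
  fixes H :: "real ^ 'n \<Rightarrow> real"
  assumes "real_polynomial_function H"
  shows "real_polynomial_function (\<lambda>y. H ((y - x0) /\<^sub>R r))"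
proof -
  have "polynomial_function (\<lambda>y. (y - x0) /\<^sub>R r)"
    by (intro polynomial_function_cmul polynomial_function_diff polynomial_function_id polynomial_function_const)
  from real_polynomial_function_compose[OF this assms] show ?thesis
    by (simp add: o_def)
qed

text \<open>The factor \<open>r\<^sup>2\<close> compensates the two derivatives of the rescaled
  argument: the Hessian stays of order one while \<open>H\<close> perturbs the gradient only by
  order \<open>r\<close>.\<close>

lemma lin_op_rescaled_test:
  fixes H :: "real ^ 'n \<Rightarrow> real" and x0 \<eta> :: "real ^ 'n" and r :: real
  assumes H: "real_polynomial_function H" and r: "r \<noteq> 0"
  defines "G \<equiv> \<lambda>y. \<eta> \<bullet> (y - x0) + r\<^sup>2 * H ((y - x0) /\<^sub>R r)"
  shows "real_polynomial_function G"
    and "grad G y = \<eta> + r *\<^sub>R grad H ((y - x0) /\<^sub>R r)"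
    and "lin_op a G y = lin_op a H ((y - x0) /\<^sub>R r)"
proof -
  define R where "R y = H ((y - x0) /\<^sub>R r)" for y
  define l where "l y = \<eta> \<bullet> (y - x0)" for y
  have R: "real_polynomial_function R"
    unfolding R_def[abs_def] by (rule polynomial_rescale[OF H])
  have l_alt: "l = (\<lambda>y. \<eta> \<bullet> y - \<eta> \<bullet> x0)"
    by (simp add: l_def fun_eq_iff inner_diff_right)
  have l: "real_polynomial_function l"
    unfolding l_alt
    by (intro real_polynomial_function_diff real_polynomial_function.intros(1,2) bounded_linear_inner_right)
  have pl: "partial_deriv i l = (\<lambda>y. \<eta> $ i)" for i
  proof
    fix y
    have "(l has_derivative (\<lambda>h. \<eta> \<bullet> h)) (at y)"
      unfolding l_def[abs_def] by (auto intro!: derivative_eq_intros)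
    from partial_deriv_eqI[OF this] show "partial_deriv i l y = \<eta> $ i" by (simp add: inner_axis)
  qed
  have pR: "partial_deriv i R = (\<lambda>y. partial_deriv i H ((y - x0) /\<^sub>R r) / r)" for i
    unfolding R_def[abs_def] by (rule partial_deriv_rescale[OF H])
  have G_alt: "G = (\<lambda>y. l y + r\<^sup>2 * R y)"
    by (simp add: G_def l_def R_def)
  have cR: "real_polynomial_function (\<lambda>y. r\<^sup>2 * R y)"
    by (intro real_polynomial_function.intros(2,4) R)
  show "real_polynomial_function G"
    unfolding G_alt by (rule real_polynomial_function.intros(3)[OF l cR])
  show "grad G y = \<eta> + r *\<^sub>R grad H ((y - x0) /\<^sub>R r)"
    unfolding G_alt grad_def partial_deriv_add[OF l cR] partial_deriv_cmult[OF R] pl pR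
    using r by (simp add: vec_eq_iff power2_eq_square)
  have "lin_op a l y = 0"
    by (simp add: lin_op_def hessian_def pl partial_deriv_const)
  moreover have "r\<^sup>2 * lin_op a R y = lin_op a H ((y - x0) /\<^sub>R r)"
  proof -
    have "partial_deriv j (partial_deriv i R) = (\<lambda>y. partial_deriv j (partial_deriv i H) ((y - x0) /\<^sub>R r) / r / r)" for i j
    proof -
      have "partial_deriv j (partial_deriv i R) = partial_deriv j (\<lambda>y. (1/r) * partial_deriv i H ((y - x0) /\<^sub>R r))"
        by (simp add: pR)
      also have "\<dots> = (\<lambda>y. (1/r) * (partial_deriv j (partial_deriv i H) ((y - x0) /\<^sub>R r) / r))"
        using polynomial_partial_deriv[OF H]
        by (subst partial_deriv_cmult) (auto intro: polynomial_rescale simp: partial_deriv_rescale)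
      finally show ?thesis by simp
    qed
    then show ?thesis
      using r by (simp add: lin_op_def hessian_def sum_distrib_left power2_eq_square)
  qed
  ultimately show "lin_op a G y = lin_op a H ((y - x0) /\<^sub>R r)"
    unfolding G_alt lin_op_add[OF l cR] lin_op_cmult[OF R] by simp
qed

lemma lin_op_pq_coeff_perturb:
  fixes H :: "real ^ 'n \<Rightarrow> real"
  assumes H: "real_polynomial_function H" and E: "compact E" and \<eta>: "\<eta> \<noteq> 0" and e: "e > 0"
  shows "\<exists>r0>0. \<forall>r x. 0 < r \<and> r < r0 \<and> x \<in> E \<longrightarrow> \<eta> + r *\<^sub>R grad H x \<noteq> 0 \<and>
     \<bar>lin_op (pq_coeff p q (\<eta> + r *\<^sub>R grad H x)) H x - lin_op (pq_coeff p q \<eta>) H x\<bar> < e"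
proof -
  have "continuous_on E (\<lambda>x. norm (grad H x))"
    unfolding grad_def
    by (intro continuous_intros polynomial_continuous_on polynomial_partial_deriv H)
  then have "bounded ((\<lambda>x. norm (grad H x)) ` E)"
    using E compact_continuous_image compact_imp_bounded by blast
  then obtain M1 where M1: "M1 > 0" "\<And>x. x \<in> E \<Longrightarrow> norm (grad H x) \<le> M1"
    unfolding bounded_pos by auto
  have "continuous_on E (\<lambda>x. \<Sum>i\<in>UNIV. \<Sum>j\<in>UNIV. \<bar>hessian H x $ i $ j\<bar>)"
    unfolding hessian_def
    by (simp, intro continuous_intros polynomial_continuous_on polynomial_partial_deriv H)
  then have "bounded ((\<lambda>x. \<Sum>i\<in>UNIV. \<Sum>j\<in>UNIV. \<bar>hessian H x $ i $ j\<bar>) ` E)"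
    using E compact_continuous_image compact_imp_bounded by blast
  then obtain M2 where M2: "M2 > 0" "\<And>x. x \<in> E \<Longrightarrow> \<bar>\<Sum>i\<in>UNIV. \<Sum>j\<in>UNIV. \<bar>hessian H x $ i $ j\<bar>\<bar> \<le> M2"
    unfolding bounded_pos by auto
  have "\<forall>\<^sub>F \<eta>' in nhds \<eta>. \<forall>i. \<forall>j. \<bar>pq_coeff p q \<eta>' i j - pq_coeff p q \<eta> i j\<bar> < e / (2 * M2)"
  proof (intro eventually_all_finite)
    fix i j
    have "isCont (\<lambda>\<eta>. pq_coeff p q \<eta> i j) \<eta>"
      using continuous_on_eq_continuous_at[of "- {0}" "\<lambda>\<eta>. pq_coeff p q \<eta> i j"]
        continuous_on_pq_coeff[of p q i j] \<eta> by (simp add: open_Compl)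
    then have "((\<lambda>\<eta>. pq_coeff p q \<eta> i j) \<longlongrightarrow> pq_coeff p q \<eta> i j) (nhds \<eta>)"
      by (simp only: isCont_def tendsto_at_iff_tendsto_nhds[of "\<lambda>\<eta>. pq_coeff p q \<eta> i j"])
    from tendstoD[OF this, of "e / (2 * M2)"] show "\<forall>\<^sub>F \<eta>' in nhds \<eta>. \<bar>pq_coeff p q \<eta>' i j - pq_coeff p q \<eta> i j\<bar> < e / (2 * M2)"
      using e M2(1) by (simp add: dist_real_def)
  qed
  then obtain d where d: "d > 0" "\<And>\<eta>' i j. dist \<eta>' \<eta> < d \<Longrightarrow> \<bar>pq_coeff p q \<eta>' i j - pq_coeff p q \<eta> i j\<bar> < e / (2 * M2)"
    unfolding eventually_nhds_metric by blast
  \<comment> \<open>\<open>r * M1\<close> bounds the change of the gradient. Below \<open>d\<close>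
    it keeps the coefficients close, and below \<open>norm \<eta>\<close> it keeps the gradient away
    from the singularity at 0.\<close>
  define r0 where "r0 = min d (norm \<eta>) / M1"
  have "r0 > 0" using d(1) M1(1) \<eta> by (simp add: r0_def)
  moreover have "\<eta> + r *\<^sub>R grad H x \<noteq> 0 \<and>
     \<bar>lin_op (pq_coeff p q (\<eta> + r *\<^sub>R grad H x)) H x - lin_op (pq_coeff p q \<eta>) H x\<bar> < e"
    if r: "0 < r" "r < r0" "x \<in> E" for r x
  proof
    define \<eta>' where "\<eta>' = \<eta> + r *\<^sub>R grad H x"
    have "norm (r *\<^sub>R grad H x) \<le> r * M1"
      using M1(2)[OF r(3)] r(1) by simp
    also have "\<dots> < min d (norm \<eta>)"
      using r(2) M1(1) by (simp add: r0_def field_simps)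
    finally have n: "norm (r *\<^sub>R grad H x) < d" "norm (r *\<^sub>R grad H x) < norm \<eta>" by simp_all
    show "\<eta> + r *\<^sub>R grad H x \<noteq> 0"
    proof
      assume "\<eta> + r *\<^sub>R grad H x = 0"
      then have "r *\<^sub>R grad H x = - \<eta>" by (simp add: add_eq_0_iff)
      then have "norm (r *\<^sub>R grad H x) = norm \<eta>" by (metis norm_minus_cancel)
      with n(2) show False by simp
    qed
    have c: "\<bar>pq_coeff p q \<eta>' i j - pq_coeff p q \<eta> i j\<bar> \<le> e / (2 * M2)" for i j
      using d(2)[of \<eta>' i j] n(1) by (simp add: \<eta>'_def dist_norm)
    have "lin_op (pq_coeff p q \<eta>') H x - lin_op (pq_coeff p q \<eta>) H x
      = (\<Sum>i\<in>UNIV. \<Sum>j\<in>UNIV. (pq_coeff p q \<eta>' i j - pq_coeff p q \<eta> i j) * hessian H x $ i $ j)"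
      by (simp add: lin_op_def sum_subtractf left_diff_distrib)
    also have "\<bar>\<dots>\<bar> \<le> (\<Sum>i\<in>UNIV. \<Sum>j\<in>UNIV. e / (2 * M2) * \<bar>hessian H x $ i $ j\<bar>)"
      by (intro order_trans[OF sum_abs] sum_mono) (simp only: abs_mult, intro mult_right_mono c abs_ge_zero)
    also have "\<dots> = e / (2 * M2) * (\<Sum>i\<in>UNIV. \<Sum>j\<in>UNIV. \<bar>hessian H x $ i $ j\<bar>)"
      by (simp add: sum_distrib_left)
    also have "\<dots> \<le> e / (2 * M2) * M2"
      using M2(2)[OF r(3)] e M2(1) by (intro mult_left_mono) auto
    also have "\<dots> < e" using e M2(1) by simp
    finally show "\<bar>lin_op (pq_coeff p q (\<eta> + r *\<^sub>R grad H x)) H x - lin_op (pq_coeff p q \<eta>) H x\<bar> < e"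
      by (simp add: \<eta>'_def)
  qed
  ultimately show ?thesis by blast
qed

text \<open>If \<open>H 0\<close> were positive, the barrier would lie above \<open>u\<close> at the
  centre and below it on the boundary of the cylinder, so \<open>u\<close> minus the barrier would
  have an interior minimum. Testing there gives \<mu> \<le> \<theta> up to errors that vanish with
  \<open>r\<close>, against \<mu> > \<theta>. The threshold \<open>r0\<close> depends on
  \<open>H\<close>, \<open>T\<close> and \<open>K\<close>, but not on the boundary values of
  \<open>u\<close>.\<close>

lemma supersolution_barrier:
  fixes H :: "real ^ 'n \<Rightarrow> real"
  assumes sup: "viscosity_supersolution p q \<Theta> u" and p: "p > 1"
    and \<Theta>: "open \<Theta>" "(x0, t0) \<in> \<Theta>"
    and u0: "u (x0, t0) = ereal u0"
    and \<eta>: "\<eta> \<noteq> 0"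
    and H: "real_polynomial_function H" and \<mu>: "\<And>x. lin_op (pq_coeff p q \<eta>) H x = \<mu>" "\<mu> > \<theta>"
    and T: "T > 0"
  shows "\<exists>r0>0. \<forall>r. 0 < r \<and> r < r0 \<longrightarrow>
     (\<forall>x \<tau>. pq_quad p q \<eta> x \<le> 1 \<and> \<bar>\<tau>\<bar> \<le> T \<and> (pq_quad p q \<eta> x = 1 \<or> \<bar>\<tau>\<bar> = T) \<longrightarrow>
        ereal (u0 + r * (\<eta> \<bullet> x) + r * \<theta> * \<tau> + r\<^sup>2 * (H x - K * \<tau>\<^sup>2)) \<le> u (x0 + r *\<^sub>R x, t0 + r * \<tau>)) \<longrightarrow>
     H 0 \<le> 0"
proof -
  define E where "E = {x. pq_quad p q \<eta> x \<le> 1}"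
  define D where "D = E \<times> {-T..T}"
  have E: "compact E" unfolding E_def by (rule compact_pq_quad_ball[OF p \<eta>])
  have D: "compact D" unfolding D_def by (intro compact_Times E compact_Icc)
  have Q0: "pq_quad p q \<eta> 0 = 0" by (simp add: pq_quad_def)
  have D0: "(0, 0) \<in> D" using T by (simp add: D_def E_def Q0)
  obtain R where R: "R > 0" "\<And>z. z \<in> D \<Longrightarrow> norm z \<le> R"
    using compact_imp_bounded[OF D] unfolding bounded_pos by blast
  obtain \<delta> where \<delta>: "\<delta> > 0" "ball (x0, t0) \<delta> \<subseteq> \<Theta>"
    using \<Theta> open_contains_ball by blast
  obtain r1 where r1: "r1 > 0" "\<And>r x. 0 < r \<Longrightarrow> r < r1 \<Longrightarrow> x \<in> E \<Longrightarrow> \<eta> + r *\<^sub>R grad H x \<noteq> 0 \<and>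
     \<bar>lin_op (pq_coeff p q (\<eta> + r *\<^sub>R grad H x)) H x - lin_op (pq_coeff p q \<eta>) H x\<bar> < (\<mu> - \<theta>) / 2"
    using lin_op_pq_coeff_perturb[OF H E \<eta>, of "(\<mu> - \<theta>) / 2" p q] \<mu>(2) by auto
  \<comment> \<open>The three bounds keep the rescaled cylinder in \<Theta>, change the operator by
    less than half of \<mu> - \<theta>, and bound the time derivative of
    \<open>K * \<tau>\<^sup>2\<close> at scale \<open>r\<close> by the other half. The 1 added to
    \<open>\<bar>K\<bar>\<close> covers \<open>K = 0\<close>.\<close>
  define r0 where "r0 = min (min (\<delta> / R) r1) ((\<mu> - \<theta>) / (4 * (\<bar>K\<bar> + 1) * T))"
  have "r0 > 0"
    using \<delta>(1) R(1) r1(1) \<mu>(2) T by (simp add: r0_def)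
  moreover have "H 0 \<le> 0"
    if r: "0 < r" "r < r0" and bd: "\<And>x \<tau>. pq_quad p q \<eta> x \<le> 1 \<Longrightarrow> \<bar>\<tau>\<bar> \<le> T \<Longrightarrow> pq_quad p q \<eta> x = 1 \<or> \<bar>\<tau>\<bar> = T \<Longrightarrow>
        ereal (u0 + r * (\<eta> \<bullet> x) + r * \<theta> * \<tau> + r\<^sup>2 * (H x - K * \<tau>\<^sup>2)) \<le> u (x0 + r *\<^sub>R x, t0 + r * \<tau>)" for r
  proof (rule ccontr)
    assume H0: "\<not> H 0 \<le> 0"
    define P where "P = (\<lambda>(x, \<tau>). u0 + r * (\<eta> \<bullet> x) + r * \<theta> * \<tau> + r\<^sup>2 * (H x - K * \<tau>\<^sup>2))"
    define h :: "(real ^ 'n) \<times> real \<Rightarrow> (real ^ 'n) \<times> real" where "h z = (x0, t0) + r *\<^sub>R z" for z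
    have hD: "h z \<in> \<Theta>" if "z \<in> D" for z
    proof -
      have "norm (r *\<^sub>R z) \<le> r * R" using R(2)[OF that] r(1) by simp
      also have "\<dots> < \<delta>" using r(2) R(1) by (simp add: r0_def field_simps)
      finally show ?thesis using \<delta>(2) by (auto simp: h_def dist_norm)
    qed
    have uD: "u \<zeta> \<noteq> -\<infinity>" if "\<zeta> \<in> \<Theta>" for \<zeta>
      using sup that unfolding viscosity_supersolution_def by blast
    have "lower_semicontinuous_on \<Theta> u"
      using sup unfolding viscosity_supersolution_def by blast
    then have lsc: "seq_lsc_on \<Theta> u" by (rule lower_semicontinuous_on_seq_lsc_on)
    have "continuous_on D h"
      unfolding h_def[abs_def] by (intro continuous_intros)
    moreover have "h ` D \<subseteq> \<Theta>" using hD by (rule image_subsetI)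
    ultimately have lsc1: "seq_lsc_on D (\<lambda>z. u (h z))"
      by (rule seq_lsc_on_compose[OF lsc])
    have "continuous_on D (\<lambda>z. - P z)"
      unfolding P_def case_prod_beta'
      by (intro continuous_intros continuous_on_compose2[OF polynomial_continuous_on[OF H, of UNIV]]) auto
    then have lsc2: "seq_lsc_on D (\<lambda>z. ereal (- P z))"
      by (rule seq_lsc_on_continuous)
    have "seq_lsc_on D (\<lambda>z. u (h z) + ereal (- P z))"
      using uD hD by (intro seq_lsc_on_add[OF lsc1 lsc2]) simp_all
    then obtain z where z: "z \<in> D" "\<And>w. w \<in> D \<Longrightarrow> u (h z) + ereal (- P z) \<le> u (h w) + ereal (- P w)"
      using seq_lsc_on_attains_inf[OF D] D0 by blast
    obtain x \<tau> where x: "z = (x, \<tau>)" by fastforce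
    have P0: "P (0, 0) = u0 + r\<^sup>2 * H 0" "h (0, 0) = (x0, t0)"
      by (simp_all add: P_def h_def)
    have "u (h z) + ereal (- P z) \<le> ereal (- (r\<^sup>2 * H 0))"
      using z(2)[OF D0] by (simp add: P0 u0)
    moreover have neg: "- (r\<^sup>2 * H 0) < 0" using H0 r(1) by simp
    moreover have "u (h z) \<noteq> -\<infinity>" using uD hD z(1) by blast
    ultimately obtain U where U: "u (h z) = ereal U" "U - P z \<le> - (r\<^sup>2 * H 0)"
      by (cases "u (h z)") auto
    define m where "m = U - P z"
    have m: "m < 0" using U(2) neg by (simp add: m_def)
    have int: "pq_quad p q \<eta> x < 1 \<and> \<bar>\<tau>\<bar> < T"
    proof (rule ccontr)
      assume "\<not> ?thesis"
      moreover have "pq_quad p q \<eta> x \<le> 1" "\<bar>\<tau>\<bar> \<le> T" using z(1) by (auto simp: x D_def E_def)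
      ultimately have "ereal (P z) \<le> u (h z)"
        using bd[of x \<tau>] by (auto simp: P_def h_def x)
      then show False using m by (simp add: U m_def)
    qed
    define G where "G y = \<eta> \<bullet> (y - x0) + r\<^sup>2 * H ((y - x0) /\<^sub>R r)" for y
    \<comment> \<open>The summand \<open>m\<close>, the negative minimum of \<open>u\<close> minus
      the barrier, lowers the barrier until it touches \<open>u\<close> at the minimum
      point.\<close>
    define S where "S s = u0 + m + \<theta> * (s - t0) - K * (s - t0)\<^sup>2" for s
    note G = lin_op_rescaled_test[OF H, where r=r and \<eta>=\<eta> and ?x0.0=x0, folded G_def]
    have id: "real_polynomial_function (\<lambda>s::real. s)"
      by (rule real_polynomial_function.intros(1)) (rule bounded_linear_ident)
    have S: "real_polynomial_function S"
      unfolding S_def[abs_def]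
      by (intro real_polynomial_function_diff real_polynomial_function.intros(2-4) real_polynomial_function_power id)
    have S': "(S has_real_derivative \<theta> - 2 * K * (r * \<tau>)) (at (t0 + r * \<tau>))"
      unfolding S_def[abs_def] by (auto intro!: derivative_eq_intros)
    have hz: "h z = (x0 + r *\<^sub>R x, t0 + r * \<tau>)" by (simp add: h_def x)
    have GS: "G (x0 + r *\<^sub>R y) + S (t0 + r * s) = P (y, s) + m" for y s
      using r(1) by (simp add: G_def S_def P_def algebra_simps power2_eq_square)
    have xE: "x \<in> E" using z(1) by (simp add: x D_def)
    have rx: "(x0 + r *\<^sub>R x - x0) /\<^sub>R r = x" using r(1) by simp
    have near: "\<forall>\<^sub>F \<zeta> in at (x0 + r *\<^sub>R x, t0 + r * \<tau>). ereal (G (fst \<zeta>) + S (snd \<zeta>)) \<le> u \<zeta>"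
    proof -
      define k :: "(real ^ 'n) \<times> real \<Rightarrow> (real ^ 'n) \<times> real" where "k \<zeta> = (\<zeta> - (x0, t0)) /\<^sub>R r" for \<zeta>
      have hk: "h (k \<zeta>) = \<zeta>" for \<zeta> using r(1) by (simp add: h_def k_def)
      have kz: "k (x0 + r *\<^sub>R x, t0 + r * \<tau>) = (x, \<tau>)" using r(1) by (simp add: k_def)
      have "open ({x. pq_quad p q \<eta> x < 1} \<times> {-T<..<T})"
        by (intro open_Times open_greaterThanLessThan open_Collect_less continuous_on_const polynomial_continuous_on
            homogeneous_polynomial[OF homogeneous_pq_quad])
      then have op: "open (k -` ({x. pq_quad p q \<eta> x < 1} \<times> {-T<..<T}))"
        by (rule open_vimage) (auto simp: k_def intro!: continuous_intros)
      have "(x0 + r *\<^sub>R x, t0 + r * \<tau>) \<in> k -` ({x. pq_quad p q \<eta> x < 1} \<times> {-T<..<T})"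
        using int by (auto simp: kz)
      moreover have "ereal (G (fst \<zeta>) + S (snd \<zeta>)) \<le> u \<zeta>"
        if "\<zeta> \<in> k -` ({x. pq_quad p q \<eta> x < 1} \<times> {-T<..<T})" for \<zeta>
      proof -
        obtain y s where ys: "k \<zeta> = (y, s)" by fastforce
        have "k \<zeta> \<in> D" using that ys by (auto simp: D_def E_def)
        from z(2)[OF this] have "ereal m \<le> u \<zeta> + ereal (- P (y, s))"
          unfolding hk by (simp add: U m_def ys)
        then have "ereal (P (y, s) + m) \<le> u \<zeta>"
          by (cases "u \<zeta>") auto
        moreover have "\<zeta> = (x0 + r *\<^sub>R y, t0 + r * s)"
          using hk[of \<zeta>] by (simp add: ys h_def)
        ultimately show ?thesis by (simp add: GS)
      qed
      ultimately show ?thesis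
        unfolding eventually_at_topological using op by blast
    qed
    have nz: "grad G (x0 + r *\<^sub>R x) \<noteq> 0"
      using G(2)[of "x0 + r *\<^sub>R x"] r1(2)[of r x] r xE by (simp add: rx r0_def)
    have "lin_op (pq_coeff p q (grad G (x0 + r *\<^sub>R x))) G (x0 + r *\<^sub>R x) \<le> \<theta> - 2 * K * (r * \<tau>)"
    proof (rule supersolution_test[OF sup _ _ S S' _ near nz])
      show "(x0 + r *\<^sub>R x, t0 + r * \<tau>) \<in> \<Theta>" using hD[OF z(1)] by (simp add: hz)
      show "real_polynomial_function G" using G(1) r(1) by simp
      show "u (x0 + r *\<^sub>R x, t0 + r * \<tau>) = ereal (G (x0 + r *\<^sub>R x) + S (t0 + r * \<tau>))"
        unfolding GS using U(1) unfolding hz by (simp add: m_def x)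
    qed
    then have "lin_op (pq_coeff p q (\<eta> + r *\<^sub>R grad H x)) H x \<le> \<theta> - 2 * K * (r * \<tau>)"
      using G(2,3) r(1) by (simp add: rx)
    moreover have "\<bar>lin_op (pq_coeff p q (\<eta> + r *\<^sub>R grad H x)) H x - \<mu>\<bar> < (\<mu> - \<theta>) / 2"
      using r1(2)[of r x] r xE by (simp add: r0_def \<mu>(1))
    moreover have "\<bar>2 * K * (r * \<tau>)\<bar> \<le> (\<mu> - \<theta>) / 2"
    proof -
      have "\<bar>2 * K * (r * \<tau>)\<bar> = 2 * \<bar>K\<bar> * (r * \<bar>\<tau>\<bar>)" using r(1) by (simp add: abs_mult)
      also have "\<dots> \<le> 2 * (\<bar>K\<bar> + 1) * (r * T)"
        using int r(1) by (intro mult_mono) auto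
      also have "\<dots> \<le> (\<mu> - \<theta>) / 2"
      proof -
        have "r \<le> (\<mu> - \<theta>) / (4 * (\<bar>K\<bar> + 1) * T)" using r(2) by (simp add: r0_def)
        moreover have "4 * (\<bar>K\<bar> + 1) * T > 0" using T by simp
        ultimately have "r * (4 * (\<bar>K\<bar> + 1) * T) \<le> \<mu> - \<theta>" by (simp add: pos_le_divide_eq)
        then show ?thesis by (simp add: algebra_simps)
      qed
      finally show ?thesis .
    qed
    moreover have False if "L \<le> \<theta> - s" "\<bar>L - \<mu>\<bar> < (\<mu> - \<theta>) / 2" "\<bar>s\<bar> \<le> (\<mu> - \<theta>) / 2" for L s
      using that by (auto simp: abs_less_iff abs_le_iff)
    ultimately show False by blast
  qed
  ultimately show ?thesis by blast
qed

subsection \<open>Blow-up at a point of contact\<close>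

text \<open>A sup-convolution at scale \<open>r\<close>, restricted to a bounded set: it separates \<open>v\<close> from \<open>u\<close> and its
  bounds do not depend on \<open>r\<close>.\<close>

lemma separating_profile:
  fixes v u :: "(real ^ 'n) \<times> real \<Rightarrow> ereal" and x1 x2 \<eta> :: "real ^ 'n" and t1 t2 \<theta> \<epsilon> C r R :: real
  assumes quad: "\<And>a \<alpha> b \<beta>. norm a + \<bar>\<alpha>\<bar> < \<delta> \<Longrightarrow> norm b + \<bar>\<beta>\<bar> < \<delta> \<Longrightarrow>
      v (x1 + a, t1 + \<alpha>) \<le> u (x2 + b, t2 + \<beta>) + ereal (v1 - u2 + \<epsilon> * \<beta> + \<eta> \<bullet> (a - b) + \<theta> * (\<alpha> - \<beta>)
         + C * ((norm (a - b))\<^sup>2 + (\<alpha> - \<beta>)\<^sup>2))"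
    and fin: "\<And>a \<alpha>. norm a + \<bar>\<alpha>\<bar> < \<delta> \<Longrightarrow> v (x1 + a, t1 + \<alpha>) \<noteq> \<infinity>"
      "\<And>a \<alpha>. norm a + \<bar>\<alpha>\<bar> < \<delta> \<Longrightarrow> u (x2 + a, t2 + \<alpha>) \<noteq> -\<infinity>"
    and v1: "v (x1, t1) = ereal v1" and u2: "u (x2, t2) = ereal u2"
    and C: "C \<ge> 0" and R: "R \<ge> 1" "\<And>x. x \<in> E \<Longrightarrow> norm x \<le> R" and E0: "0 \<in> E"
    and r: "0 < r" "r * (2 * R) < \<delta>"
  shows "\<exists>g. (\<forall>x\<in>E. \<bar>g x\<bar> \<le> 2 * C * R\<^sup>2) \<and>
    (\<forall>x\<in>E. \<forall>y\<in>E. g x \<le> g y + 4 * C * R * norm (x - y)) \<and>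
    (\<forall>x\<in>E. \<forall>\<tau>. \<bar>\<tau>\<bar> \<le> 1 \<longrightarrow>
       v (x1 + r *\<^sub>R x, t1 + r * \<tau>) \<le> ereal (v1 + r * (\<eta> \<bullet> x) + r * \<theta> * \<tau> + r\<^sup>2 * (g x + C * \<tau>\<^sup>2)) \<and>
       ereal (u2 + r * (\<eta> \<bullet> x) + r * (\<theta> - \<epsilon>) * \<tau> + r\<^sup>2 * (g x - 3 * C * \<bar>\<tau>\<bar>)) \<le> u (x2 + r *\<^sub>R x, t2 + r * \<tau>))"
proof -
  have small: "norm (r *\<^sub>R x) + \<bar>r * \<tau>\<bar> < \<delta>" if "x \<in> E" "\<bar>\<tau>\<bar> \<le> 1" for x \<tau>
  proof -
    have "norm x + \<bar>\<tau>\<bar> \<le> 2 * R" using R(1) R(2)[OF that(1)] that(2) by simp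
    then have "r * (norm x + \<bar>\<tau>\<bar>) \<le> r * (2 * R)" using r(1) by (intro mult_left_mono) auto
    with r show ?thesis by (simp add: abs_mult distrib_left)
  qed
  \<comment> \<open>The set collects the points where \<open>v\<close> is finite, and
    \<open>V\<close> is the second-order remainder of \<open>v\<close> there after division by
    \<open>r\<^sup>2\<close>. Where \<open>v\<close> is -\<infinity>, the required upper bound is
    trivial.\<close>
  define S where "S = {(a, \<alpha>). a \<in> E \<and> \<bar>\<alpha>\<bar> \<le> 1 \<and> v (x1 + r *\<^sub>R a, t1 + r * \<alpha>) \<noteq> -\<infinity>}"
  define V where "V = (\<lambda>(a, \<alpha>). (real_of_ereal (v (x1 + r *\<^sub>R a, t1 + r * \<alpha>)) - v1 - r * (\<eta> \<bullet> a) - r * \<theta> * \<alpha>) / r\<^sup>2)"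
  have vV: "v (x1 + r *\<^sub>R a, t1 + r * \<alpha>) = ereal (v1 + r * (\<eta> \<bullet> a) + r * \<theta> * \<alpha> + r\<^sup>2 * V (a, \<alpha>))"
    if "(a, \<alpha>) \<in> S" for a \<alpha>
  proof -
    have "v (x1 + r *\<^sub>R a, t1 + r * \<alpha>) \<noteq> -\<infinity>" "v (x1 + r *\<^sub>R a, t1 + r * \<alpha>) \<noteq> \<infinity>"
      using that fin(1)[OF small] by (auto simp: S_def)
    then obtain w where w: "v (x1 + r *\<^sub>R a, t1 + r * \<alpha>) = ereal w"
      by (cases "v (x1 + r *\<^sub>R a, t1 + r * \<alpha>)") auto
    show ?thesis using r(1) by (simp add: w V_def)
  qed
  \<comment> \<open>The term \<epsilon> \<beta> in the contact inequality moves to the side of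
    \<open>u\<close> and changes its slope in time from \<theta> to \<theta> - \<epsilon>.\<close>
  have key: "ereal (u2 + r * (\<eta> \<bullet> b) + r * (\<theta> - \<epsilon>) * \<beta> + r\<^sup>2 * (V (a, \<alpha>) - C * ((norm (a - b))\<^sup>2 + (\<alpha> - \<beta>)\<^sup>2)))
      \<le> u (x2 + r *\<^sub>R b, t2 + r * \<beta>)"
    if S: "(a, \<alpha>) \<in> S" and b: "b \<in> E" "\<bar>\<beta>\<bar> \<le> 1" for a b \<alpha> \<beta>
  proof -
    have a: "a \<in> E" "\<bar>\<alpha>\<bar> \<le> 1" using S by (auto simp: S_def)
    have e: "C * ((norm (r *\<^sub>R a - r *\<^sub>R b))\<^sup>2 + (r * \<alpha> - r * \<beta>)\<^sup>2) = r\<^sup>2 * (C * ((norm (a - b))\<^sup>2 + (\<alpha> - \<beta>)\<^sup>2))"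
    proof -
      have "norm (r *\<^sub>R a - r *\<^sub>R b) = r * norm (a - b)" "r * \<alpha> - r * \<beta> = r * (\<alpha> - \<beta>)"
        using r(1) by (simp_all add: right_diff_distrib flip: scaleR_diff_right)
      then show ?thesis by (simp add: power_mult_distrib distrib_left mult_ac)
    qed
    have "v (x1 + r *\<^sub>R a, t1 + r * \<alpha>) \<le> u (x2 + r *\<^sub>R b, t2 + r * \<beta>) + ereal (v1 - u2 + \<epsilon> * (r * \<beta>) + \<eta> \<bullet> (r *\<^sub>R a - r *\<^sub>R b) + \<theta> * (r * \<alpha> - r * \<beta>)
         + r\<^sup>2 * (C * ((norm (a - b))\<^sup>2 + (\<alpha> - \<beta>)\<^sup>2)))"
      using quad[OF small[OF a] small[OF b]] unfolding e .
    then have q: "ereal (v1 + r * (\<eta> \<bullet> a) + r * \<theta> * \<alpha> + r\<^sup>2 * V (a, \<alpha>)) \<le>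
      u (x2 + r *\<^sub>R b, t2 + r * \<beta>) + ereal (v1 - u2 + \<epsilon> * (r * \<beta>) + \<eta> \<bullet> (r *\<^sub>R a - r *\<^sub>R b) + \<theta> * (r * \<alpha> - r * \<beta>)
         + r\<^sup>2 * (C * ((norm (a - b))\<^sup>2 + (\<alpha> - \<beta>)\<^sup>2)))"
      unfolding vV[OF S] .
    show ?thesis
    proof (cases "u (x2 + r *\<^sub>R b, t2 + r * \<beta>)")
      case (real w)
      then show ?thesis using q by (simp add: inner_diff_right algebra_simps)
    qed (use fin(2)[OF small[OF b]] in auto)
  qed
  have V0: "(0, 0) \<in> S" "V (0, 0) = 0"
    using E0 by (auto simp: S_def V_def v1)
  have Vle: "V (a, \<alpha>) \<le> C * ((norm a)\<^sup>2 + \<alpha>\<^sup>2)" if "(a, \<alpha>) \<in> S" for a \<alpha>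
  proof -
    have "r\<^sup>2 * (V (a, \<alpha>) - C * ((norm a)\<^sup>2 + \<alpha>\<^sup>2)) \<le> 0"
      using key[OF that E0, of 0] by (simp add: u2)
    then show ?thesis using r(1) by (simp add: mult_le_0_iff)
  qed
  \<comment> \<open>The quadratic penalty is taken at time 0 only, so that \<open>g\<close> depends
    on space alone. Moving from time 0 to \<tau> costs \<open>C * \<tau>\<^sup>2\<close> on the side
    of \<open>v\<close> and \<open>3 * C * \<bar>\<tau>\<bar>\<close> on the side of
    \<open>u\<close>.\<close>
  define W where "W x = (\<lambda>z. V z - C * ((norm (fst z - x))\<^sup>2 + (snd z)\<^sup>2))" for x
  define g where "g x = (SUP z\<in>S. W x z)" for x
  have M: "C * ((norm a)\<^sup>2 + \<alpha>\<^sup>2) \<le> 2 * C * R\<^sup>2" if "a \<in> E" "\<bar>\<alpha>\<bar> \<le> 1" for a \<alpha>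
  proof -
    have "(norm a)\<^sup>2 \<le> R\<^sup>2" using R(2)[OF that(1)] by (intro power_mono) auto
    moreover have "\<alpha>\<^sup>2 \<le> R\<^sup>2"
      using R(1) that(2) by (simp flip: abs_le_square_iff)
    ultimately have "(norm a)\<^sup>2 + \<alpha>\<^sup>2 \<le> 2 * R\<^sup>2" by simp
    from mult_left_mono[OF this C] show ?thesis by simp
  qed
  have Wle: "W x z \<le> 2 * C * R\<^sup>2" if "z \<in> S" for x z
  proof -
    obtain a \<alpha> where z: "z = (a, \<alpha>)" by fastforce
    have "V z \<le> 2 * C * R\<^sup>2"
      using Vle[of a \<alpha>] M[of a \<alpha>] that unfolding z by (auto simp: S_def)
    moreover have "0 \<le> C * ((norm (fst z - x))\<^sup>2 + (snd z)\<^sup>2)" using C by simp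
    ultimately show ?thesis by (simp add: W_def)
  qed
  have bdd: "bdd_above (W x ` S)" for x
    using Wle by (auto intro!: bdd_aboveI)
  have ne: "S \<noteq> {}" using V0(1) by blast
  have up: "W x z \<le> g x" if "z \<in> S" for x z
    unfolding g_def by (rule cSUP_upper[OF that bdd])
  have le: "g x \<le> c" if "\<And>z. z \<in> S \<Longrightarrow> W x z \<le> c" for x c
    unfolding g_def by (rule cSUP_least[OF ne that])
  have b: "\<bar>g x\<bar> \<le> 2 * C * R\<^sup>2" if "x \<in> E" for x
  proof -
    have "- (2 * C * R\<^sup>2) \<le> W x (0, 0)"
      using M[OF that, of 0] by (simp add: W_def V0)
    also have "\<dots> \<le> g x" by (rule up[OF V0(1)])
    finally show ?thesis using le[OF Wle] by (simp add: abs_le_iff)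
  qed
  have lip: "g x \<le> g y + 4 * C * R * norm (x - y)" if xy: "x \<in> E" "y \<in> E" for x y
  proof (rule le)
    fix z assume z: "z \<in> S"
    obtain a \<alpha> where za: "z = (a, \<alpha>)" by fastforce
    have a: "norm a \<le> R" using z R(2) by (auto simp: za S_def)
    have "(norm (a - y))\<^sup>2 - (norm (a - x))\<^sup>2 = (norm (a - y) - norm (a - x)) * (norm (a - y) + norm (a - x))"
      by (simp add: power2_eq_square algebra_simps)
    also have "\<dots> \<le> norm (x - y) * (4 * R)"
    proof (rule mult_mono)
      show "norm (a - y) - norm (a - x) \<le> norm (x - y)"
        using norm_triangle_ineq[of "a - x" "x - y"] by simp
      show "norm (a - y) + norm (a - x) \<le> 4 * R"
        using norm_triangle_ineq4[of a x] norm_triangle_ineq4[of a y] a R(2)[OF xy(1)] R(2)[OF xy(2)] by linarith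
    qed auto
    finally have "C * ((norm (a - y))\<^sup>2 - (norm (a - x))\<^sup>2) \<le> C * (norm (x - y) * (4 * R))"
      using C by (rule mult_left_mono)
    then have "W x z \<le> W y z + 4 * C * R * norm (x - y)"
      by (simp add: W_def za algebra_simps)
    also have "W y z \<le> g y" by (rule up[OF z])
    finally show "W x z \<le> g y + 4 * C * R * norm (x - y)" by simp
  qed
  have lower: "v (x1 + r *\<^sub>R x, t1 + r * \<tau>) \<le> ereal (v1 + r * (\<eta> \<bullet> x) + r * \<theta> * \<tau> + r\<^sup>2 * (g x + C * \<tau>\<^sup>2))"
    if x: "x \<in> E" "\<bar>\<tau>\<bar> \<le> 1" for x \<tau>
  proof (cases "(x, \<tau>) \<in> S")
    case True
    have "V (x, \<tau>) \<le> g x + C * \<tau>\<^sup>2"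
      using up[OF True, of x] by (simp add: W_def)
    then have "r\<^sup>2 * V (x, \<tau>) \<le> r\<^sup>2 * (g x + C * \<tau>\<^sup>2)" by (rule mult_left_mono) simp
    then show ?thesis by (simp add: vV[OF True])
  next
    case False
    then show ?thesis using x by (simp add: S_def)
  qed
  have upper: "ereal (u2 + r * (\<eta> \<bullet> x) + r * (\<theta> - \<epsilon>) * \<tau> + r\<^sup>2 * (g x - 3 * C * \<bar>\<tau>\<bar>)) \<le> u (x2 + r *\<^sub>R x, t2 + r * \<tau>)"
    if x: "x \<in> E" "\<bar>\<tau>\<bar> \<le> 1" for x \<tau>
  proof (cases "u (x2 + r *\<^sub>R x, t2 + r * \<tau>)")
    case (real w)
    define c where "c = (w - u2 - r * (\<eta> \<bullet> x) - r * (\<theta> - \<epsilon>) * \<tau>) / r\<^sup>2"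
    have w: "w = u2 + r * (\<eta> \<bullet> x) + r * (\<theta> - \<epsilon>) * \<tau> + r\<^sup>2 * c"
      using r(1) by (simp add: c_def)
    have "g x \<le> c + 3 * C * \<bar>\<tau>\<bar>"
    proof (rule le)
      fix z assume z: "z \<in> S"
      obtain a \<alpha> where za: "z = (a, \<alpha>)" by fastforce
      have \<alpha>: "\<bar>\<alpha>\<bar> \<le> 1" using z by (auto simp: za S_def)
      have "r\<^sup>2 * (V (a, \<alpha>) - C * ((norm (a - x))\<^sup>2 + (\<alpha> - \<tau>)\<^sup>2)) \<le> r\<^sup>2 * c"
        using key[OF z[unfolded za] x] unfolding real w by simp
      then have 1: "V (a, \<alpha>) - C * ((norm (a - x))\<^sup>2 + (\<alpha> - \<tau>)\<^sup>2) \<le> c"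
        using r(1) by simp
      \<comment> \<open>Origin of the factor 3: \<open>\<bar>\<tau>\<bar> \<le> 1\<close> bounds the
        square by \<open>\<bar>\<tau>\<bar>\<close>, and the mixed term contributes at most twice
        that.\<close>
      have "(\<alpha> - \<tau>)\<^sup>2 - \<alpha>\<^sup>2 = \<bar>\<tau>\<bar> * \<bar>\<tau>\<bar> + 2 * (- \<alpha> * \<tau>)"
        by (simp add: power2_eq_square algebra_simps)
      also have "\<bar>\<tau>\<bar> * \<bar>\<tau>\<bar> \<le> 1 * \<bar>\<tau>\<bar>" using x(2) by (intro mult_right_mono) auto
      also have "- \<alpha> * \<tau> \<le> \<bar>\<alpha>\<bar> * \<bar>\<tau>\<bar>" by (metis abs_ge_self abs_minus_cancel abs_mult)
      also have "\<bar>\<alpha>\<bar> * \<bar>\<tau>\<bar> \<le> 1 * \<bar>\<tau>\<bar>" using \<alpha> by (intro mult_right_mono) auto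
      finally have "(\<alpha> - \<tau>)\<^sup>2 - \<alpha>\<^sup>2 \<le> 3 * \<bar>\<tau>\<bar>" by simp
      then have "C * ((\<alpha> - \<tau>)\<^sup>2 - \<alpha>\<^sup>2) \<le> C * (3 * \<bar>\<tau>\<bar>)" using C by (rule mult_left_mono)
      with 1 show "W x z \<le> c + 3 * C * \<bar>\<tau>\<bar>"
        by (simp add: W_def za algebra_simps)
    qed
    then have "r\<^sup>2 * (g x - 3 * C * \<bar>\<tau>\<bar>) \<le> r\<^sup>2 * c" by (intro mult_left_mono) auto
    then show ?thesis unfolding real by (simp add: w)
  qed (use fin(2)[OF small[OF x]] in auto)
  show ?thesis
    using b lip lower upper by blast
qed

text \<open>The barriers satisfy \<open>lin_op A H1 = \<theta> - \<epsilon> / 3\<close> and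
  \<open>lin_op A H2 = \<theta> - 2 * \<epsilon> / 3\<close>, strict on the correct sides of
  \<theta> for \<open>v\<close> and of \<theta> - \<epsilon> for \<open>u\<close>. Comparison at
  small scales gives \<open>H1 0 \<ge> 0 \<ge> H2 0\<close>. But their boundary values nearly agree,
  and the larger right-hand side pushes \<open>H1\<close> below \<open>H2\<close> at the
  centre.\<close>

lemma no_nondegenerate_contact:
  fixes v u :: "(real ^ 'n) \<times> real \<Rightarrow> ereal" and x1 x2 \<eta> :: "real ^ 'n" and t1 t2 \<theta> \<epsilon> C :: real
  assumes p: "p > 1"
    and u: "viscosity_supersolution p q \<Theta> u" and v: "viscosity_subsolution p q \<Theta> v"
    and \<Theta>: "open \<Theta>" "(x1, t1) \<in> \<Theta>" "(x2, t2) \<in> \<Theta>"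
    and v1: "v (x1, t1) = ereal v1" and u2: "u (x2, t2) = ereal u2"
    and \<eta>: "\<eta> \<noteq> 0" and \<epsilon>: "\<epsilon> > 0" and C: "C \<ge> 0" and \<delta>: "\<delta> > 0"
    and quad: "\<And>a \<alpha> b \<beta>. norm a + \<bar>\<alpha>\<bar> < \<delta> \<Longrightarrow> norm b + \<bar>\<beta>\<bar> < \<delta> \<Longrightarrow>
      (x1 + a, t1 + \<alpha>) \<in> \<Theta> \<Longrightarrow> (x2 + b, t2 + \<beta>) \<in> \<Theta> \<Longrightarrow>
      v (x1 + a, t1 + \<alpha>) \<le> u (x2 + b, t2 + \<beta>) + ereal (v1 - u2 + \<epsilon> * \<beta> + \<eta> \<bullet> (a - b) + \<theta> * (\<alpha> - \<beta>)
         + C * ((norm (a - b))\<^sup>2 + (\<alpha> - \<beta>)\<^sup>2))"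
  shows False
proof -
  have v': "viscosity_supersolution p q \<Theta> (\<lambda>\<xi>. - v \<xi>)"
    using v by (simp add: viscosity_subsolution_def)
  define Q where "Q = pq_quad p q \<eta>"
  define E where "E = {x. Q x \<le> 1}"
  define N where "N = real CARD('n)"
  have N: "N > 0" by (simp add: N_def)
  have E: "compact E" unfolding E_def Q_def by (rule compact_pq_quad_ball[OF p \<eta>])
  have Q0: "Q 0 = 0" by (simp add: Q_def pq_quad_def)
  have Qpoly: "real_polynomial_function Q"
    unfolding Q_def by (rule homogeneous_polynomial[OF homogeneous_pq_quad])
  obtain R' where "R' > 0" "\<And>x. x \<in> E \<Longrightarrow> norm x \<le> R'"
    using compact_imp_bounded[OF E] unfolding bounded_pos by blast
  then obtain R where R: "R \<ge> 1" "\<And>x. x \<in> E \<Longrightarrow> norm x \<le> R"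
    by (metis max.coboundedI2 max.cobounded1)
  have near: "\<exists>d>0. \<forall>a \<alpha>. norm a + \<bar>\<alpha>\<bar> < d \<longrightarrow> (x + a, t + \<alpha>) \<in> \<Theta>" if xt: "(x, t) \<in> \<Theta>" for x t
  proof -
    obtain d where d: "d > 0" "ball (x, t) d \<subseteq> \<Theta>"
      using \<Theta>(1) xt open_contains_ball by blast
    have "(x + a, t + \<alpha>) \<in> \<Theta>" if "norm a + \<bar>\<alpha>\<bar> < d" for a \<alpha>
    proof -
      have "dist (x, t) (x + a, t + \<alpha>) = norm (a, \<alpha>)"
        by (simp add: dist_norm norm_prod_def)
      also have "\<dots> \<le> norm a + norm \<alpha>" by (rule norm_Pair_le)
      finally show ?thesis using d(2) that by (auto simp: mem_ball)
    qed
    then show ?thesis using d(1) by blast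
  qed
  obtain d1 where d1: "d1 > 0" "\<And>a \<alpha>. norm a + \<bar>\<alpha>\<bar> < d1 \<Longrightarrow> (x1 + a, t1 + \<alpha>) \<in> \<Theta>"
    using near[OF \<Theta>(2)] by blast
  obtain d2 where d2: "d2 > 0" "\<And>a \<alpha>. norm a + \<bar>\<alpha>\<bar> < d2 \<Longrightarrow> (x2 + a, t2 + \<alpha>) \<in> \<Theta>"
    using near[OF \<Theta>(3)] by blast
  define d where "d = min \<delta> (min d1 d2)"
  have d: "d > 0" using \<delta> d1(1) d2(1) by (simp add: d_def)
  define P where "P r g \<longleftrightarrow> (\<forall>x\<in>E. \<bar>g x\<bar> \<le> 2 * C * R\<^sup>2) \<and>
    (\<forall>x\<in>E. \<forall>y\<in>E. g x \<le> g y + 4 * C * R * norm (x - y)) \<and>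
    (\<forall>x\<in>E. \<forall>\<tau>. \<bar>\<tau>\<bar> \<le> 1 \<longrightarrow>
       v (x1 + r *\<^sub>R x, t1 + r * \<tau>) \<le> ereal (v1 + r * (\<eta> \<bullet> x) + r * \<theta> * \<tau> + r\<^sup>2 * (g x + C * \<tau>\<^sup>2)) \<and>
       ereal (u2 + r * (\<eta> \<bullet> x) + r * (\<theta> - \<epsilon>) * \<tau> + r\<^sup>2 * (g x - 3 * C * \<bar>\<tau>\<bar>)) \<le> u (x2 + r *\<^sub>R x, t2 + r * \<tau>))"
    for r g
  have ex: "\<exists>g. P r g" if r: "0 < r" "r * (2 * R) < d" for r
    unfolding P_def
  proof (rule separating_profile[where \<delta>=d])
    show "v (x1 + a, t1 + \<alpha>) \<le> u (x2 + b, t2 + \<beta>) + ereal (v1 - u2 + \<epsilon> * \<beta> + \<eta> \<bullet> (a - b) + \<theta> * (\<alpha> - \<beta>)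
         + C * ((norm (a - b))\<^sup>2 + (\<alpha> - \<beta>)\<^sup>2))"
      if "norm a + \<bar>\<alpha>\<bar> < d" "norm b + \<bar>\<beta>\<bar> < d" for a \<alpha> b \<beta>
      using that by (intro quad d1(2) d2(2)) (simp_all add: d_def)
    show "v (x1 + a, t1 + \<alpha>) \<noteq> \<infinity>" if "norm a + \<bar>\<alpha>\<bar> < d" for a \<alpha>
      using d1(2)[of a \<alpha>] that v' unfolding viscosity_supersolution_def d_def by force
    show "u (x2 + a, t2 + \<alpha>) \<noteq> -\<infinity>" if "norm a + \<bar>\<alpha>\<bar> < d" for a \<alpha>
      using d2(2)[of a \<alpha>] that u unfolding viscosity_supersolution_def d_def by force
    show "0 \<in> E" by (simp add: E_def Q0)
  qed (use r R C v1 u2 in auto)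
  define \<rho> where "\<rho> n = d / (4 * R) / (real n + 1)" for n
  have \<rho>: "0 < \<rho> n" "\<rho> n * (2 * R) < d" for n
  proof -
    show "0 < \<rho> n" using d R(1) by (simp add: \<rho>_def)
    have "\<rho> n \<le> d / (4 * R)"
      using d R(1) by (simp add: \<rho>_def divide_le_eq)
    then have "\<rho> n * (2 * R) \<le> d / (4 * R) * (2 * R)" using R(1) by (intro mult_right_mono) auto
    also have "\<dots> < d" using d R(1) by simp
    finally show "\<rho> n * (2 * R) < d" .
  qed
  have \<rho>0: "\<rho> \<longlonglongrightarrow> 0"
  proof -
    have "\<rho> = (\<lambda>n. d / (4 * R) * inverse (real (Suc n)))"
      unfolding \<rho>_def[abs_def] of_nat_Suc add.commute[of 1] divide_inverse ..
    with tendsto_mult_right_zero[OF LIMSEQ_inverse_real_of_nat, of "d / (4 * R)"] show ?thesis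
      by (simp only:)
  qed
  have "\<forall>n. \<exists>g. P (\<rho> n) g" using ex \<rho> by blast
  then obtain g where g: "\<And>n. P (\<rho> n) (g n)" by metis
  have gb: "norm (g n x) \<le> 2 * C * R\<^sup>2" if "x \<in> E" for n x
    using g[of n] that unfolding P_def by simp
  have glip: "\<bar>g n x - g n y\<bar> \<le> 4 * C * R * norm (x - y)" if "x \<in> E" "y \<in> E" for n x y
  proof -
    have "g n x \<le> g n y + 4 * C * R * norm (x - y)" "g n y \<le> g n x + 4 * C * R * norm (y - x)"
      using g[of n] that unfolding P_def by blast+
    then show ?thesis by (simp add: norm_minus_commute abs_le_iff)
  qed
  have equi: "\<exists>d>0. \<forall>n y. y \<in> E \<and> norm (x - y) < d \<longrightarrow> norm (g n x - g n y) < e" if "x \<in> E" "e > 0" for x e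
  proof (intro exI[of _ "e / (4 * C * R + 1)"] conjI allI impI)
    have pos: "4 * C * R + 1 > 0" using C R(1) by (simp add: add_nonneg_pos)
    then show "e / (4 * C * R + 1) > 0" using that by simp
    fix n y assume y: "y \<in> E \<and> norm (x - y) < e / (4 * C * R + 1)"
    have "norm (g n x - g n y) \<le> 4 * C * R * norm (x - y)" using glip that y by simp
    also have "\<dots> \<le> (4 * C * R + 1) * norm (x - y)" by (intro mult_right_mono) auto
    also have "\<dots> < e" using y pos by (simp add: field_simps)
    finally show "norm (g n x - g n y) < e" .
  qed
  obtain g0 k where g0: "continuous_on E g0" "strict_mono (k :: nat \<Rightarrow> nat)"
    "\<And>e. 0 < e \<Longrightarrow> \<exists>N. \<forall>n x. n \<ge> N \<and> x \<in> E \<longrightarrow> norm (g (k n) x - g0 x) < e"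
    using Arzela_Ascoli[OF E gb equi] by metis
  \<comment> \<open>The gap at the centre is \<epsilon> / (6 N), and the boundary margins cost
    \<open>6 * \<kappa>\<close>, which this choice makes half of the gap.\<close>
  define \<kappa> where "\<kappa> = \<epsilon> / (72 * N)"
  have \<kappa>: "\<kappa> > 0" using \<epsilon> N by (simp add: \<kappa>_def)
  obtain f where f: "real_polynomial_function f" "\<And>x. x \<in> E \<Longrightarrow> \<bar>g0 x - f x\<bar> < \<kappa>"
    using Stone_Weierstrass_real_polynomial_function[OF E g0(1) \<kappa>] by blast
  define A where "A = pq_coeff p q \<eta>"
  have Q2: "homogeneous 2 Q" unfolding Q_def by (rule homogeneous_pq_quad)
  have AQ: "(\<Sum>j\<in>UNIV. A i j * partial_deriv j Q x) = 2 * x $ i" for i x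
    unfolding A_def Q_def by (rule pq_coeff_pq_quad[OF p \<eta>])
  have Asym: "A i j = A j i" for i j unfolding A_def by (rule pq_coeff_sym)
  obtain h where h: "real_polynomial_function h" "lin_op A h = (\<lambda>x. 0)" "\<And>x. Q x = 1 \<Longrightarrow> h x = f x"
    by (rule polynomial_harmonic_extension[OF Asym Q2 AQ f(1)]) blast
  \<comment> \<open>Adding \<open>l * Q\<close> raises the right-hand side by
    \<open>2 * N * l\<close> and shifts the boundary values by the constant \<open>l\<close>, which
    \<open>c\<close> corrects. Taking \<open>l\<close> at the thirds of the interval from \<theta> -
    \<epsilon> to \<theta> leaves room for strictness on both sides and for a gap between the
    barriers.\<close>
  define H where "H c l x = h x + (c + l * Q x)" for c l x
  have Hpoly: "real_polynomial_function (H c l)" for c l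
    unfolding H_def[abs_def] by (intro real_polynomial_function.intros(2-4) h(1) Qpoly)
  have HL: "lin_op A (H c l) x = l * (2 * N)" for c l x
  proof -
    have lQ: "real_polynomial_function (\<lambda>x. l * Q x)"
      by (intro real_polynomial_function.intros(2,4) Qpoly)
    show ?thesis
      unfolding H_def[abs_def] lin_op_add[OF h(1) real_polynomial_function.intros(3)[OF real_polynomial_function.intros(2) lQ]]
        lin_op_add[OF real_polynomial_function.intros(2) lQ] lin_op_cmult[OF Qpoly] lin_op_const h(2)
        lin_op_quadratic[OF Asym Q2 AQ] N_def by simp
  qed
  define l1 where "l1 = (\<theta> - \<epsilon> / 3) / (2 * N)"
  define l2 where "l2 = (\<theta> - 2 * \<epsilon> / 3) / (2 * N)"
  \<comment> \<open>The margin \<open>3 * \<kappa>\<close> on \<open>Q = 1\<close> splits into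
    \<kappa> for the polynomial approximation, \<kappa> for the uniform convergence, and \<kappa>
    for the dependence on time.\<close>
  define H1 where "H1 = H (3 * \<kappa> - l1) l1"
  define H2 where "H2 = H (- 3 * \<kappa> - l2) l2"
  have H1Q: "H1 x = f x + 3 * \<kappa>" and H2Q: "H2 x = f x - 3 * \<kappa>" if "Q x = 1" for x
    using h(3)[OF that] that by (simp_all add: H1_def H2_def H_def)
  have "bounded (H1 ` E)" "bounded (H2 ` E)"
    unfolding H1_def H2_def
    by (intro compact_imp_bounded compact_continuous_image polynomial_continuous_on Hpoly E)+
  then have "\<exists>B1. \<forall>x\<in>E. \<bar>H1 x\<bar> \<le> B1" "\<exists>B2. \<forall>x\<in>E. \<bar>H2 x\<bar> \<le> B2"
    unfolding bounded_iff by auto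
  then obtain B1 B2 where B12: "\<forall>x\<in>E. \<bar>H1 x\<bar> \<le> B1" "\<forall>x\<in>E. \<bar>H2 x\<bar> \<le> B2" by blast
  define B where "B = max B1 B2"
  have B: "\<bar>H1 x\<bar> \<le> B" "\<bar>H2 x\<bar> \<le> B" if "x \<in> E" for x
    using B12 that by (auto simp: B_def le_max_iff_disj)
  \<comment> \<open>Short enough for both time errors of the separating function to stay below
    \<kappa>, and at most 1, the range in which the separation is known.\<close>
  define T where "T = min 1 (\<kappa> / (3 * C + 1))"
  have T: "T > 0" "T \<le> 1" using \<kappa> C by (simp_all add: T_def)
  have CT: "3 * C * \<bar>\<tau>\<bar> \<le> \<kappa>" "C * \<tau>\<^sup>2 \<le> \<kappa>" if "\<bar>\<tau>\<bar> \<le> T" for \<tau>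
  proof -
    have "T \<le> \<kappa> / (3 * C + 1)" by (simp add: T_def)
    then have "(3 * C + 1) * T \<le> \<kappa>" using C by (simp add: field_simps)
    moreover have "3 * C * \<bar>\<tau>\<bar> \<le> (3 * C + 1) * T" using that C by (intro mult_mono) auto
    ultimately show 1: "3 * C * \<bar>\<tau>\<bar> \<le> \<kappa>" by linarith
    have "\<tau>\<^sup>2 = \<bar>\<tau>\<bar> * \<bar>\<tau>\<bar>" by (simp add: power2_eq_square)
    also have "\<dots> \<le> 3 * \<bar>\<tau>\<bar>" using that T(2) by (intro mult_right_mono) auto
    finally have "C * \<tau>\<^sup>2 \<le> C * (3 * \<bar>\<tau>\<bar>)" using C by (rule mult_left_mono)
    with 1 show "C * \<tau>\<^sup>2 \<le> \<kappa>" by simp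
  qed
  \<comment> \<open>At the ends \<open>\<bar>\<tau>\<bar> = T\<close> there is no relation between
    barrier and separating function, so \<open>K * T\<^sup>2\<close> has to exceed the sum of their
    bounds and the time error.\<close>
  define K where "K = (B + 2 * C * R\<^sup>2 + \<kappa>) / T\<^sup>2"
  have "B \<ge> 0" using B(1)[of 0] by (simp add: E_def Q0)
  then have K: "K \<ge> 0" "K * T\<^sup>2 = B + 2 * C * R\<^sup>2 + \<kappa>"
    using C \<kappa> T(1) by (simp_all add: K_def)
  \<comment> \<open>For the supersolution \<open>- v\<close> all data change sign: slope
    \<open>- \<eta>\<close>, time slope \<open>- \<theta>\<close>, barrier \<open>- H1\<close>, and
    the requirement becomes \<open>- (\<theta> - \<epsilon> / 3) > - \<theta>\<close>.\<close>
  obtain r1 where r1: "r1 > 0" "\<And>r. 0 < r \<Longrightarrow> r < r1 \<Longrightarrow>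
     (\<And>x \<tau>. Q x \<le> 1 \<Longrightarrow> \<bar>\<tau>\<bar> \<le> T \<Longrightarrow> Q x = 1 \<or> \<bar>\<tau>\<bar> = T \<Longrightarrow>
        ereal (- v1 + r * (- \<eta> \<bullet> x) + r * (- \<theta>) * \<tau> + r\<^sup>2 * (- 1 * H1 x - K * \<tau>\<^sup>2)) \<le> - v (x1 + r *\<^sub>R x, t1 + r * \<tau>)) \<Longrightarrow>
     - 1 * H1 0 \<le> 0"
  proof -
    have "lin_op (pq_coeff p q (- \<eta>)) (\<lambda>x. - 1 * H1 x) x = - (\<theta> - \<epsilon> / 3)" for x
      unfolding lin_op_cmult[OF Hpoly[of "3 * \<kappa> - l1" l1, folded H1_def]] pq_coeff_minus A_def[symmetric]
      using N by (simp add: H1_def HL l1_def)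
    moreover have "pq_quad p q (- \<eta>) = Q" by (simp add: Q_def pq_quad_def fun_eq_iff)
    moreover have "real_polynomial_function (\<lambda>x. - 1 * H1 x)"
      unfolding H1_def by (intro real_polynomial_function.intros(2,4) Hpoly)
    moreover have "- v (x1, t1) = ereal (- v1)" by (simp add: v1)
    ultimately show ?thesis
      using that supersolution_barrier[OF v' p \<Theta>(1,2), of "- v1" "- \<eta>" "\<lambda>x. - 1 * H1 x" "- (\<theta> - \<epsilon> / 3)" "- \<theta>" T K]
        \<eta> \<epsilon> T(1) by auto
  qed
  obtain r2 where r2: "r2 > 0" "\<And>r. 0 < r \<Longrightarrow> r < r2 \<Longrightarrow>
     (\<And>x \<tau>. Q x \<le> 1 \<Longrightarrow> \<bar>\<tau>\<bar> \<le> T \<Longrightarrow> Q x = 1 \<or> \<bar>\<tau>\<bar> = T \<Longrightarrow>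
        ereal (u2 + r * (\<eta> \<bullet> x) + r * (\<theta> - \<epsilon>) * \<tau> + r\<^sup>2 * (H2 x - K * \<tau>\<^sup>2)) \<le> u (x2 + r *\<^sub>R x, t2 + r * \<tau>)) \<Longrightarrow>
     H2 0 \<le> 0"
  proof -
    have "lin_op (pq_coeff p q \<eta>) H2 x = \<theta> - 2 * \<epsilon> / 3" for x
      unfolding A_def[symmetric] H2_def HL using N by (simp add: l2_def)
    then show ?thesis
      using that supersolution_barrier[OF u p \<Theta>(1,3) u2 \<eta> Hpoly[of "- 3 * \<kappa> - l2" l2, folded H2_def], of "\<theta> - 2 * \<epsilon> / 3" "\<theta> - \<epsilon>" T K, folded Q_def]
        \<epsilon> T(1) by auto
  qed
  obtain n0 where n0: "\<And>n x. n \<ge> n0 \<Longrightarrow> x \<in> E \<Longrightarrow> \<bar>g (k n) x - g0 x\<bar> < \<kappa>"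
    using g0(3)[OF \<kappa>] by auto
  have lim: "(\<rho> \<circ> k) \<longlonglongrightarrow> 0" using \<rho>0 g0(2) by (rule LIMSEQ_subseq_LIMSEQ)
  have "\<forall>\<^sub>F n in sequentially. (\<rho> \<circ> k) n < min r1 r2"
    by (rule order_tendstoD(2)[OF lim]) (simp add: r1(1) r2(1))
  then obtain n where n: "n \<ge> n0" "\<rho> (k n) < min r1 r2"
    unfolding eventually_sequentially by (metis comp_apply max.cobounded1 max.cobounded2)
  \<comment> \<open>The scale is fixed only here: the barriers, \<open>T\<close> and
    \<open>K\<close>, hence also \<open>r1\<close> and \<open>r2\<close>, were built from the limit
    \<open>g0\<close> and do not depend on \<open>n\<close>.\<close>
  define r where "r = \<rho> (k n)"
  define G where "G = g (k n)"
  have r: "0 < r" "r < r1" "r < r2" using \<rho>(1) n(2) by (auto simp: r_def)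
  have Gf: "\<bar>G x - f x\<bar> < 2 * \<kappa>" if "x \<in> E" for x
    using n0[OF n(1) that] f(2)[OF that] unfolding G_def by linarith
  have Gb: "\<bar>G x\<bar> \<le> 2 * C * R\<^sup>2" if "x \<in> E" for x
    using gb[OF that] by (simp add: G_def)
  have Gv: "v (x1 + r *\<^sub>R x, t1 + r * \<tau>) \<le> ereal (v1 + r * (\<eta> \<bullet> x) + r * \<theta> * \<tau> + r\<^sup>2 * (G x + C * \<tau>\<^sup>2))"
    and Gu: "ereal (u2 + r * (\<eta> \<bullet> x) + r * (\<theta> - \<epsilon>) * \<tau> + r\<^sup>2 * (G x - 3 * C * \<bar>\<tau>\<bar>)) \<le> u (x2 + r *\<^sub>R x, t2 + r * \<tau>)"
    if "x \<in> E" "\<bar>\<tau>\<bar> \<le> 1" for x \<tau>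
    using g[of "k n"] that unfolding P_def r_def G_def by blast+
  have K\<tau>: "K * \<tau>\<^sup>2 = B + 2 * C * R\<^sup>2 + \<kappa>" if "\<bar>\<tau>\<bar> = T" for \<tau>
    using K(2) that by (metis power2_abs)
  have "- 1 * H1 0 \<le> 0"
  proof (rule r1(2)[OF r(1,2)])
    fix x \<tau> assume x: "Q x \<le> 1" "\<bar>\<tau>\<bar> \<le> T" "Q x = 1 \<or> \<bar>\<tau>\<bar> = T"
    have xE: "x \<in> E" using x(1) by (simp add: E_def)
    have "G x + C * \<tau>\<^sup>2 \<le> H1 x + K * \<tau>\<^sup>2"
      using x(3)
    proof
      assume "Q x = 1"
      moreover have "K * \<tau>\<^sup>2 \<ge> 0" using K(1) by simp
      ultimately show ?thesis
        using H1Q[of x] Gf[OF xE] CT(2)[OF x(2)] by linarith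
    next
      assume "\<bar>\<tau>\<bar> = T"
      then show ?thesis
        using K\<tau>[of \<tau>] B(1)[OF xE] Gb[OF xE] CT(2)[OF x(2)] by linarith
    qed
    then have "r\<^sup>2 * (G x + C * \<tau>\<^sup>2) \<le> r\<^sup>2 * (H1 x + K * \<tau>\<^sup>2)" by (rule mult_left_mono) simp
    then have "ereal (v1 + r * (\<eta> \<bullet> x) + r * \<theta> * \<tau> + r\<^sup>2 * (G x + C * \<tau>\<^sup>2)) \<le> ereal (v1 + r * (\<eta> \<bullet> x) + r * \<theta> * \<tau> + r\<^sup>2 * (H1 x + K * \<tau>\<^sup>2))"
      by simp
    then have "v (x1 + r *\<^sub>R x, t1 + r * \<tau>) \<le> ereal (v1 + r * (\<eta> \<bullet> x) + r * \<theta> * \<tau> + r\<^sup>2 * (H1 x + K * \<tau>\<^sup>2))"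
      using Gv[OF xE, of \<tau>] x(2) T(2) by (meson order_trans)
    then have "- ereal (v1 + r * (\<eta> \<bullet> x) + r * \<theta> * \<tau> + r\<^sup>2 * (H1 x + K * \<tau>\<^sup>2)) \<le> - v (x1 + r *\<^sub>R x, t1 + r * \<tau>)"
      by (simp only: ereal_minus_le_minus)
    then show "ereal (- v1 + r * (- \<eta> \<bullet> x) + r * (- \<theta>) * \<tau> + r\<^sup>2 * (- 1 * H1 x - K * \<tau>\<^sup>2)) \<le> - v (x1 + r *\<^sub>R x, t1 + r * \<tau>)"
      by (simp add: algebra_simps)
  qed
  moreover have "H2 0 \<le> 0"
  proof (rule r2(2)[OF r(1,3)])
    fix x \<tau> assume x: "Q x \<le> 1" "\<bar>\<tau>\<bar> \<le> T" "Q x = 1 \<or> \<bar>\<tau>\<bar> = T"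
    have xE: "x \<in> E" using x(1) by (simp add: E_def)
    have "H2 x - K * \<tau>\<^sup>2 \<le> G x - 3 * C * \<bar>\<tau>\<bar>"
      using x(3)
    proof
      assume "Q x = 1"
      moreover have "K * \<tau>\<^sup>2 \<ge> 0" using K(1) by simp
      ultimately show ?thesis
        using H2Q[of x] Gf[OF xE] CT(1)[OF x(2)] by linarith
    next
      assume "\<bar>\<tau>\<bar> = T"
      then show ?thesis
        using K\<tau>[of \<tau>] B(2)[OF xE] Gb[OF xE] CT(1)[OF x(2)] by linarith
    qed
    then have "r\<^sup>2 * (H2 x - K * \<tau>\<^sup>2) \<le> r\<^sup>2 * (G x - 3 * C * \<bar>\<tau>\<bar>)" by (rule mult_left_mono) simp
    then have "ereal (u2 + r * (\<eta> \<bullet> x) + r * (\<theta> - \<epsilon>) * \<tau> + r\<^sup>2 * (H2 x - K * \<tau>\<^sup>2)) \<le> ereal (u2 + r * (\<eta> \<bullet> x) + r * (\<theta> - \<epsilon>) * \<tau> + r\<^sup>2 * (G x - 3 * C * \<bar>\<tau>\<bar>))"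
      by simp
    then show "ereal (u2 + r * (\<eta> \<bullet> x) + r * (\<theta> - \<epsilon>) * \<tau> + r\<^sup>2 * (H2 x - K * \<tau>\<^sup>2)) \<le> u (x2 + r *\<^sub>R x, t2 + r * \<tau>)"
      using Gu[OF xE, of \<tau>] x(2) T(2) by (meson order_trans)
  qed
  moreover have "H1 0 - H2 0 = 6 * \<kappa> - \<epsilon> / (6 * N)"
    using N by (simp add: H1_def H2_def H_def Q0 l1_def l2_def field_simps)
  moreover have "6 * \<kappa> < \<epsilon> / (6 * N)" using \<epsilon> N by (simp add: \<kappa>_def field_simps)
  ultimately show False by linarith
qed

subsection \<open>Doubling of variables\<close>

text \<open>By induction on the polynomial: the remainder of a product splits into three terms, each
  quadratic in \<open>h\<close>, because increments are bounded by a constant times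
  \<open>norm h\<close> on the unit ball.\<close>

lemma polynomial_taylor_bound:
  fixes f :: "real ^ 'n \<Rightarrow> real"
  assumes "real_polynomial_function f"
  shows "\<exists>C\<ge>0. \<forall>h. norm h \<le> 1 \<longrightarrow> \<bar>f (x + h) - f x - h \<bullet> grad f x\<bar> \<le> C * (norm h)\<^sup>2"
  using assms
proof induction
  case (linear f)
  have "f = (\<lambda>h. h \<bullet> grad f x)"
    using has_derivative_unique[OF bounded_linear.has_derivative[OF linear has_derivative_ident[of "at x"]]
      polynomial_has_derivative_grad(1)[OF real_polynomial_function.intros(1)[OF linear]]] .
  then have "f (x + h) - f x - h \<bullet> grad f x = 0" for h
    using linear_add[OF bounded_linear.linear[OF linear], of x h] by (metis add_diff_cancel_left' diff_self)
  then show ?case by (intro exI[of _ 0]) simp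
next
  case (const c)
  have "grad (\<lambda>x::real^'n. c) x = 0" by (simp add: grad_def partial_deriv_const vec_eq_iff)
  then show ?case by (intro exI[of _ 0]) simp
next
  case (add f g)
  then obtain C1 C2 where C: "C1 \<ge> 0" "C2 \<ge> 0"
    "\<And>h. norm h \<le> 1 \<Longrightarrow> \<bar>f (x + h) - f x - h \<bullet> grad f x\<bar> \<le> C1 * (norm h)\<^sup>2"
    "\<And>h. norm h \<le> 1 \<Longrightarrow> \<bar>g (x + h) - g x - h \<bullet> grad g x\<bar> \<le> C2 * (norm h)\<^sup>2"
    by blast
  have gr: "grad (\<lambda>x. f x + g x) x = grad f x + grad g x"
    using add.hyps by (simp add: grad_def partial_deriv_add vec_eq_iff)
  show ?case
  proof (intro exI[of _ "C1 + C2"] conjI allI impI)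
    fix h :: "real ^ 'n" assume h: "norm h \<le> 1"
    show "\<bar>f (x + h) + g (x + h) - (f x + g x) - h \<bullet> grad (\<lambda>x. f x + g x) x\<bar> \<le> (C1 + C2) * (norm h)\<^sup>2"
      using C(3,4)[OF h] unfolding gr inner_add_right distrib_right by linarith
  qed (use C in auto)
next
  case (mult f g)
  then obtain C1 C2 where C: "C1 \<ge> 0" "C2 \<ge> 0"
    "\<And>h. norm h \<le> 1 \<Longrightarrow> \<bar>f (x + h) - f x - h \<bullet> grad f x\<bar> \<le> C1 * (norm h)\<^sup>2"
    "\<And>h. norm h \<le> 1 \<Longrightarrow> \<bar>g (x + h) - g x - h \<bullet> grad g x\<bar> \<le> C2 * (norm h)\<^sup>2"
    by blast
  have gr: "grad (\<lambda>x. f x * g x) x = f x *\<^sub>R grad g x + g x *\<^sub>R grad f x"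
    using mult.hyps by (simp add: grad_def partial_deriv_mult vec_eq_iff)
  define A where "A = C1 + norm (grad f x)"
  have A: "A \<ge> 0" using C by (simp add: A_def)
  show ?case
  proof (intro exI[of _ "(\<bar>f x\<bar> + A) * C2 + A * norm (grad g x) + \<bar>g x\<bar> * C1"] conjI allI impI)
    show "0 \<le> (\<bar>f x\<bar> + A) * C2 + A * norm (grad g x) + \<bar>g x\<bar> * C1" using A C by simp
    fix h :: "real ^ 'n" assume h: "norm h \<le> 1"
    define F where "F = f (x + h) - f x"
    define DF where "DF = h \<bullet> grad f x"
    define DG where "DG = h \<bullet> grad g x"
    have DF: "\<bar>DF\<bar> \<le> norm h * norm (grad f x)" and DG: "\<bar>DG\<bar> \<le> norm h * norm (grad g x)"
      unfolding DF_def DG_def by (rule Cauchy_Schwarz_ineq2)+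
    have F1: "\<bar>F - DF\<bar> \<le> C1 * (norm h)\<^sup>2" using C(3)[OF h] by (simp add: F_def DF_def)
    have "(norm h)\<^sup>2 \<le> norm h" using h by (simp add: power2_eq_square mult_left_le)
    then have "C1 * (norm h)\<^sup>2 \<le> C1 * norm h" using C(1) by (rule mult_left_mono)
    then have F2: "\<bar>F\<bar> \<le> A * norm h" using F1 DF unfolding A_def by (simp add: algebra_simps)
    also have "\<dots> \<le> A" using h A by (simp add: mult_left_le)
    finally have F3: "\<bar>f (x + h)\<bar> \<le> \<bar>f x\<bar> + A" by (simp add: F_def)
    have e: "f (x + h) * g (x + h) - f x * g x - h \<bullet> grad (\<lambda>x. f x * g x) x
      = f (x + h) * (g (x + h) - g x - DG) + F * DG + g x * (F - DF)"
      unfolding gr F_def DF_def DG_def inner_add_right inner_scaleR_right by (simp add: algebra_simps)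
    have "\<bar>f (x + h) * (g (x + h) - g x - DG)\<bar> \<le> (\<bar>f x\<bar> + A) * (C2 * (norm h)\<^sup>2)"
      unfolding abs_mult using F3 C(4)[OF h] A by (intro mult_mono) (auto simp: DG_def)
    moreover have "\<bar>F * DG\<bar> \<le> (A * norm h) * (norm h * norm (grad g x))"
      unfolding abs_mult using F2 DG A by (intro mult_mono) auto
    moreover have "\<bar>g x * (F - DF)\<bar> \<le> \<bar>g x\<bar> * (C1 * (norm h)\<^sup>2)"
      unfolding abs_mult using F1 by (intro mult_left_mono) auto
    ultimately have "\<bar>f (x + h) * g (x + h) - f x * g x - h \<bullet> grad (\<lambda>x. f x * g x) x\<bar>
      \<le> (\<bar>f x\<bar> + A) * (C2 * (norm h)\<^sup>2) + (A * norm h) * (norm h * norm (grad g x)) + \<bar>g x\<bar> * (C1 * (norm h)\<^sup>2)"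
      unfolding e by linarith
    also have "\<dots> = ((\<bar>f x\<bar> + A) * C2 + A * norm (grad g x) + \<bar>g x\<bar> * C1) * (norm h)\<^sup>2"
      by (simp add: algebra_simps power2_eq_square)
    finally show "\<bar>f (x + h) * g (x + h) - f x * g x - h \<bullet> grad (\<lambda>x. f x * g x) x\<bar>
      \<le> ((\<bar>f x\<bar> + A) * C2 + A * norm (grad g x) + \<bar>g x\<bar> * C1) * (norm h)\<^sup>2" .
  qed
qed

text \<open>In time a square is enough, since \<open>time_moduli\<close> asks only for a vanishing
  first derivative. In space the power must be high enough for
  \<open>power_profile_admissible\<close>, because the space points may coincide and the gradient
  then vanishes.\<close>

definition penalty :: "nat \<Rightarrow> (real ^ 'n) \<times> real \<Rightarrow> (real ^ 'n) \<times> real \<Rightarrow> real" where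
  "penalty M \<xi> \<zeta> = norm (fst \<xi> - fst \<zeta>) ^ (2 * M) + (snd \<xi> - snd \<zeta>)\<^sup>2"

lemma penalty_nonneg: "penalty M \<xi> \<zeta> \<ge> 0"
  by (simp add: penalty_def)

lemma penalty_eq_0:
  assumes "penalty M \<xi> \<zeta> = 0"
  shows "\<xi> = \<zeta>"
proof -
  have "norm (fst \<xi> - fst \<zeta>) ^ (2 * M) \<ge> 0" "(snd \<xi> - snd \<zeta>)\<^sup>2 \<ge> 0" by simp_all
  with assms have "norm (fst \<xi> - fst \<zeta>) ^ (2 * M) = 0" "(snd \<xi> - snd \<zeta>)\<^sup>2 = 0"
    unfolding penalty_def by linarith+
  then show ?thesis by (simp add: prod_eq_iff)
qed

lemma continuous_on_penalty: "continuous_on S (\<lambda>z. penalty M (fst z) (snd z))"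
  unfolding penalty_def by (intro continuous_intros)

lemma no_interior_contact:
  fixes u v :: "(real ^ 'n) \<times> real \<Rightarrow> ereal" and j \<epsilon> :: real
  assumes pq: "p > 1" "q > 1" and M: "M \<ge> 2" "(2 * real M - 1) * (q - 1) > 1"
    and u: "viscosity_supersolution p q \<Theta> u" and v: "viscosity_subsolution p q \<Theta> v"
    and \<Theta>: "open \<Theta>" "\<xi>1 \<in> \<Theta>" "\<xi>2 \<in> \<Theta>"
    and v1: "v \<xi>1 = ereal v1" and u2: "u \<xi>2 = ereal u2" and j: "j > 0" and \<epsilon>: "\<epsilon> > 0"
    and min: "\<And>\<xi> \<zeta>. \<xi> \<in> \<Theta> \<Longrightarrow> \<zeta> \<in> \<Theta> \<Longrightarrow>
      ereal (- v1 + u2 + \<epsilon> * snd \<xi>2 + j * penalty M \<xi>1 \<xi>2) \<le> - v \<xi> + (u \<zeta> + ereal (\<epsilon> * snd \<zeta> + j * penalty M \<xi> \<zeta>))"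
  shows False
proof -
  obtain x1 t1 x2 t2 where \<xi>: "\<xi>1 = (x1, t1)" "\<xi>2 = (x2, t2)" by fastforce
  define \<theta> where "\<theta> = 2 * j * (t1 - t2)"
  have v': "viscosity_supersolution p q \<Theta> (\<lambda>\<xi>. - v \<xi>)"
    using v by (simp add: viscosity_subsolution_def)
  show False
  proof (cases "x1 = x2")
    case True
    \<comment> \<open>Freezing one of the two points turns the minimality into a test for the other
      function. Since \<open>x1 = x2\<close>, the spatial penalty is centred at the contact point
      itself, which is the form the degenerate test requires.\<close>
    have "\<theta> - \<epsilon> \<ge> 0"
    proof (rule supersolution_degenerate_test[OF u \<Theta>(1) _ pq(2) less_imp_le[OF j] M])
      show "(x2, t2) \<in> \<Theta>" "u (x2, t2) = ereal u2" using \<Theta>(3) u2 \<xi> by simp_all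
      fix y s assume ys: "(y, s) \<in> \<Theta>"
      have "ereal (- v1 + u2 + \<epsilon> * t2 + j * penalty M \<xi>1 \<xi>2) \<le> ereal (- v1) + (u (y, s) + ereal (\<epsilon> * s + j * penalty M \<xi>1 (y, s)))"
        using min[OF \<Theta>(2) ys] by (simp add: v1[unfolded \<xi>] \<xi>)
      moreover have "u2 + (\<theta> - \<epsilon>) * (s - t2) - j * (norm (y - x2) ^ (2 * M) + (s - t2)\<^sup>2)
        = u2 + \<epsilon> * t2 + j * penalty M \<xi>1 \<xi>2 - (\<epsilon> * s + j * penalty M \<xi>1 (y, s))"
        using M(1) by (simp add: penalty_def \<xi> True \<theta>_def norm_minus_commute power2_eq_square algebra_simps)
      ultimately show "ereal (u2 + (\<theta> - \<epsilon>) * (s - t2) - j * (norm (y - x2) ^ (2 * M) + (s - t2)\<^sup>2)) \<le> u (y, s)"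
        by (cases "u (y, s)") auto
    qed
    moreover have "- \<theta> \<ge> 0"
    proof (rule supersolution_degenerate_test[OF v' \<Theta>(1) _ pq(2) less_imp_le[OF j] M])
      show "(x1, t1) \<in> \<Theta>" "- v (x1, t1) = ereal (- v1)" using \<Theta>(2) v1 \<xi> by simp_all
      fix y s assume ys: "(y, s) \<in> \<Theta>"
      have "ereal (- v1 + u2 + \<epsilon> * t2 + j * penalty M \<xi>1 \<xi>2) \<le> - v (y, s) + ereal (u2 + \<epsilon> * t2 + j * penalty M (y, s) \<xi>2)"
        using min[OF ys \<Theta>(3)] by (simp add: u2[unfolded \<xi>] \<xi> add.assoc)
      moreover have "- v1 + - \<theta> * (s - t1) - j * (norm (y - x1) ^ (2 * M) + (s - t1)\<^sup>2)
        = - v1 + j * penalty M \<xi>1 \<xi>2 - j * penalty M (y, s) \<xi>2"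
        using M(1) by (simp add: penalty_def \<xi> True \<theta>_def power2_eq_square algebra_simps)
      ultimately show "ereal (- v1 + - \<theta> * (s - t1) - j * (norm (y - x1) ^ (2 * M) + (s - t1)\<^sup>2)) \<le> - v (y, s)"
        by (cases "v (y, s)") auto
    qed
    ultimately show False using \<epsilon> by simp
  next
    case False
    define f where "f x = j * (x \<bullet> x) ^ M" for x :: "real ^ 'n"
    have f_alt: "f x = j * norm x ^ (2 * M)" for x
      by (simp add: f_def power_mult power2_norm_eq_inner)
    have fpoly: "real_polynomial_function f"
      unfolding f_def[abs_def] using polynomial_dist_square[of 0]
      by (intro real_polynomial_function.intros(2,4) real_polynomial_function_power) simp
    define \<eta> where "\<eta> = grad f (x1 - x2)"
    obtain C where C: "C \<ge> 0" "\<And>h. norm h \<le> 1 \<Longrightarrow> \<bar>f (x1 - x2 + h) - f (x1 - x2) - h \<bullet> \<eta>\<bar> \<le> C * (norm h)\<^sup>2"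
      using polynomial_taylor_bound[OF fpoly, of "x1 - x2"] unfolding \<eta>_def by blast
    have \<eta>: "\<eta> \<noteq> 0"
    proof -
      have "(f has_derivative (\<lambda>h. (2 * real M * j * ((x1 - x2) \<bullet> (x1 - x2)) ^ (M - 1)) * ((x1 - x2) \<bullet> h))) (at (x1 - x2))"
        unfolding f_def[abs_def] by (auto intro!: derivative_eq_intros simp: inner_commute)
      from partial_deriv_eqI[OF this]
      have "\<eta> = (2 * real M * j * ((x1 - x2) \<bullet> (x1 - x2)) ^ (M - 1)) *\<^sub>R (x1 - x2)"
        by (simp add: \<eta>_def grad_def vec_eq_iff inner_axis)
      then show ?thesis using False j M(1) by simp
    qed
    show False
    \<comment> \<open>With \<open>1/2\<close> on both sides the difference \<open>a - b\<close> has
      norm at most 1, the range of the Taylor bound. The constant \<open>C + j\<close> also covers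
      the square in time.\<close>
    proof (rule no_nondegenerate_contact[OF pq(1) u v \<Theta>(1) _ _ _ _ \<eta> \<epsilon>, where \<delta>="1/2"])
      show "(x1, t1) \<in> \<Theta>" "(x2, t2) \<in> \<Theta>" "v (x1, t1) = ereal v1" "u (x2, t2) = ereal u2"
        using \<Theta> v1 u2 \<xi> by simp_all
      show "0 \<le> C + j" "(0::real) < 1 / 2" using C(1) j by simp_all
      fix a b \<alpha> \<beta>
      assume *: "norm a + \<bar>\<alpha>\<bar> < 1 / 2" "norm b + \<bar>\<beta>\<bar> < 1 / 2" "(x1 + a, t1 + \<alpha>) \<in> \<Theta>" "(x2 + b, t2 + \<beta>) \<in> \<Theta>"
      have "norm (a - b) \<le> 1" using norm_triangle_ineq4[of a b] *(1,2) by linarith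
      then have "f (x1 - x2 + (a - b)) - f (x1 - x2) \<le> \<eta> \<bullet> (a - b) + C * (norm (a - b))\<^sup>2"
        using C(2)[of "a - b"] by (simp add: inner_commute abs_le_iff)
      moreover have "x1 - x2 + (a - b) = x1 + a - (x2 + b)" by simp
      ultimately have fl: "j * norm (x1 + a - (x2 + b)) ^ (2 * M) - j * norm (x1 - x2) ^ (2 * M) \<le> \<eta> \<bullet> (a - b) + C * (norm (a - b))\<^sup>2"
        by (simp only: f_alt)
      have "j * (t1 + \<alpha> - (t2 + \<beta>))\<^sup>2 - j * (t1 - t2)\<^sup>2 = \<theta> * (\<alpha> - \<beta>) + j * (\<alpha> - \<beta>)\<^sup>2"
        by (simp add: \<theta>_def power2_eq_square algebra_simps)
      moreover have "C * (norm (a - b))\<^sup>2 + j * (\<alpha> - \<beta>)\<^sup>2 \<le> (C + j) * ((norm (a - b))\<^sup>2 + (\<alpha> - \<beta>)\<^sup>2)"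
        using C(1) j by (simp add: algebra_simps)
      ultimately have pen: "j * penalty M (x1 + a, t1 + \<alpha>) (x2 + b, t2 + \<beta>) - j * penalty M \<xi>1 \<xi>2
        \<le> \<eta> \<bullet> (a - b) + \<theta> * (\<alpha> - \<beta>) + (C + j) * ((norm (a - b))\<^sup>2 + (\<alpha> - \<beta>)\<^sup>2)"
        using fl unfolding penalty_def \<xi> fst_conv snd_conv distrib_left by linarith
      have "v (x1 + a, t1 + \<alpha>) \<noteq> \<infinity>" "u (x2 + b, t2 + \<beta>) \<noteq> -\<infinity>"
        using u v' *(3,4) unfolding viscosity_supersolution_def by force+
      then show "v (x1 + a, t1 + \<alpha>) \<le> u (x2 + b, t2 + \<beta>) + ereal (v1 - u2 + \<epsilon> * \<beta> + \<eta> \<bullet> (a - b) + \<theta> * (\<alpha> - \<beta>)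
         + (C + j) * ((norm (a - b))\<^sup>2 + (\<alpha> - \<beta>)\<^sup>2))"
        using min[OF *(3,4)] pen
        by (cases "v (x1 + a, t1 + \<alpha>)"; cases "u (x2 + b, t2 + \<beta>)") (auto simp: \<xi> algebra_simps)
    qed
  qed
qed

lemma seq_lsc_on_bounded_below:
  assumes "compact K" "seq_lsc_on K f" "\<And>\<xi>. \<xi> \<in> K \<Longrightarrow> f \<xi> \<noteq> -\<infinity>"
  obtains b where "\<And>\<xi>. \<xi> \<in> K \<Longrightarrow> ereal b \<le> f \<xi>"
proof (cases "K = {}")
  case False
  then obtain \<xi> where \<xi>: "\<xi> \<in> K" "\<And>\<zeta>. \<zeta> \<in> K \<Longrightarrow> f \<xi> \<le> f \<zeta>"
    using seq_lsc_on_attains_inf[OF assms(1) False assms(2)] by blast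
  \<comment> \<open>If the minimum is \<infinity>, \<open>real_of_ereal\<close> returns 0, which is
    still a lower bound.\<close>
  have "ereal (real_of_ereal (f \<xi>)) \<le> f \<xi>"
    using assms(3)[OF \<xi>(1)] by (cases "f \<xi>") auto
  then show ?thesis using \<xi>(2) that order_trans by blast
qed (use that in blast)

text \<open>Since \<open>U\<close> and \<open>W\<close> are bounded below on \<open>K\<close>, the
  penalty at the minimisers is O(1/j), so their limit points lie on the diagonal. By lower
  semicontinuity \<open>W + U\<close> is negative there, which by \<open>bd\<close> places the limit
  in \<open>G\<close>; as \<open>G\<close> is open, late minimisers lie in \<open>G\<close> as
  well.\<close>

lemma doubling:
  fixes U W :: "(real ^ 'n) \<times> real \<Rightarrow> ereal"
  assumes K: "compact K" and lsc: "seq_lsc_on K U" "seq_lsc_on K W"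
    and fin: "\<And>\<xi>. \<xi> \<in> K \<Longrightarrow> U \<xi> \<noteq> -\<infinity>" "\<And>\<xi>. \<xi> \<in> K \<Longrightarrow> W \<xi> \<noteq> -\<infinity>"
    and \<xi>0: "\<xi>0 \<in> K" "W \<xi>0 + U \<xi>0 < 0"
    and G: "open G" and bd: "\<And>\<xi>. \<xi> \<in> K \<Longrightarrow> \<xi> \<notin> G \<Longrightarrow> W \<xi> + U \<xi> \<ge> 0" and M: "M > 0"
  shows "\<exists>j>0. \<exists>\<xi>1\<in>K \<inter> G. \<exists>\<xi>2\<in>K \<inter> G. W \<xi>1 + (U \<xi>2 + ereal (j * penalty M \<xi>1 \<xi>2)) < 0 \<and>
    (\<forall>\<xi>\<in>K. \<forall>\<zeta>\<in>K. W \<xi>1 + (U \<xi>2 + ereal (j * penalty M \<xi>1 \<xi>2)) \<le> W \<xi> + (U \<zeta> + ereal (j * penalty M \<xi> \<zeta>)))"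
proof -
  define pen where "pen z = penalty M (fst z) (snd z)" for z :: "((real ^ 'n) \<times> real) \<times> ((real ^ 'n) \<times> real)"
  define F where "F j z = W (fst z) + (U (snd z) + ereal (j * pen z))" for j z
  define KK where "KK = K \<times> K"
  have KK: "compact KK" unfolding KK_def by (rule compact_Times[OF K K])
  have z0: "(\<xi>0, \<xi>0) \<in> KK" using \<xi>0(1) by (simp add: KK_def)
  have pen_nonneg: "pen z \<ge> 0" for z unfolding pen_def by (rule penalty_nonneg)
  have pen_cont: "continuous_on KK pen"
    unfolding pen_def[abs_def] by (rule continuous_on_penalty)
  have F_lsc: "seq_lsc_on KK (F j)" for j
  proof -
    have 1: "seq_lsc_on KK (\<lambda>z. W (fst z))"
      by (rule seq_lsc_on_compose[OF lsc(2)]) (auto simp: KK_def intro: continuous_intros)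
    have 2: "seq_lsc_on KK (\<lambda>z. U (snd z))"
      by (rule seq_lsc_on_compose[OF lsc(1)]) (auto simp: KK_def intro: continuous_intros)
    have 3: "seq_lsc_on KK (\<lambda>z. ereal (j * pen z))"
      by (rule seq_lsc_on_continuous) (intro continuous_intros pen_cont)
    have 4: "seq_lsc_on KK (\<lambda>z. U (snd z) + ereal (j * pen z))"
      by (rule seq_lsc_on_add[OF 2 3]) (auto simp: KK_def fin)
    show ?thesis
      unfolding F_def[abs_def]
      by (rule seq_lsc_on_add[OF 1 4]) (auto simp: KK_def fin)
  qed
  have "\<forall>n::nat. \<exists>z\<in>KK. \<forall>w\<in>KK. F (real (Suc n)) z \<le> F (real (Suc n)) w"
    using seq_lsc_on_attains_inf[OF KK _ F_lsc] z0 by blast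
  then obtain Z where Z: "\<And>n. Z n \<in> KK" "\<And>n w. w \<in> KK \<Longrightarrow> F (real (Suc n)) (Z n) \<le> F (real (Suc n)) w"
    by metis
  define e0 where "e0 = W \<xi>0 + U \<xi>0"
  have "pen (\<xi>0, \<xi>0) = 0" using M by (simp add: pen_def penalty_def)
  then have Fe0: "F (real (Suc n)) (Z n) \<le> e0" for n
    using Z(2)[OF z0, of n] by (simp add: F_def e0_def)
  obtain b1 where b1: "\<And>\<xi>. \<xi> \<in> K \<Longrightarrow> ereal b1 \<le> U \<xi>"
    using seq_lsc_on_bounded_below[OF K lsc(1) fin(1)] by blast
  obtain b2 where b2: "\<And>\<xi>. \<xi> \<in> K \<Longrightarrow> ereal b2 \<le> W \<xi>"
    using seq_lsc_on_bounded_below[OF K lsc(2) fin(2)] by blast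
  have penle: "pen (Z n) \<le> (- b1 - b2) * inverse (real (Suc n))" for n
  proof -
    have "fst (Z n) \<in> K" "snd (Z n) \<in> K" using Z(1)[of n] by (auto simp: KK_def)
    then have "ereal b2 + (ereal b1 + ereal (real (Suc n) * pen (Z n))) \<le> F (real (Suc n)) (Z n)"
      unfolding F_def by (intro add_mono b1 b2 order_refl)
    also have "\<dots> < 0" using Fe0[of n] \<xi>0(2) by (simp add: e0_def)
    finally have "real (Suc n) * pen (Z n) \<le> - b1 - b2" by simp
    then show ?thesis by (simp add: field_simps del: of_nat_Suc)
  qed
  obtain z r where r: "z \<in> KK" "strict_mono r" "(Z \<circ> r) \<longlonglongrightarrow> z"
    using KK Z(1) unfolding compact_def by metis
  have Zr: "(Z \<circ> r) n \<in> KK" for n using Z(1) by simp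
  have "(\<lambda>n. pen ((Z \<circ> r) n)) \<longlonglongrightarrow> pen z"
    using pen_cont r(1,3) Zr unfolding continuous_on_sequentially by (auto simp: o_def)
  moreover have "(\<lambda>n. (- b1 - b2) * inverse (real (Suc (r n)))) \<longlonglongrightarrow> 0"
    using LIMSEQ_subseq_LIMSEQ[OF tendsto_mult_right_zero[OF LIMSEQ_inverse_real_of_nat, of "- b1 - b2"] r(2)]
    by (simp only: o_def)
  ultimately have "pen z \<le> 0"
    by (rule LIMSEQ_le) (use penle in auto)
  then have zz: "snd z = fst z"
    using pen_nonneg[of z] penalty_eq_0[of M "fst z" "snd z"] by (simp add: pen_def)
  \<comment> \<open>The functional without penalty lies below every penalised one, so the limit can
    be taken in a functional that does not vary with \<open>n\<close>.\<close>
  have "F 0 z \<le> liminf (\<lambda>n. F 0 ((Z \<circ> r) n))"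
    by (rule seq_lsc_onD[OF F_lsc r(1) Zr r(3)])
  also have "\<dots> \<le> limsup (\<lambda>n. F 0 ((Z \<circ> r) n))" by (rule Liminf_le_Limsup) simp
  also have "\<dots> \<le> e0"
  proof (rule Limsup_bounded, intro always_eventually allI)
    fix n
    have "F 0 ((Z \<circ> r) n) \<le> F (real (Suc (r n))) (Z (r n))"
      unfolding F_def o_def using pen_nonneg[of "Z (r n)"]
      by (intro add_left_mono) (simp del: of_nat_Suc)
    then show "F 0 ((Z \<circ> r) n) \<le> e0" using Fe0 order_trans by blast
  qed
  finally have "W (fst z) + U (fst z) < 0"
    using \<xi>0(2) by (simp add: F_def zz e0_def)
  moreover have "fst z \<in> K" using r(1) by (auto simp: KK_def)
  ultimately have zG: "fst z \<in> G"
    using bd[of "fst z"] leD by blast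
  have "\<forall>\<^sub>F n in sequentially. fst ((Z \<circ> r) n) \<in> G"
    using topological_tendstoD[OF tendsto_fst[OF r(3)] G zG] .
  moreover have "\<forall>\<^sub>F n in sequentially. snd ((Z \<circ> r) n) \<in> G"
    using topological_tendstoD[OF tendsto_snd[OF r(3)] G] zG by (simp add: zz)
  ultimately have "\<forall>\<^sub>F n in sequentially. fst ((Z \<circ> r) n) \<in> G \<and> snd ((Z \<circ> r) n) \<in> G"
    by (rule eventually_conj)
  then obtain n where n: "fst (Z (r n)) \<in> G" "snd (Z (r n)) \<in> G"
    unfolding eventually_sequentially by auto
  have K12: "fst (Z (r n)) \<in> K" "snd (Z (r n)) \<in> K" using Z(1)[of "r n"] by (auto simp: KK_def)
  have lt: "W (fst (Z (r n))) + (U (snd (Z (r n))) + ereal (real (Suc (r n)) * penalty M (fst (Z (r n))) (snd (Z (r n))))) < 0"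
    using Fe0[of "r n"] \<xi>0(2) unfolding F_def pen_def e0_def by (rule le_less_trans)
  have "W (fst (Z (r n))) + (U (snd (Z (r n))) + ereal (real (Suc (r n)) * penalty M (fst (Z (r n))) (snd (Z (r n)))))
      \<le> W \<xi> + (U \<zeta> + ereal (real (Suc (r n)) * penalty M \<xi> \<zeta>))" if "\<xi> \<in> K" "\<zeta> \<in> K" for \<xi> \<zeta>
    using Z(2)[of "(\<xi>, \<zeta>)" "r n"] that by (simp only: F_def pen_def KK_def mem_Times_iff fst_conv snd_conv simp_thms)
  with lt show ?thesis
    using n K12
    by (intro exI[of _ "real (Suc (r n))"] conjI, simp)
       (rule bexI[of _ "fst (Z (r n))"], rule bexI[of _ "snd (Z (r n))"], simp_all del: of_nat_Suc)
qed

theorem theorem3p1: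
  fixes p q :: real
    and \<Theta> :: "((real ^ 'n) \<times> real) set"
    and u v :: "(real ^ 'n) \<times> real \<Rightarrow> ereal"
  assumes "p > 1" and "q > 1"
    and "open \<Theta>" and "bounded \<Theta>"
    and "viscosity_supersolution p q \<Theta> u"
    and "viscosity_subsolution p q \<Theta> v"
    and "\<And>\<xi>. \<xi> \<in> frontier \<Theta> \<Longrightarrow>
           Limsup (at \<xi> within \<Theta>) v \<noteq> \<infinity> \<and>
           Limsup (at \<xi> within \<Theta>) v \<le> Liminf (at \<xi> within \<Theta>) u \<and>
           Liminf (at \<xi> within \<Theta>) u \<noteq> -\<infinity>"
  shows "\<forall>\<xi>\<in>\<Theta>. v \<xi> \<le> u \<xi>"
proof (rule ccontr)
  assume "\<not> ?thesis"
  then obtain \<xi>0 where \<xi>0: "\<xi>0 \<in> \<Theta>" "u \<xi>0 < v \<xi>0" by (auto simp: not_le)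
  have v': "viscosity_supersolution p q \<Theta> (\<lambda>\<xi>. - v \<xi>)"
    using assms(6) by (simp add: viscosity_subsolution_def)
  have un: "u \<xi> \<noteq> -\<infinity>" and vn: "v \<xi> \<noteq> \<infinity>" if "\<xi> \<in> \<Theta>" for \<xi>
  proof -
    have "\<forall>\<xi>\<in>\<Theta>. u \<xi> \<noteq> -\<infinity>" "\<forall>\<xi>\<in>\<Theta>. - v \<xi> \<noteq> -\<infinity>"
      using assms(5) v' unfolding viscosity_supersolution_def by blast+
    with that show "u \<xi> \<noteq> -\<infinity>" "v \<xi> \<noteq> \<infinity>" by auto
  qed
  obtain u0 v0 where u0: "u \<xi>0 = ereal u0" and v0: "v \<xi>0 = ereal v0" and uv0: "u0 < v0"
    using un[OF \<xi>0(1)] vn[OF \<xi>0(1)] \<xi>0(2) by (cases "u \<xi>0"; cases "v \<xi>0") auto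
  define K where "K = closure \<Theta>"
  have K: "compact K" unfolding K_def using assms(4) by (rule compact_closure[THEN iffD2])
  have \<Theta>K: "\<Theta> \<subseteq> K" unfolding K_def by (rule closure_subset)
  have Kfr: "\<xi> \<in> frontier \<Theta>" if "\<xi> \<in> K" "\<xi> \<notin> \<Theta>" for \<xi>
    using that assms(3) by (simp add: K_def frontier_def interior_open)
  obtain B where B: "B > 0" "\<And>\<xi>. \<xi> \<in> K \<Longrightarrow> norm \<xi> \<le> B"
    using compact_imp_bounded[OF K] unfolding bounded_pos by blast
  have tB: "\<bar>snd \<xi>\<bar> \<le> B" if "\<xi> \<in> K" for \<xi>
    using B(2)[OF that] norm_snd_le[of "snd \<xi>" "fst \<xi>"] by simp
  \<comment> \<open>On \<open>K\<close> the perturbation \<open>\<epsilon> * (snd \<xi> + B)\<close>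
    lies between 0 and \<open>2 * B * \<epsilon>\<close>, half of \<open>v0 - u0\<close>. It makes
    the supersolution strict in time, respects the boundary inequality, and keeps the violation at
    \<xi>0.\<close>
  define \<epsilon> where "\<epsilon> = (v0 - u0) / (4 * B)"
  have \<epsilon>: "\<epsilon> > 0" using B(1) uv0 by (simp add: \<epsilon>_def)
  define W where "W = lsc_extension \<Theta> (\<lambda>\<xi>. - v \<xi>)"
  define U0 where "U0 = lsc_extension \<Theta> u"
  define U where "U \<xi> = U0 \<xi> + ereal (\<epsilon> * (snd \<xi> + B))" for \<xi>
  have W\<Theta>: "W \<xi> = - v \<xi>" and U0\<Theta>: "U0 \<xi> = u \<xi>" if "\<xi> \<in> \<Theta>" for \<xi>
    using that by (simp_all add: W_def U0_def lsc_extension_def)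
  have Wfr: "W \<xi> = - Limsup (at \<xi> within \<Theta>) v" and U0fr: "U0 \<xi> = Liminf (at \<xi> within \<Theta>) u" if "\<xi> \<notin> \<Theta>" for \<xi>
    using that by (simp_all add: W_def U0_def lsc_extension_def ereal_Liminf_uminus)
  \<comment> \<open>On the frontier this is the assumption that the upper limit of \<open>v\<close>
    is not \<infinity>; together with \<open>U0n\<close> it keeps all later sums clear of
    \<infinity> - \<infinity>.\<close>
  have Wn: "W \<xi> \<noteq> -\<infinity>" if "\<xi> \<in> K" for \<xi>
    using vn[of \<xi>] assms(7)[OF Kfr[OF that]] by (cases "\<xi> \<in> \<Theta>") (auto simp: W\<Theta> Wfr ereal_uminus_eq_reorder)
  have U0n: "U0 \<xi> \<noteq> -\<infinity>" if "\<xi> \<in> K" for \<xi>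
    using un[of \<xi>] assms(7)[OF Kfr[OF that]] by (cases "\<xi> \<in> \<Theta>") (auto simp: U0\<Theta> U0fr)
  have W_lsc: "seq_lsc_on K W"
    unfolding K_def W_def using v' by (intro seq_lsc_on_lsc_extension) (simp add: viscosity_supersolution_def)
  have U0_lsc: "seq_lsc_on K U0"
    unfolding K_def U0_def using assms(5) by (intro seq_lsc_on_lsc_extension) (simp add: viscosity_supersolution_def)
  have "seq_lsc_on K (\<lambda>\<xi>. ereal (\<epsilon> * (snd \<xi> + B)))"
    by (intro seq_lsc_on_continuous continuous_intros)
  from seq_lsc_on_add[OF U0_lsc this] have U_lsc: "seq_lsc_on K U"
    unfolding U_def[abs_def] using U0n by simp
  have Un: "U \<xi> \<noteq> -\<infinity>" if "\<xi> \<in> K" for \<xi>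
    using U0n[OF that] by (simp add: U_def)
  have neg: "W \<xi>0 + U \<xi>0 < 0"
  proof -
    have "\<epsilon> * (snd \<xi>0 + B) \<le> \<epsilon> * (2 * B)"
      using tB[of \<xi>0] \<xi>0(1) \<Theta>K \<epsilon> by (intro mult_left_mono) (auto simp: abs_le_iff)
    also have "\<dots> = (v0 - u0) / 2" using B(1) by (simp add: \<epsilon>_def)
    finally show ?thesis using uv0 by (simp add: W\<Theta> U_def U0\<Theta> \<xi>0(1) u0 v0)
  qed
  have bd: "W \<xi> + U \<xi> \<ge> 0" if "\<xi> \<in> K" "\<xi> \<notin> \<Theta>" for \<xi>
  proof -
    have "0 \<le> \<epsilon> * (snd \<xi> + B)" using tB[OF that(1)] \<epsilon> by (simp add: abs_le_iff)
    then show ?thesis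
      using assms(7)[OF Kfr[OF that]] unfolding U_def Wfr[OF that(2)] U0fr[OF that(2)]
      by (cases "Limsup (at \<xi> within \<Theta>) v"; cases "Liminf (at \<xi> within \<Theta>) u") auto
  qed
  obtain M :: nat where M: "M \<ge> 2" "(2 * real M - 1) * (q - 1) > 1"
  proof -
    obtain m :: nat where m: "1 / (q - 1) < real m" using reals_Archimedean2 by blast
    have "1 < real m * (q - 1)" using m assms(2) by (simp add: field_simps)
    also have "\<dots> \<le> (2 * real (m + 2) - 1) * (q - 1)" using assms(2) by (intro mult_right_mono) auto
    finally show ?thesis using that[of "m + 2"] by simp
  qed
  obtain j \<xi>1 \<xi>2 where j: "j > 0" and \<xi>1: "\<xi>1 \<in> \<Theta>" and \<xi>2: "\<xi>2 \<in> \<Theta>"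
    and lt: "W \<xi>1 + (U \<xi>2 + ereal (j * penalty M \<xi>1 \<xi>2)) < 0"
    and min: "\<And>\<xi> \<zeta>. \<xi> \<in> K \<Longrightarrow> \<zeta> \<in> K \<Longrightarrow> W \<xi>1 + (U \<xi>2 + ereal (j * penalty M \<xi>1 \<xi>2)) \<le> W \<xi> + (U \<zeta> + ereal (j * penalty M \<xi> \<zeta>))"
  proof -
    have "\<xi>0 \<in> K" "M > 0" using \<xi>0(1) \<Theta>K M(1) by auto
    from doubling[OF K U_lsc W_lsc Un Wn this(1) neg assms(3) bd this(2)] that show ?thesis by blast
  qed
  obtain v1 where v1: "v \<xi>1 = ereal v1"
    using lt vn[OF \<xi>1] un[OF \<xi>2] by (cases "v \<xi>1"; cases "u \<xi>2") (auto simp: W\<Theta>[OF \<xi>1] U_def U0\<Theta>[OF \<xi>2])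
  obtain u2 where u2: "u \<xi>2 = ereal u2"
    using lt vn[OF \<xi>1] un[OF \<xi>2] by (cases "v \<xi>1"; cases "u \<xi>2") (auto simp: W\<Theta>[OF \<xi>1] U_def U0\<Theta>[OF \<xi>2])
  show False
  proof (rule no_interior_contact[OF assms(1,2) M assms(5,6,3) \<xi>1 \<xi>2 v1 u2 j \<epsilon>])
    \<comment> \<open>The shift \<open>\<epsilon> * B\<close> only served to make the perturbation
      nonnegative on \<open>K\<close>; it occurs on both sides and cancels.\<close>
    fix \<xi> \<zeta> assume \<xi>\<zeta>: "\<xi> \<in> \<Theta>" "\<zeta> \<in> \<Theta>"
    then have "ereal (- v1) + ((ereal u2 + ereal (\<epsilon> * (snd \<xi>2 + B))) + ereal (j * penalty M \<xi>1 \<xi>2))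
      \<le> - v \<xi> + ((u \<zeta> + ereal (\<epsilon> * (snd \<zeta> + B))) + ereal (j * penalty M \<xi> \<zeta>))"
      using min[of \<xi> \<zeta>] \<Theta>K by (auto simp: U_def W\<Theta> U0\<Theta> \<xi>1 \<xi>2 v1 u2)
    then show "ereal (- v1 + u2 + \<epsilon> * snd \<xi>2 + j * penalty M \<xi>1 \<xi>2) \<le> - v \<xi> + (u \<zeta> + ereal (\<epsilon> * snd \<zeta> + j * penalty M \<xi> \<zeta>))"
      using vn[OF \<xi>\<zeta>(1)] un[OF \<xi>\<zeta>(2)]
      by (cases "v \<xi>"; cases "u \<zeta>") (auto simp: algebra_simps)
  qed
qed

end
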